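(* If the family $\{f_t\}_t$ is Newton-admissible, then for all sufficiently small $t$ the Milnor fibration of $f_t$ at $\mathbf{0}\in\mathbb{C}^n$ is isomorphic (as a fibration) to the Milnor fibration of $f_0$ at $\mathbf{0}$.
   Context: Let $(t,\mathbf{z})=(t,z_1,\ldots,z_n)$ be coordinates on $\mathbb{C}\times\mathbb{C}^n$. For $k\in K_0:=\{1,\ldots,k_0\}$ let $f^k\colon\mathbb{C}\times\mathbb{C}^n\to\mathbb{C}$ be a non-constant polynomial with $f^k(t,\mathbf{0})=0$ for all $t$; put $f:=f^1\cdots f^{k_0}$, $f_t(\mathbf{z}):=f(t,\mathbf{z})$, $f^k_t(\mathbf{z}):=f^k(t,\mathbf{z})$. All statements concern germs at the origin. The Milnor fibration of $f_t$ at $\mathbf 0$ is $f_t\colon B_\varepsilon\cap f_t^{-1}(D^*_\delta)\to D^*_\delta$ for $0<\delta\ll\varepsilon\ll1$ ($B_\varepsilon$ closed ball in $\mathbb C^n$, $D^*_\delta$ punctured disc). Newton data: for a polynomial $g(\mathbf{z})=\sum_\alpha c_\alpha\mathbf{z}^\alpha$ with $g(\mathbf{0})=0$, $\Gamma_+(g)$ is the convex hull in $\mathbb{R}^n_+$ of $\bigcup_{c_\alpha\neq0}(\alpha+\mathbb{R}^n_+)$, and the Newton boundary $\Gamma(g)$ is the union of its compact faces. For a weight vector $\mathbf{w}=(w_1,\ldots,w_n)\in\mathbb{N}^n\setminus\{\mathbf{0}\}$ (nonnegative integers), $d(\mathbf{w};g):=\min\{\sum_i w_ix_i : x\in\Gamma_+(g)\}$,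 $\Delta(\mathbf{w};g)$ is the face of $\Gamma_+(g)$ where this minimum is attained, $g_{\mathbf{w}}:=\sum_{\alpha\in\Delta(\mathbf{w};g)}c_\alpha\mathbf{z}^\alpha$ is the face function, and $I(\mathbf{w}):=\{i: w_i=0\}$. $\mathbf w$ is positive if all $w_i>0$. For $I\subseteq\{1,\ldots,n\}$, $\mathbb{C}^I:=\{\mathbf{z}: z_i=0 \text{ for } i\notin I\}$ and $\mathbb{C}^{*I}:=\{\mathbf{z}: z_i=0\iff i\notin I\}$; $\mathbb{C}^{*n}=\mathbb{C}^{*\{1,\ldots,n\}}$. $\mathcal{V}_g$ is the set of $I$ with $g|_{\mathbb{C}^I}\equiv0$. For $i_1,\ldots,i_m$ and $u_{i_j}\in\mathbb{C}^*$, $\mathbb{C}^{*n}(u_{i_1},\ldots,u_{i_m}):=\{\mathbf{z}\in\mathbb{C}^{*n}: z_{i_j}=u_{i_j},\ 1\le j\le m\}$. Non-degenerate complete intersection: polynomials $g^1,\ldots,g^p$ vanishing at $\mathbf 0$ define a non-degenerate complete intersection germ $V(g^1,\ldots,g^p)$ if for every positive weight vector $\mathbf{w}$, the $p$-form $dg^1_{\mathbf{w}}\wedge\cdots\wedge dg^p_{\mathbf{w}}$ is nowhere zero on $V^*(g^1_{\mathbf{w}},\ldots,g^p_{\mathbf{w}}):=\{\mathbf{z}\in\mathbb{C}^{*n}: g^1_{\mathbf{w}}(\mathbf{z})=\cdots=g^p_{\mathbf{w}}(\mathbf{z})=0\}$. Local tameness: $R>0$ is a radius of local tameness of $\{g^1,\ldots,g^p\}$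 if for every nonempty $I=\{i_1,\ldots,i_m\}\in\mathcal{V}_{g^1}\cap\cdots\cap\mathcal{V}_{g^p}$, every $\mathbf{w}\in\mathbb{N}^n\setminus\{\mathbf 0\}$ with $I(\mathbf{w})=I$ and every $u_{i_1},\ldots,u_{i_m}\in\mathbb{C}^*$ with $\sum_j|u_{i_j}|^2<R$, the set $V^*(g^1_{\mathbf{w}},\ldots,g^p_{\mathbf{w}})\cap\mathbb{C}^{*n}(u_{i_1},\ldots,u_{i_m})$ is a reduced non-singular complete intersection in $\mathbb{C}^{*n}(u_{i_1},\ldots,u_{i_m})$, i.e. the differentials of $g^1_{\mathbf{w}},\ldots,g^p_{\mathbf{w}}$ with respect to the variables $(z_i)_{i\notin I}$ are linearly independent at each of its points; the germ is locally tame if such $R$ exists. Newton-admissible: $\{f_t\}_t$ is Newton-admissible if there is $R>0$ such that for all sufficiently small $t$: (i) for each $k\in K_0$, $\Gamma(f^k_t)$ is independent of $t$; (ii) for every nonempty $\{k_1,\ldots,k_p\}\subseteq K_0$, $V(f^{k_1}_t,\ldots,f^{k_p}_t)$ is a non-degenerate, locally tame complete intersection germ having a radius of local tameness greater than $R$ ($R$ independent of $t$ and of the subset). *)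

theory Defs
  imports "HOL-Analysis.Analysis"
begin

text \<open>Polynomials in z = (z_1,...,z_n) (n = CARD('n)) are represented by their
coefficient functions  g :: nat^'n \<Rightarrow> complex  with finite support
(g \<alpha> is the coefficient of z^\<alpha>).  Polynomials in (t,z) are represented by
c :: nat \<Rightarrow> nat^'n \<Rightarrow> complex, c j \<alpha> being the coefficient of t^j z^\<alpha>.\<close>

definition zsupp :: "(nat^'n \<Rightarrow> complex) \<Rightarrow> (nat^'n) set" where
  "zsupp g = {\<alpha>. g \<alpha> \<noteq> 0}"

definition tzsupp :: "(nat \<Rightarrow> nat^'n \<Rightarrow> complex) \<Rightarrow> (nat \<times> (nat^'n)) set" where
  "tzsupp c = {(j,\<alpha>). c j \<alpha> \<noteq> 0}"

definition zmonom :: "nat^'n \<Rightarrow> complex^'n \<Rightarrow> complex" where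
  "zmonom \<alpha> z = (\<Prod>i\<in>UNIV. (z$i) ^ (\<alpha>$i))"

definition zeval :: "(nat^'n \<Rightarrow> complex) \<Rightarrow> complex^'n \<Rightarrow> complex" where
  "zeval g z = (\<Sum>\<alpha>\<in>zsupp g. g \<alpha> * zmonom \<alpha> z)"

definition tzeval :: "(nat \<Rightarrow> nat^'n \<Rightarrow> complex) \<Rightarrow> complex \<Rightarrow> complex^'n \<Rightarrow> complex" where
  "tzeval c t z = (\<Sum>(j,\<alpha>)\<in>tzsupp c. c j \<alpha> * t ^ j * zmonom \<alpha> z)"

text \<open>The polynomial g_t(z) = c(t,z) in z, for fixed t.\<close>
definition tslice :: "(nat \<Rightarrow> nat^'n \<Rightarrow> complex) \<Rightarrow> complex \<Rightarrow> nat^'n \<Rightarrow> complex" where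
  "tslice c t \<alpha> = (\<Sum>j\<in>{j. c j \<alpha> \<noteq> 0}. c j \<alpha> * t ^ j)"

definition is_tzpoly :: "(nat \<Rightarrow> nat^'n \<Rightarrow> complex) \<Rightarrow> bool" where
  "is_tzpoly c \<longleftrightarrow> finite (tzsupp c)"

definition nonconstant_tzpoly :: "(nat \<Rightarrow> nat^'n \<Rightarrow> complex) \<Rightarrow> bool" where
  "nonconstant_tzpoly c \<longleftrightarrow> (\<exists>t1 t2 z1 z2. tzeval c t1 z1 \<noteq> tzeval c t2 z2)"

definition real_of_exp :: "nat^'n \<Rightarrow> real^'n" where
  "real_of_exp \<alpha> = (\<chi> i. real (\<alpha>$i))"

text \<open>Newton polyhedron \<Gamma>_+(g) and Newton boundary \<Gamma>(g) (union of compact faces).\<close>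
definition newton_polyhedron :: "(nat^'n \<Rightarrow> complex) \<Rightarrow> (real^'n) set" where
  "newton_polyhedron g =
     convex hull (\<Union>\<alpha>\<in>zsupp g. {x. \<forall>i. real (\<alpha>$i) \<le> x$i})"

definition newton_boundary :: "(nat^'n \<Rightarrow> complex) \<Rightarrow> (real^'n) set" where
  "newton_boundary g = \<Union>{F. F face_of newton_polyhedron g \<and> compact F}"

definition wdot :: "nat^'n \<Rightarrow> real^'n \<Rightarrow> real" where
  "wdot w x = (\<Sum>i\<in>UNIV. real (w$i) * x$i)"

definition newton_d :: "nat^'n \<Rightarrow> (nat^'n \<Rightarrow> complex) \<Rightarrow> real" where
  "newton_d w g = Inf (wdot w ` newton_polyhedron g)"

definition newton_Delta :: "nat^'n \<Rightarrow> (nat^'n \<Rightarrow> complex) \<Rightarrow> (real^'n) set" where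
  "newton_Delta w g = {x\<in>newton_polyhedron g. wdot w x = newton_d w g}"

text \<open>Face function g_w.\<close>
definition face_fun :: "nat^'n \<Rightarrow> (nat^'n \<Rightarrow> complex) \<Rightarrow> nat^'n \<Rightarrow> complex" where
  "face_fun w g \<alpha> = (if real_of_exp \<alpha> \<in> newton_Delta w g then g \<alpha> else 0)"

definition positive_weight :: "nat^'n \<Rightarrow> bool" where
  "positive_weight w \<longleftrightarrow> (\<forall>i. 0 < w$i)"

definition zero_index :: "nat^'n \<Rightarrow> 'n set" where
  "zero_index w = {i. w$i = 0}"

text \<open>Complex partial derivative  \<partial>g/\<partial>z_i  at z (of the polynomial function).\<close>
definition zpartial :: "(nat^'n \<Rightarrow> complex) \<Rightarrow> 'n \<Rightarrow> complex^'n \<Rightarrow> complex" where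
  "zpartial g i z = deriv (\<lambda>s. zeval g (\<chi> l. if l = i then s else z$l)) (z$i)"

text \<open>\<C>^{*n} and V^*(g^k, k \<in> S).\<close>
definition torus :: "(complex^'n) set" where
  "torus = {z. \<forall>i. z$i \<noteq> 0}"

definition Vstar :: "nat set \<Rightarrow> (nat \<Rightarrow> nat^'n \<Rightarrow> complex) \<Rightarrow> (complex^'n) set" where
  "Vstar S G = {z\<in>torus. \<forall>k\<in>S. zeval (G k) z = 0}"

text \<open>The differentials of G k (k \<in> S), taken w.r.t. the variables z_i with i \<notin> I,
  are C-linearly independent at z.\<close>
definition diffs_independent ::
  "'n set \<Rightarrow> nat set \<Rightarrow> (nat \<Rightarrow> nat^'n \<Rightarrow> complex) \<Rightarrow> complex^'n \<Rightarrow> bool" where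
  "diffs_independent I S G z \<longleftrightarrow>
     (\<forall>c :: nat \<Rightarrow> complex.
        (\<forall>i. i \<notin> I \<longrightarrow> (\<Sum>k\<in>S. c k * zpartial (G k) i z) = 0) \<longrightarrow> (\<forall>k\<in>S. c k = 0))"

text \<open>Non-degenerate complete intersection V(G k, k \<in> S).\<close>
definition nondegenerate_ci :: "nat set \<Rightarrow> (nat \<Rightarrow> nat^'n \<Rightarrow> complex) \<Rightarrow> bool" where
  "nondegenerate_ci S G \<longleftrightarrow>
     (\<forall>w. positive_weight w \<longrightarrow>
        (\<forall>z\<in>Vstar S (\<lambda>k. face_fun w (G k)). diffs_independent {} S (\<lambda>k. face_fun w (G k)) z))"

text \<open>\<V>_g: the coordinate subspaces C^I on which g vanishes identically.\<close>
definition vanishing_coord :: "(nat^'n \<Rightarrow> complex) \<Rightarrow> ('n set) set" where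
  "vanishing_coord g = {I. \<forall>z. (\<forall>i. i \<notin> I \<longrightarrow> z$i = 0) \<longrightarrow> zeval g z = 0}"

definition tameness_radius :: "real \<Rightarrow> nat set \<Rightarrow> (nat \<Rightarrow> nat^'n \<Rightarrow> complex) \<Rightarrow> bool" where
  "tameness_radius R S G \<longleftrightarrow> 0 < R \<and>
     (\<forall>I. I \<noteq> {} \<and> (\<forall>k\<in>S. I \<in> vanishing_coord (G k)) \<longrightarrow>
       (\<forall>w. w \<noteq> 0 \<and> zero_index w = I \<longrightarrow>
         (\<forall>u :: complex^'n. (\<forall>i\<in>I. u$i \<noteq> 0) \<and> (\<Sum>i\<in>I. (norm (u$i))^2) < R \<longrightarrow>
           (\<forall>z\<in>Vstar S (\<lambda>k. face_fun w (G k)). (\<forall>i\<in>I. z$i = u$i) \<longrightarrow>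
               diffs_independent I S (\<lambda>k. face_fun w (G k)) z))))"

text \<open>Newton-admissibility of the family f^1,...,f^k0 (F k = coefficients of f^k).\<close>
definition newton_admissible :: "nat \<Rightarrow> (nat \<Rightarrow> nat \<Rightarrow> nat^'n \<Rightarrow> complex) \<Rightarrow> bool" where
  "newton_admissible k0 F \<longleftrightarrow>
     (\<exists>R>0. \<exists>\<rho>>0. \<forall>t. norm t < \<rho> \<longrightarrow>
        (\<forall>k\<in>{1..k0}. newton_boundary (tslice (F k) t) = newton_boundary (tslice (F k) 0)) \<and>
        (\<forall>S. S \<noteq> {} \<and> S \<subseteq> {1..k0} \<longrightarrow>
           nondegenerate_ci S (\<lambda>k. tslice (F k) t) \<and>
           (\<exists>R'>R. tameness_radius R' S (\<lambda>k. tslice (F k) t))))"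

text \<open>Total space of the Milnor fibration  B_\<epsilon> \<inter> g^{-1}(D^*_\<delta>).\<close>
definition milnor_space :: "(complex^'n \<Rightarrow> complex) \<Rightarrow> real \<Rightarrow> real \<Rightarrow> (complex^'n) set" where
  "milnor_space g \<epsilon> \<delta> = {z\<in>cball 0 \<epsilon>. g z \<in> ball 0 \<delta> - {0}}"

text \<open>The Milnor fibrations of g and h at 0 are isomorphic: for 0 < \<delta> \<ll> \<epsilon> \<ll> 1 there is a
  homeomorphism of the total spaces commuting with the projections to D^*_\<delta>.\<close>
definition milnor_fibrations_isomorphic ::
  "(complex^'n \<Rightarrow> complex) \<Rightarrow> (complex^'n \<Rightarrow> complex) \<Rightarrow> bool" where
  "milnor_fibrations_isomorphic g h \<longleftrightarrow>
     (\<exists>\<epsilon>0>0. \<forall>\<epsilon>. 0 < \<epsilon> \<and> \<epsilon> \<le> \<epsilon>0 \<longrightarrow>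
       (\<exists>\<delta>0>0. \<forall>\<delta>. 0 < \<delta> \<and> \<delta> \<le> \<delta>0 \<longrightarrow>
          (\<exists>\<Phi> \<Psi>. homeomorphism (milnor_space g \<epsilon> \<delta>) (milnor_space h \<epsilon> \<delta>) \<Phi> \<Psi> \<and>
                  (\<forall>z\<in>milnor_space g \<epsilon> \<delta>. h (\<Phi> z) = g z))))"

end

theory Submission
  imports Defs
begin

text \<open>
  Join t to 0 by a segment and transport the fibres of f along it inside a fixed small closed ball.
  If the fibres over small nonzero values are smooth and transversal to the bounding sphere for all
  parameters on the segment, an explicit vector field does this. Transversality is checked with
  sequences instead of the curve selection lemma: along a sequence of bad points converging to a
  zero z0 of f, pass to a subsequence along which all quotients of monomials converge in [0,infinity].
  The dominant monomials of f^k are then those of a face function for a common integral weight w,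
  and after rescaling the points converge to a point u of the torus. In the limit, the relation
  between the differentials of the f^k and the radial covector becomes a linear relation between the
  differentials of the face functions vanishing at u, and Euler's identity for the weight w removes
  the radial term. This contradicts non-degeneracy or local tameness.
\<close>

text \<open>Two obstacles shape the argument. Fibres over 0 may be singular, so the lifted field
  need not stay bounded as the value tends to 0: for every start value the field is truncated at a
  level depending on that value, and conservation of the value then shows that the truncation was
  never felt. And a fibre may fail in two ways, by a critical point inside the ball or by tangency
  to the sphere; both are read off from one function, eps^2 |p|^2 - |p.y|^2 with p the gradient.

  The weight has to be integral because non-degeneracy and tameness are assumed for integral
  weights, whereas convergence of monomials alone supplies a real one. Its zero entries must be
  exactly the nonvanishing coordinates of z0, the case that tameness covers. At a limit z0 other
  than the origin a radial term may survive: it drops out of the weighted Euler sum, but stays in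
  the equations for those f^k that do not vanish on the coordinate space of z0. Hence these are
  treated by a radius fixed beforehand, up to which the strata in the coordinate tori are
  transversal to all spheres.\<close>

section \<open>Differential equations with Lipschitz right-hand side\<close>

text \<open>The weight exp (- K s) makes the Picard operator a contraction on all of [0,1].\<close>
lemma lipschitz_ode_exists:
  fixes X :: "real \<Rightarrow> 'a::euclidean_space \<Rightarrow> 'a"
  assumes cont: "continuous_on ({0..1} \<times> UNIV) (\<lambda>(s, y). X s y)"
    and lip: "\<And>s y y'. s \<in> {0..1} \<Longrightarrow> norm (X s y - X s y') \<le> L * norm (y - y')"
    and bound: "\<And>s y. s \<in> {0..1} \<Longrightarrow> norm (X s y) \<le> B"
  obtains Y where "Y 0 = y0"
    "\<And>s. s \<in> {0..1} \<Longrightarrow> (Y has_vector_derivative X s (Y s)) (at s within {0..1})"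
proof -
  define K where "K = 2 * \<bar>L\<bar> + 1"
  have K: "K > 0" "\<bar>L\<bar> / K \<le> 1 / 2" by (auto simp: K_def field_simps)
  \<comment> \<open>Bounded continuous functions live on the whole line, so \<open>c\<close> clamps
    time to [0,1]. The unknown is v(s) = exp (- K s) (Y s - y0), measured in the sup norm.\<close>
  define c :: "real \<Rightarrow> real" where "c s = max 0 (min 1 s)" for s
  have c: "c s \<in> {0..1}" for s by (auto simp: c_def)
  have contc: "continuous_on UNIV c" unfolding c_def by (intro continuous_intros)
  define J where "J v \<tau> = X \<tau> (y0 + exp (K * \<tau>) *\<^sub>R apply_bcontfun v \<tau>)" for v :: "real \<Rightarrow>\<^sub>C 'a" and \<tau>
  have contJ: "continuous_on {0..1} (J v)" for v
  proof -
    have "continuous_on {0..1} (\<lambda>\<tau>. (\<lambda>(s, y). X s y) (\<tau>, y0 + exp (K * \<tau>) *\<^sub>R apply_bcontfun v \<tau>))"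
      by (rule continuous_on_compose2[OF cont]) (auto intro!: continuous_intros)
    then show ?thesis by (simp add: J_def[abs_def])
  qed
  define S where "S v s = exp (- K * c s) *\<^sub>R integral {0..c s} (J v)" for v s
  have SB: "S v \<in> bcontfun" for v
  proof (rule bcontfun_normI)
    have "continuous_on {0..1} (\<lambda>u. integral {0..u} (J v))"
      by (rule indefinite_integral_continuous_1[OF integrable_continuous_real[OF contJ]])
    from continuous_on_compose2[OF this contc] c
    have "continuous_on UNIV (\<lambda>s. integral {0..c s} (J v))" by blast
    then show "continuous_on UNIV (S v)" unfolding S_def
      by (intro continuous_intros contc)
    fix s
    have "norm (integral {0..c s} (J v)) \<le> B * (c s - 0)"
      by (rule integral_bound)
        (use c[of s] continuous_on_subset[OF contJ[of v]] in \<open>auto simp: J_def intro!: bound\<close>)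
    also have "\<dots> \<le> B" using c[of s] bound[of 0 0] norm_ge_zero[of "X 0 0"] 
      by (auto intro!: mult_left_le simp del: norm_ge_zero intro: order_trans)
    finally have "norm (integral {0..c s} (J v)) \<le> B" .
    moreover have "exp (- K * c s) \<le> 1" using K c[of s] by auto
    ultimately have "exp (- K * c s) * norm (integral {0..c s} (J v)) \<le> 1 * B"
      by (intro mult_mono) auto
    then show "norm (S v s) \<le> B" by (simp add: S_def)
  qed
  define T where "T v = Bcontfun (S v)" for v
  have T: "apply_bcontfun (T v) = S v" for v
    unfolding T_def using SB by (simp add: Bcontfun_inverse)
  have "dist (T v) (T v') \<le> 1 / 2 * dist v v'" for v v'
  proof (rule dist_bound)
    fix s
    let ?a = "c s" and ?d = "dist v v'"
    have sub: "{0..?a} \<subseteq> {0..1}" using c[of s] by auto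
    have int: "J u integrable_on {0..?a}" for u
      by (rule integrable_continuous_real[OF continuous_on_subset[OF contJ sub]])
    have hi: "((\<lambda>\<tau>. \<bar>L\<bar> * ?d * exp (K * \<tau>)) has_integral
       \<bar>L\<bar> * ?d * exp (K * ?a) / K - \<bar>L\<bar> * ?d * exp (K * 0) / K) {0..?a}"
      by (rule fundamental_theorem_of_calculus)
        (use c[of s] K in \<open>auto intro!: derivative_eq_intros simp: has_real_derivative_iff_has_vector_derivative[symmetric]\<close>)
    have "norm (integral {0..?a} (J v) - integral {0..?a} (J v')) = norm (integral {0..?a} (\<lambda>\<tau>. J v \<tau> - J v' \<tau>))"
      by (simp add: int Henstock_Kurzweil_Integration.integral_diff)
    also have "\<dots> \<le> integral {0..?a} (\<lambda>\<tau>. \<bar>L\<bar> * ?d * exp (K * \<tau>))"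
    proof (rule integral_norm_bound_integral)
      fix \<tau> assume "\<tau> \<in> {0..?a}"
      then have \<tau>: "\<tau> \<in> {0..1}" using sub by auto
      have "norm (J v \<tau> - J v' \<tau>) \<le> L * norm (exp (K * \<tau>) *\<^sub>R (apply_bcontfun v \<tau> - apply_bcontfun v' \<tau>))"
        unfolding J_def using lip[OF \<tau>, of "y0 + exp (K * \<tau>) *\<^sub>R apply_bcontfun v \<tau>" "y0 + exp (K * \<tau>) *\<^sub>R apply_bcontfun v' \<tau>"]
        by (simp add: scaleR_diff_right)
      also have "\<dots> \<le> \<bar>L\<bar> * (exp (K * \<tau>) * ?d)"
        using dist_bounded[of v \<tau> v'] by (intro mult_mono) (auto simp: dist_norm)
      finally show "norm (J v \<tau> - J v' \<tau>) \<le> \<bar>L\<bar> * ?d * exp (K * \<tau>)" by (simp add: ac_simps)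
    qed (use hi int in \<open>auto intro!: integrable_diff\<close>)
    also have "\<dots> \<le> \<bar>L\<bar> * ?d * exp (K * ?a) / K"
      using K by (subst integral_unique[OF hi]) simp
    finally have *: "norm (integral {0..?a} (J v) - integral {0..?a} (J v')) \<le> \<bar>L\<bar> * ?d * exp (K * ?a) / K" .
    have "dist (S v s) (S v' s) = exp (- K * ?a) * norm (integral {0..?a} (J v) - integral {0..?a} (J v'))"
      by (simp add: S_def dist_norm flip: scaleR_diff_right)
    also have "\<dots> \<le> exp (- K * ?a) * (\<bar>L\<bar> * ?d * exp (K * ?a) / K)"
      using * by (intro mult_left_mono) auto
    also have "\<dots> = \<bar>L\<bar> / K * ?d" by (simp add: exp_minus)
    also have "\<dots> \<le> 1 / 2 * ?d" using K by (intro mult_right_mono) auto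
    finally show "dist (apply_bcontfun (T v) s) (apply_bcontfun (T v') s) \<le> 1 / 2 * ?d" by (simp add: T)
  qed
  then obtain v where v: "T v = v" using banach_fix_type[of "1/2" T] by auto
  define Y where "Y s = y0 + exp (K * s) *\<^sub>R apply_bcontfun v s" for s
  have Yeq: "Y s = y0 + integral {0..s} (\<lambda>\<tau>. X \<tau> (Y \<tau>))" if "s \<in> {0..1}" for s
  proof -
    have "c s = s" using that by (auto simp: c_def)
    then have "apply_bcontfun v s = exp (- K * s) *\<^sub>R integral {0..s} (J v)"
      using T[of v] v by (simp add: S_def)
    then have "Y s = y0 + (exp (K * s) * exp (- K * s)) *\<^sub>R integral {0..s} (J v)" by (simp add: Y_def)
    then show ?thesis by (simp add: Y_def J_def[abs_def] flip: exp_add)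
  qed
  show ?thesis
  proof
    show "Y 0 = y0" using Yeq[of 0] by simp
    fix s :: real assume s: "s \<in> {0..1}"
    have "continuous_on {0..1} (\<lambda>\<tau>. X \<tau> (Y \<tau>))" using contJ[of v] by (simp add: J_def[abs_def] Y_def)
    from integral_has_vector_derivative[OF this s]
    have "((\<lambda>u. y0 + integral {0..u} (\<lambda>\<tau>. X \<tau> (Y \<tau>))) has_vector_derivative X s (Y s)) (at s within {0..1})"
      by (auto intro!: derivative_eq_intros)
    then show "(Y has_vector_derivative X s (Y s)) (at s within {0..1})"
      by (rule has_vector_derivative_transform[OF s, rotated]) (use Yeq in auto)
  qed
qed

text \<open>Solving backwards from time 1 is solving forwards for the field
  \<open>- X (1 - s)\<close>. Both directions are needed, since the inverse of a transport is again
  a transport.\<close>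

lemma lipschitz_ode_exists_final:
  fixes X :: "real \<Rightarrow> 'a::euclidean_space \<Rightarrow> 'a"
  assumes cont: "continuous_on ({0..1} \<times> UNIV) (\<lambda>(s, y). X s y)"
    and lip: "\<And>s y y'. s \<in> {0..1} \<Longrightarrow> norm (X s y - X s y') \<le> L * norm (y - y')"
    and bound: "\<And>s y. s \<in> {0..1} \<Longrightarrow> norm (X s y) \<le> B"
  obtains Y where "Y 1 = y1"
    "\<And>s. s \<in> {0..1} \<Longrightarrow> (Y has_vector_derivative X s (Y s)) (at s within {0..1})"
proof -
  have "continuous_on ({0..1} \<times> UNIV) (\<lambda>p. - (\<lambda>(s, y). X s y) (1 - fst p, snd p))"
    by (intro continuous_intros continuous_on_compose2[OF cont]) auto
  then have c': "continuous_on ({0..1} \<times> UNIV) (\<lambda>(s, y). - X (1 - s) y)" by (simp add: case_prod_beta)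
  obtain Z where Z: "Z 0 = y1" "\<And>s. s \<in> {0..1} \<Longrightarrow> (Z has_vector_derivative - X (1 - s) (Z s)) (at s within {0..1})"
  proof (rule lipschitz_ode_exists[OF c', of L B y1])
    show "norm (- X (1 - s) y - - X (1 - s) y') \<le> L * norm (y - y')" if "s \<in> {0..1}" for s y y'
      using lip[of "1 - s" y' y] that by (simp add: norm_minus_commute)
  qed (use bound in auto)
  show ?thesis
  proof (rule that[of "\<lambda>s. Z (1 - s)"])
    show "Z (1 - 1) = y1" using Z by simp
    fix s :: real assume s: "s \<in> {0..1}"
    have im: "(\<lambda>s. 1 - s) ` {0..1} = {0..1::real}" by (auto intro!: image_eqI[of _ _ "1 - _"])
    have "((Z \<circ> (\<lambda>s. 1 - s)) has_vector_derivative (-1) *\<^sub>R (- X (1 - (1 - s)) (Z (1 - s)))) (at s within {0..1})"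
      by (rule vector_diff_chain_within)
        (use Z(2)[of "1 - s"] s im in \<open>auto intro!: derivative_eq_intros\<close>)
    then show "((\<lambda>s. Z (1 - s)) has_vector_derivative X s (Z (1 - s))) (at s within {0..1})"
      by (simp add: o_def)
  qed
qed

text \<open>The squared distance u satisfies |u'| <= 2 |L| u, so it becomes decreasing after
  multiplication by exp (- 2 |L| s) and increasing after multiplication by exp (2 |L| s). Having
  both makes r and s interchangeable; squaring avoids differentiating the norm at 0.\<close>

lemma lipschitz_ode_gronwall:
  fixes Y Z :: "real \<Rightarrow> 'a::euclidean_space"
  assumes lip: "\<And>s. s \<in> {0..1} \<Longrightarrow> norm (X s (Y s) - X s (Z s)) \<le> L * norm (Y s - Z s)"
    and Y: "\<And>s. s \<in> {0..1} \<Longrightarrow> (Y has_vector_derivative X s (Y s)) (at s within {0..1})"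
    and Z: "\<And>s. s \<in> {0..1} \<Longrightarrow> (Z has_vector_derivative X s (Z s)) (at s within {0..1})"
    and s: "s \<in> {0..1}" and r: "r \<in> {0..1}"
  shows "norm (Y s - Z s) \<le> exp \<bar>L\<bar> * norm (Y r - Z r)"
proof -
  define W where "W s = Y s - Z s" for s
  define V where "V s = X s (Y s) - X s (Z s)" for s
  define u where "u s = W s \<bullet> W s" for s
  have W: "(W has_vector_derivative V s) (at s within {0..1})" if "s \<in> {0..1}" for s
    unfolding W_def V_def using that by (auto intro!: derivative_eq_intros Y Z)
  have contW: "continuous_on {0..1} W"
    using W has_vector_derivative_continuous continuous_on_eq_continuous_within by blast
  have du: "(u has_real_derivative 2 * (W s \<bullet> V s)) (at s)" if "0 < s" "s < 1" for s
  proof -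
    have "(W has_vector_derivative V s) (at s)"
      using W[of s] at_within_interior[of s "{0..1}"] that by auto
    then have "(W has_derivative (\<lambda>h. h *\<^sub>R V s)) (at s)" by (simp add: has_vector_derivative_def)
    from has_derivative_inner[OF this this] show ?thesis
      unfolding u_def has_field_derivative_def
      by (rule back_subst[of "\<lambda>f. (_ has_derivative f) _"]) (auto simp: inner_commute)
  qed
  have ub: "\<bar>2 * (W s \<bullet> V s)\<bar> \<le> 2 * \<bar>L\<bar> * u s" if "s \<in> {0..1}" for s
  proof -
    have "\<bar>W s \<bullet> V s\<bar> \<le> norm (W s) * norm (V s)" by (rule Cauchy_Schwarz_ineq2)
    also have "\<dots> \<le> norm (W s) * (L * norm (W s))"
      using lip[OF that] by (intro mult_left_mono) (auto simp: V_def W_def)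
    also have "\<dots> \<le> \<bar>L\<bar> * u s"
      using mult_right_mono[of L "\<bar>L\<bar>" "norm (W s) * norm (W s)"]
      by (simp add: u_def power2_eq_square mult.left_commute flip: power2_norm_eq_inner)
    finally show ?thesis by simp
  qed
  have contu: "continuous_on {0..1} u" unfolding u_def by (intro continuous_intros contW)
  have main: "u b \<le> exp (2 * \<bar>L\<bar>) * u a \<and> u a \<le> exp (2 * \<bar>L\<bar>) * u b" if "0 \<le> a" "a \<le> b" "b \<le> 1" for a b
  proof -
    have sub: "{a..b} \<subseteq> {0..1}" using that by auto
    have "exp (- (2 * \<bar>L\<bar>) * a) * u a \<ge> exp (- (2 * \<bar>L\<bar>) * b) * u b"
    proof (rule DERIV_nonpos_imp_decreasing_open[of a b "\<lambda>s. exp (- (2 * \<bar>L\<bar>) * s) * u s"])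
      fix x assume x: "a < x" "x < b"
      have "2 * (W x \<bullet> V x) - 2 * \<bar>L\<bar> * u x \<le> 0" using ub[of x] x that by auto
      then have "exp (- (2 * \<bar>L\<bar>) * x) * (2 * (W x \<bullet> V x) - 2 * \<bar>L\<bar> * u x) \<le> 0"
        by (intro mult_nonneg_nonpos) auto
      moreover have "((\<lambda>s. exp (- (2 * \<bar>L\<bar>) * s) * u s) has_real_derivative
          exp (- (2 * \<bar>L\<bar>) * x) * (2 * (W x \<bullet> V x) - 2 * \<bar>L\<bar> * u x)) (at x)"
        using x that by (auto intro!: derivative_eq_intros du simp: algebra_simps)
      ultimately show "\<exists>y. ((\<lambda>s. exp (- (2 * \<bar>L\<bar>) * s) * u s) has_real_derivative y) (at x) \<and> y \<le> 0"
        by blast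
    qed (use that in \<open>auto intro!: continuous_intros continuous_on_subset[OF contu sub]\<close>)
    moreover have "exp (2 * \<bar>L\<bar> * a) * u a \<le> exp (2 * \<bar>L\<bar> * b) * u b"
    proof (rule DERIV_nonneg_imp_increasing_open[of a b "\<lambda>s. exp (2 * \<bar>L\<bar> * s) * u s"])
      fix x assume x: "a < x" "x < b"
      have "2 * (W x \<bullet> V x) + 2 * \<bar>L\<bar> * u x \<ge> 0" using ub[of x] x that by auto
      then have "exp (2 * \<bar>L\<bar> * x) * (2 * (W x \<bullet> V x) + 2 * \<bar>L\<bar> * u x) \<ge> 0"
        by (intro mult_nonneg_nonneg) auto
      moreover have "((\<lambda>s. exp (2 * \<bar>L\<bar> * s) * u s) has_real_derivative
          exp (2 * \<bar>L\<bar> * x) * (2 * (W x \<bullet> V x) + 2 * \<bar>L\<bar> * u x)) (at x)"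
        using x that by (auto intro!: derivative_eq_intros du simp: algebra_simps)
      ultimately show "\<exists>y. ((\<lambda>s. exp (2 * \<bar>L\<bar> * s) * u s) has_real_derivative y) (at x) \<and> y \<ge> 0"
        by blast
    qed (use that in \<open>auto intro!: continuous_intros continuous_on_subset[OF contu sub]\<close>)
    moreover have "exp (2 * \<bar>L\<bar> * (b - a)) \<le> exp (2 * \<bar>L\<bar>)"
      using that by (auto intro!: mult_left_le)
    moreover have "u a \<ge> 0" "u b \<ge> 0" by (auto simp: u_def)
    moreover have "u b \<le> exp (2 * \<bar>L\<bar> * (b - a)) * u a" if "exp (- (2 * \<bar>L\<bar>) * a) * u a \<ge> exp (- (2 * \<bar>L\<bar>) * b) * u b"
    proof -
      have "exp (2 * \<bar>L\<bar> * b) * (exp (- (2 * \<bar>L\<bar>) * b) * u b) \<le> exp (2 * \<bar>L\<bar> * b) * (exp (- (2 * \<bar>L\<bar>) * a) * u a)"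
        using that by (intro mult_left_mono) auto
      then show ?thesis by (simp add: mult.assoc[symmetric] flip: exp_add) (simp add: algebra_simps)
    qed
    moreover have "u a \<le> exp (2 * \<bar>L\<bar> * (b - a)) * u b" if "exp (2 * \<bar>L\<bar> * a) * u a \<le> exp (2 * \<bar>L\<bar> * b) * u b"
    proof -
      have "exp (- (2 * \<bar>L\<bar> * a)) * (exp (2 * \<bar>L\<bar> * a) * u a) \<le> exp (- (2 * \<bar>L\<bar> * a)) * (exp (2 * \<bar>L\<bar> * b) * u b)"
        using that by (intro mult_left_mono) auto
      then show ?thesis by (simp add: mult.assoc[symmetric] flip: exp_add) (simp add: algebra_simps)
    qed
    ultimately show ?thesis by (meson mult_right_mono order_trans)
  qed
  have "u s \<le> exp (2 * \<bar>L\<bar>) * u r"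
    using main[of r s] main[of s r] s r by (cases "r \<le> s") auto
  then have "(norm (W s))\<^sup>2 \<le> (exp \<bar>L\<bar> * norm (W r))\<^sup>2"
    by (simp add: u_def power2_norm_eq_inner power_mult_distrib flip: exp_double)
  then show ?thesis unfolding W_def by (rule power2_le_imp_le) auto
qed

section \<open>Transport of the fibres of a family of functions on a ball\<close>

text \<open>Lipschitz in y uniformly in s, but merely continuous in s: the regularity that the
  existence theorem asks of a field. The class is closed under ring operations and conjugation, so
  polynomial expressions need no derivative estimates.\<close>

definition unif_lip :: "real \<Rightarrow> (real \<Rightarrow> complex^'n \<Rightarrow> complex) \<Rightarrow> bool" where
  "unif_lip \<epsilon> f \<longleftrightarrow> continuous_on ({0..1} \<times> cball 0 \<epsilon>) (\<lambda>(s, y). f s y) \<and>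
     (\<exists>L. \<forall>s\<in>{0..1}. \<forall>y\<in>cball 0 \<epsilon>. \<forall>y'\<in>cball 0 \<epsilon>. norm (f s y - f s y') \<le> L * norm (y - y'))"

lemma unif_lip_bounded:
  assumes "unif_lip \<epsilon> f"
  obtains B where "B \<ge> 0" "\<And>s y. s \<in> {0..1} \<Longrightarrow> y \<in> cball 0 \<epsilon> \<Longrightarrow> norm (f s y) \<le> B"
proof -
  have "compact ((\<lambda>(s, y). f s y) ` ({0..1} \<times> cball 0 \<epsilon>))"
    using assms by (intro compact_continuous_image) (auto simp: unif_lip_def compact_Times)
  then obtain B where "\<And>x. x \<in> (\<lambda>(s, y). f s y) ` ({0..1} \<times> cball 0 \<epsilon>) \<Longrightarrow> norm x \<le> B"
    using compact_imp_bounded bounded_iff by metis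
  then show thesis by (intro that[of "max B 0"]) (force intro: max.coboundedI1)+
qed

section \<open>Closure properties of uniformly Lipschitz families\<close>

lemma unif_lip_param: "continuous_on {0..1} h \<Longrightarrow> unif_lip \<epsilon> (\<lambda>s y. h s)"
  unfolding unif_lip_def case_prod_beta
  by (intro conjI exI[of _ 0] continuous_on_compose2[of "{0..1}" h _ fst] continuous_on_fst continuous_on_id) auto

lemma unif_lip_const: "unif_lip \<epsilon> (\<lambda>s y. c)" by (rule unif_lip_param) simp

lemma unif_lip_nth: "unif_lip \<epsilon> (\<lambda>s y. y $ i)"
  unfolding unif_lip_def case_prod_beta
  by (intro conjI continuous_intros exI[of _ 1] ballI)
    (simp add: Finite_Cartesian_Product.norm_nth_le flip: vector_minus_component)

lemma unif_lip_add:
  assumes "unif_lip \<epsilon> f" "unif_lip \<epsilon> g"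
  shows "unif_lip \<epsilon> (\<lambda>s y. f s y + g s y)"
proof -
  from assms obtain L M where
    L: "\<forall>s\<in>{0..1}. \<forall>y\<in>cball 0 \<epsilon>. \<forall>y'\<in>cball 0 \<epsilon>. norm (f s y - f s y') \<le> L * norm (y - y')" and
    M: "\<forall>s\<in>{0..1}. \<forall>y\<in>cball 0 \<epsilon>. \<forall>y'\<in>cball 0 \<epsilon>. norm (g s y - g s y') \<le> M * norm (y - y')"
    unfolding unif_lip_def by blast
  have "norm (f s y + g s y - (f s y' + g s y')) \<le> (L + M) * norm (y - y')"
    if "s \<in> {0..1}" "y \<in> cball 0 \<epsilon>" "y' \<in> cball 0 \<epsilon>" for s y y'
  proof -
    have "norm (f s y + g s y - (f s y' + g s y')) \<le> norm (f s y - f s y') + norm (g s y - g s y')"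
      by (metis add_diff_add norm_triangle_ineq)
    also have "\<dots> \<le> L * norm (y - y') + M * norm (y - y')"
      by (intro add_mono L[rule_format] M[rule_format] that)
    finally show ?thesis by (simp add: algebra_simps)
  qed
  moreover have "continuous_on ({0..1} \<times> cball 0 \<epsilon>) (\<lambda>(s, y). f s y + g s y)"
    using assms unfolding unif_lip_def case_prod_beta by (intro continuous_intros) auto
  ultimately show ?thesis unfolding unif_lip_def by blast
qed

lemma unif_lip_mult:
  assumes "unif_lip \<epsilon> f" "unif_lip \<epsilon> g"
  shows "unif_lip \<epsilon> (\<lambda>s y. f s y * g s y)"
proof -
  from assms obtain L M where
    L: "\<forall>s\<in>{0..1}. \<forall>y\<in>cball 0 \<epsilon>. \<forall>y'\<in>cball 0 \<epsilon>. norm (f s y - f s y') \<le> L * norm (y - y')" and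
    M: "\<forall>s\<in>{0..1}. \<forall>y\<in>cball 0 \<epsilon>. \<forall>y'\<in>cball 0 \<epsilon>. norm (g s y - g s y') \<le> M * norm (y - y')"
    unfolding unif_lip_def by blast
  obtain A where A: "A \<ge> 0" "\<And>s y. s \<in> {0..1} \<Longrightarrow> y \<in> cball 0 \<epsilon> \<Longrightarrow> norm (f s y) \<le> A"
    using unif_lip_bounded[OF assms(1)] by blast
  obtain B where B: "B \<ge> 0" "\<And>s y. s \<in> {0..1} \<Longrightarrow> y \<in> cball 0 \<epsilon> \<Longrightarrow> norm (g s y) \<le> B"
    using unif_lip_bounded[OF assms(2)] by blast
  have "norm (f s y * g s y - f s y' * g s y') \<le> (L * B + A * M) * norm (y - y')"
    if "s \<in> {0..1}" "y \<in> cball 0 \<epsilon>" "y' \<in> cball 0 \<epsilon>" for s y y'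
  proof -
    have "norm (f s y * g s y - f s y' * g s y') = norm ((f s y - f s y') * g s y + f s y' * (g s y - g s y'))"
      by (simp add: algebra_simps)
    also have "\<dots> \<le> norm (f s y - f s y') * norm (g s y) + norm (f s y') * norm (g s y - g s y')"
      by (metis norm_mult norm_triangle_ineq)
    also have "\<dots> \<le> (L * norm (y - y')) * B + A * (M * norm (y - y'))"
      by (intro add_mono mult_mono' L[rule_format] M[rule_format] A B that norm_ge_zero)
    finally show ?thesis by (simp add: algebra_simps)
  qed
  moreover have "continuous_on ({0..1} \<times> cball 0 \<epsilon>) (\<lambda>(s, y). f s y * g s y)"
    using assms unfolding unif_lip_def case_prod_beta by (intro continuous_intros) auto
  ultimately show ?thesis unfolding unif_lip_def by blast
qed

lemma unif_lip_compose_lipschitz: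
  assumes f: "unif_lip \<epsilon> f" and h: "\<And>a b. norm (h a - h b) \<le> C * norm (a - b)"
  shows "unif_lip \<epsilon> (\<lambda>s y. h (f s y))"
proof -
  have C: "C \<ge> 0" using h[of 0 1] by (simp add: order_trans[OF norm_ge_zero])
  have "C-lipschitz_on UNIV h" using h C by (auto simp: lipschitz_on_def dist_norm)
  then have ch: "continuous_on UNIV h" by (rule lipschitz_on_continuous_on)
  from f obtain L where
    L: "\<forall>s\<in>{0..1}. \<forall>y\<in>cball 0 \<epsilon>. \<forall>y'\<in>cball 0 \<epsilon>. norm (f s y - f s y') \<le> L * norm (y - y')"
    unfolding unif_lip_def by blast
  have "norm (h (f s y) - h (f s y')) \<le> (C * L) * norm (y - y')"
    if "s \<in> {0..1}" "y \<in> cball 0 \<epsilon>" "y' \<in> cball 0 \<epsilon>" for s y y'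
  proof -
    have "norm (f s y - f s y') \<le> L * norm (y - y')" by (intro L[rule_format] that)
    then have "C * norm (f s y - f s y') \<le> C * (L * norm (y - y'))" by (rule mult_left_mono[OF _ C])
    then show ?thesis using h[of "f s y" "f s y'"] by (simp add: mult.assoc)
  qed
  moreover have "continuous_on ({0..1} \<times> cball 0 \<epsilon>) (\<lambda>(s, y). h (f s y))"
  proof -
    have "continuous_on ({0..1} \<times> cball 0 \<epsilon>) (\<lambda>p. h ((\<lambda>(s, y). f s y) p))"
      by (rule continuous_on_compose2[OF ch]) (use f in \<open>auto simp: unif_lip_def\<close>)
    then show ?thesis by (simp add: case_prod_beta)
  qed
  ultimately show ?thesis unfolding unif_lip_def by blast
qed

lemma unif_lip_cnj: "unif_lip \<epsilon> f \<Longrightarrow> unif_lip \<epsilon> (\<lambda>s y. cnj (f s y))"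
  by (rule unif_lip_compose_lipschitz[where C = 1]) (simp_all flip: complex_cnj_diff)

lemma unif_lip_uminus: "unif_lip \<epsilon> f \<Longrightarrow> unif_lip \<epsilon> (\<lambda>s y. - f s y)"
  using unif_lip_mult[OF unif_lip_const[of \<epsilon> "-1"]] by simp

lemma unif_lip_diff: "unif_lip \<epsilon> f \<Longrightarrow> unif_lip \<epsilon> g \<Longrightarrow> unif_lip \<epsilon> (\<lambda>s y. f s y - g s y)"
  using unif_lip_add[OF _ unif_lip_uminus] by fastforce

lemma unif_lip_sum: "(\<And>a. a \<in> A \<Longrightarrow> unif_lip \<epsilon> (f a)) \<Longrightarrow> unif_lip \<epsilon> (\<lambda>s y. \<Sum>a\<in>A. f a s y)"
  by (induction A rule: infinite_finite_induct) (auto intro: unif_lip_const unif_lip_add)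

lemma unif_lip_prod: "(\<And>a. a \<in> A \<Longrightarrow> unif_lip \<epsilon> (f a)) \<Longrightarrow> unif_lip \<epsilon> (\<lambda>s y. \<Prod>a\<in>A. f a s y)"
  by (induction A rule: infinite_finite_induct) (auto intro: unif_lip_const unif_lip_mult)

lemma unif_lip_power: "unif_lip \<epsilon> f \<Longrightarrow> unif_lip \<epsilon> (\<lambda>s y. f s y ^ k)"
  by (induction k) (auto intro: unif_lip_const unif_lip_mult)

text \<open>On values at least c the reciprocal has Lipschitz constant 1 / c^2, because |1/x - 1/y|
  = |x - y| / (x y). Truncation by \<open>max\<close> supplies the lower bound everywhere.\<close>

lemma unif_lip_trunc_inverse:
  assumes "unif_lip \<epsilon> f" "c > 0"
  shows "unif_lip \<epsilon> (\<lambda>s y. of_real (1 / max (Re (f s y)) c))"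
proof (rule unif_lip_compose_lipschitz[OF assms(1), where C = "1 / c\<^sup>2"])
  fix a b :: complex
  define x y where "x = max (Re a) c" and "y = max (Re b) c"
  have xy: "x \<ge> c" "y \<ge> c" and "\<bar>x - y\<bar> \<le> \<bar>Re (a - b)\<bar>" by (auto simp: x_def y_def)
  then have d: "\<bar>x - y\<bar> \<le> norm (a - b)" using abs_Re_le_cmod order_trans by blast
  have "norm (complex_of_real (1 / x) - of_real (1 / y)) = \<bar>1 / x - 1 / y\<bar>"
    using norm_of_real[of "1 / x - 1 / y", where 'a = complex] by (simp only: of_real_diff)
  also have "\<dots> = \<bar>x - y\<bar> / (x * y)" using xy assms(2) by (auto simp: field_simps abs_if)
  also have "\<dots> \<le> norm (a - b) / (c * c)"
    using xy d assms(2) by (intro frac_le mult_mono) auto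
  finally show "norm (complex_of_real (1 / max (Re a) c) - of_real (1 / max (Re b) c)) \<le> 1 / c\<^sup>2 * norm (a - b)"
    by (simp add: x_def y_def power2_eq_square)
qed

lemmas unif_lip_intros = unif_lip_param unif_lip_const unif_lip_nth unif_lip_add unif_lip_mult unif_lip_cnj unif_lip_uminus unif_lip_diff
  unif_lip_sum unif_lip_prod unif_lip_power

section \<open>Retraction onto the ball and conservation of a value\<close>

lemma closest_point_cball_outside:
  fixes y :: "'a::euclidean_space"
  assumes "\<epsilon> > 0" "norm y \<ge> \<epsilon>"
  shows "closest_point (cball 0 \<epsilon>) y = (\<epsilon> / norm y) *\<^sub>R y"
proof (rule closest_point_unique[symmetric])
  have y: "norm y > 0" using assms by linarith
  show "(\<epsilon> / norm y) *\<^sub>R y \<in> cball 0 \<epsilon>" using assms y by simp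
  show "\<forall>z\<in>cball 0 \<epsilon>. dist y ((\<epsilon> / norm y) *\<^sub>R y) \<le> dist y z"
  proof
    fix z :: 'a assume z: "z \<in> cball 0 \<epsilon>"
    have "dist y ((\<epsilon> / norm y) *\<^sub>R y) = norm ((1 - \<epsilon> / norm y) *\<^sub>R y)"
      by (simp add: dist_norm scaleR_diff_left)
    also have "\<dots> = norm y - \<epsilon>" using assms y by (simp add: field_simps)
    also have "\<dots> \<le> norm y - norm z" using z by simp
    also have "\<dots> \<le> dist y z" by (simp add: dist_norm norm_triangle_ineq2)
    finally show "dist y ((\<epsilon> / norm y) *\<^sub>R y) \<le> dist y z" .
  qed
qed auto

text \<open>The derivative is known to vanish only while v is close to a, so constancy cannot be
  integrated directly. The times with v = a form a closed set by continuity, and a relatively open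
  one because v is constant on a short interval around each of them; connectedness of [0,1] does the
  rest.\<close>

lemma constant_if_stationary_near_value:
  fixes v :: "real \<Rightarrow> 'a::real_normed_vector"
  assumes v: "\<And>s. s \<in> {0..1} \<Longrightarrow> (v has_vector_derivative v' s) (at s within {0..1})"
    and stat: "\<And>s. s \<in> {0..1} \<Longrightarrow> dist (v s) a < r0 \<Longrightarrow> v' s = 0"
    and r: "r \<in> {0..1}" "v r = a" and "r0 > 0" and s: "s \<in> {0..1}"
  shows "v s = a"
proof -
  let ?S = "top_of_set {0..1::real}"
  define A where "A = {s \<in> {0..1}. v s = a}"
  have cont: "continuous_on {0..1} v"
    using v has_vector_derivative_continuous continuous_on_eq_continuous_within by blast
  have "closedin ?S A" unfolding A_def by (rule continuous_closedin_preimage_constant[OF cont])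
  moreover have "openin ?S A"
    unfolding openin_euclidean_subtopology_iff
  proof (intro conjI ballI)
    fix q assume q: "q \<in> A"
    obtain d where d: "d > 0" "\<And>x. x \<in> {0..1} \<Longrightarrow> dist x q < d \<Longrightarrow> dist (v x) (v q) < r0"
      using cont[unfolded continuous_on_iff, rule_format, of q r0] q \<open>r0 > 0\<close> by (auto simp: A_def)
    let ?T = "{0..1} \<inter> ball q d"
    have "\<exists>c. \<forall>x\<in>?T. v x = c"
    proof (rule has_derivative_zero_constant)
      fix x assume x: "x \<in> ?T"
      then have "v' x = 0" using d(2)[of x] stat[of x] q by (auto simp: A_def dist_commute)
      then have "(v has_vector_derivative 0) (at x within ?T)"
        using v[of x] x has_vector_derivative_within_subset[of v 0 x "{0..1}" ?T] by auto
      then show "(v has_derivative (\<lambda>h. 0)) (at x within ?T)" by (simp add: has_vector_derivative_def)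
    qed (simp add: convex_Int)
    then obtain c where c: "\<forall>x\<in>?T. v x = c" by (rule exE)
    have "q \<in> ?T" using q d(1) by (simp add: A_def)
    then have "c = a" using c q unfolding A_def by simp
    with c have "\<forall>x\<in>?T. v x = a" by simp
    then show "\<exists>e>0. \<forall>x'\<in>{0..1}. dist x' q < e \<longrightarrow> x' \<in> A"
      using d(1) unfolding A_def by (intro exI[of _ d] conjI ballI impI) (simp_all add: dist_commute)
  qed (auto simp: A_def)
  moreover have "connected {0..1::real}" by simp
  ultimately have "A = {} \<or> A = {0..1}" unfolding connected_clopen by blast
  moreover have "r \<in> A" unfolding A_def using r by simp
  ultimately have "s \<in> A" using s by blast
  then show ?thesis unfolding A_def by simp
qed

text \<open>By \<open>chain\<close>, b is the s-derivative of g and p its gradient in y. On the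
  sphere, \<open>gram\<close> is the Gram determinant of y and the conjugate of p; in the ball it is
  at least (eps^2 - |y|^2) |p|^2. So \<open>regular\<close> says at once that fibres over small
  nonzero values have no critical point inside and are transversal to the boundary sphere.\<close>

locale fibred_family =
  fixes \<epsilon> \<delta> :: real
    and g b :: "real \<Rightarrow> complex^'n \<Rightarrow> complex"
    and p :: "'n \<Rightarrow> real \<Rightarrow> complex^'n \<Rightarrow> complex"
    and e gram :: "real \<Rightarrow> complex^'n \<Rightarrow> complex"
  defines "e \<equiv> \<lambda>s y. \<Sum>i\<in>UNIV. p i s y * y $ i"
    and "gram \<equiv> \<lambda>s y. of_real (\<epsilon>\<^sup>2) * (\<Sum>i\<in>UNIV. p i s y * cnj (p i s y)) - e s y * cnj (e s y)"
  assumes eps: "\<epsilon> > 0" and delta: "\<delta> > 0"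
    and unif_lip_g: "unif_lip \<epsilon> g" and unif_lip_b: "unif_lip \<epsilon> b" and unif_lip_p: "\<And>i. unif_lip \<epsilon> (p i)"
    and chain: "\<And>Y Y' s. s \<in> {0..1} \<Longrightarrow> (Y has_vector_derivative Y') (at s within {0..1}) \<Longrightarrow>
      ((\<lambda>s. g s (Y s)) has_vector_derivative (b s (Y s) + (\<Sum>i\<in>UNIV. p i s (Y s) * Y' $ i))) (at s within {0..1})"
    and regular: "\<And>s y. s \<in> {0..1} \<Longrightarrow> norm y \<le> \<epsilon> \<Longrightarrow> 0 < norm (g s y) \<Longrightarrow> norm (g s y) \<le> \<delta> \<Longrightarrow> Re (gram s y) > 0"
begin

text \<open>
  With a = cnj p, the field X = - b (eps^2 a - <a,y> y) / gram satisfies p.X = - b, so that its flow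
  preserves g, and it is tangent to the sphere of radius eps. In the function tfield the denominator is
  truncated and the ball retracted onto, which makes the field globally Lipschitz.
\<close>
definition field_with :: "(complex \<Rightarrow> complex) \<Rightarrow> real \<Rightarrow> complex^'n \<Rightarrow> complex^'n" where
  "field_with h s y =
     (\<chi> i. - b s y * (of_real (\<epsilon>\<^sup>2) * cnj (p i s y) - cnj (e s y) * y $ i) * h (gram s y))"

definition field :: "real \<Rightarrow> complex^'n \<Rightarrow> complex^'n" where
  "field = field_with (\<lambda>D. of_real (1 / Re D))"

definition tfield :: "real \<Rightarrow> real \<Rightarrow> complex^'n \<Rightarrow> complex^'n" where
  "tfield c s y = field_with (\<lambda>D. of_real (1 / max (Re D) c)) s (closest_point (cball 0 \<epsilon>) y)"

lemma closest_in_cball: "closest_point (cball 0 \<epsilon>) y \<in> cball 0 \<epsilon>"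
  by (rule closest_point_in_set) (use eps in auto)

lemma gram_real: "gram s y = of_real (Re (gram s y))"
  by (simp add: gram_def complex_eq_iff Im_sum)

text \<open>The vector eps^2 cnj p - cnj e y has Hermitian product cnj e (eps^2 - |y|^2) with y,
  which is zero on the sphere. A scalar factor is harmless, so tangency survives any treatment of
  the denominator.\<close>

lemma field_with_radial: "norm y = \<epsilon> \<Longrightarrow> y \<bullet> field_with (\<lambda>D. of_real (h D)) s y = 0"
proof -
  assume y: "norm y = \<epsilon>"
  let ?V = "field_with (\<lambda>D. of_real (h D)) s y"
  have yy: "(\<Sum>i\<in>UNIV. y $ i * cnj (y $ i)) = of_real (\<epsilon>\<^sup>2)"
  proof -
    have "\<epsilon>\<^sup>2 = (\<Sum>i\<in>UNIV. (norm (y $ i))\<^sup>2)"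
      using y by (simp add: norm_vec_def L2_set_def sum_nonneg flip: y)
    then show ?thesis by (simp only: complex_norm_square[symmetric] of_real_sum[symmetric])
  qed
  have "y \<bullet> ?V = Re (\<Sum>i\<in>UNIV. ?V $ i * cnj (y $ i))"
    by (simp add: inner_vec_def inner_complex_def algebra_simps)
  also have "(\<Sum>i\<in>UNIV. ?V $ i * cnj (y $ i)) = - b s y * of_real (h (gram s y)) *
     (\<Sum>i\<in>UNIV. of_real (\<epsilon>\<^sup>2) * cnj (p i s y * y $ i) - cnj (e s y) * (y $ i * cnj (y $ i)))"
    unfolding sum_distrib_left by (intro sum.cong) (simp_all add: field_with_def algebra_simps)
  also have "(\<Sum>i\<in>UNIV. of_real (\<epsilon>\<^sup>2) * cnj (p i s y * y $ i) - cnj (e s y) * (y $ i * cnj (y $ i)))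
      = of_real (\<epsilon>\<^sup>2) * cnj (e s y) - cnj (e s y) * (\<Sum>i\<in>UNIV. y $ i * cnj (y $ i))"
    by (simp only: sum_subtractf sum_distrib_left[symmetric] cnj_sum[symmetric] e_def)
  also have "\<dots> = 0" by (simp add: yy)
  finally show ?thesis by simp
qed

text \<open>Pairing the same vector with p gives exactly \<open>gram\<close>. With h the reciprocal
  of \<open>Re (gram s y)\<close> the result is - b; a truncated denominator loses this where the
  truncation is active.\<close>

lemma field_with_vertical:
  "(\<Sum>i\<in>UNIV. p i s y * field_with (\<lambda>D. of_real (h D)) s y $ i) = - b s y * of_real (Re (gram s y) * h (gram s y))"
proof -
  have "(\<Sum>i\<in>UNIV. p i s y * field_with (\<lambda>D. of_real (h D)) s y $ i) = - b s y * of_real (h (gram s y)) *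
     (\<Sum>i\<in>UNIV. of_real (\<epsilon>\<^sup>2) * (p i s y * cnj (p i s y)) - (p i s y * y $ i) * cnj (e s y))"
    unfolding sum_distrib_left by (intro sum.cong) (simp_all add: field_with_def algebra_simps)
  also have "(\<Sum>i\<in>UNIV. of_real (\<epsilon>\<^sup>2) * (p i s y * cnj (p i s y)) - (p i s y * y $ i) * cnj (e s y)) = gram s y"
    by (simp only: sum_subtractf sum_distrib_left[symmetric] sum_distrib_right[symmetric] gram_def e_def)
  also have "- b s y * of_real (h (gram s y)) * gram s y = - b s y * of_real (h (gram s y)) * of_real (Re (gram s y))"
    using gram_real[of s y] by simp
  finally show ?thesis by simp
qed

text \<open>Outside the ball the retraction of y is a positive multiple of y on the sphere, and
  there the field is tangent.\<close>

lemma tfield_radial: "norm y \<ge> \<epsilon> \<Longrightarrow> y \<bullet> tfield c s y = 0"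
proof -
  assume y: "norm y \<ge> \<epsilon>"
  let ?q = "(\<epsilon> / norm y) *\<^sub>R y"
  have "norm y > 0" using y eps by linarith
  then have "norm ?q = \<epsilon>" and "y = (norm y / \<epsilon>) *\<^sub>R ?q" using eps by auto
  then have yq: "y \<bullet> tfield c s y = (norm y / \<epsilon>) * (?q \<bullet> tfield c s y)" by (metis inner_scaleR_left)
 have "?q \<bullet> tfield c s y = 0"
    unfolding tfield_def closest_point_cball_outside[OF eps y] by (rule field_with_radial) fact
  with yq show ?thesis by (simp only: mult_zero_right)
qed

lemma tfield_eq_field:
  assumes "norm y \<le> \<epsilon>" "Re (gram s y) \<ge> c"
  shows "tfield c s y = field s y"
  using assms closest_point_self[of y "cball 0 \<epsilon>"]
  by (simp add: tfield_def field_def field_with_def max_def)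

lemma unif_lip_tfield_component:
  assumes "c > 0"
  shows "unif_lip \<epsilon> (\<lambda>s y. - b s y * (of_real (\<epsilon>\<^sup>2) * cnj (p i s y) - cnj (e s y) * y $ i) * of_real (1 / max (Re (gram s y)) c))"
proof -
  have e: "unif_lip \<epsilon> e" unfolding e_def by (intro unif_lip_intros unif_lip_p)
  have "unif_lip \<epsilon> gram" unfolding gram_def by (intro unif_lip_intros unif_lip_p e)
  then show ?thesis by (intro unif_lip_intros unif_lip_p unif_lip_b e unif_lip_trunc_inverse assms)
qed

lemma tfield_continuous:
  assumes "c > 0"
  shows "continuous_on ({0..1} \<times> UNIV) (\<lambda>(s, y). tfield c s y)"
proof -
  have cp: "continuous_on UNIV (closest_point (cball 0 \<epsilon> :: (complex^'n) set))"
    by (rule continuous_on_closest_point) (use eps in auto)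
  have "continuous_on ({0..1} \<times> UNIV) (\<lambda>q. tfield c (fst q) (snd q) $ i)" for i
  proof -
    have "continuous_on ({0..1} \<times> UNIV) (\<lambda>q. (\<lambda>(s, y). - b s y * (of_real (\<epsilon>\<^sup>2) * cnj (p i s y) - cnj (e s y) * y $ i) * of_real (1 / max (Re (gram s y)) c))
       (fst q, closest_point (cball 0 \<epsilon>) (snd q)))"
      by (rule continuous_on_compose2[OF unif_lip_tfield_component[OF assms, of i, unfolded unif_lip_def, THEN conjunct1]])
        (use closest_in_cball in \<open>auto intro!: continuous_intros continuous_on_compose2[OF cp]\<close>)
    then show ?thesis by (simp add: tfield_def field_with_def)
  qed
  then have "continuous_on ({0..1} \<times> UNIV) (\<lambda>q. \<chi> i. tfield c (fst q) (snd q) $ i)"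
    by (intro continuous_on_vec_lambda)
  then show ?thesis by (simp add: case_prod_beta)
qed

lemma tfield_lipschitz:
  assumes "c > 0"
  obtains L where "\<And>s y y'. s \<in> {0..1} \<Longrightarrow> norm (tfield c s y - tfield c s y') \<le> L * norm (y - y')"
proof -
  let ?V = "\<lambda>i s y. - b s y * (of_real (\<epsilon>\<^sup>2) * cnj (p i s y) - cnj (e s y) * y $ i) * of_real (1 / max (Re (gram s y)) c)"
  have "\<forall>i. \<exists>L. \<forall>s\<in>{0..1}. \<forall>y\<in>cball 0 \<epsilon>. \<forall>y'\<in>cball 0 \<epsilon>. norm (?V i s y - ?V i s y') \<le> L * norm (y - y')"
    using unif_lip_tfield_component[OF assms] unfolding unif_lip_def by blast
  then obtain L where L: "\<And>i s y y'. s \<in> {0..1} \<Longrightarrow> y \<in> cball 0 \<epsilon> \<Longrightarrow> y' \<in> cball 0 \<epsilon> \<Longrightarrow>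
      norm (?V i s y - ?V i s y') \<le> L i * norm (y - y')" by metis
  show ?thesis
  proof (rule that)
    fix s :: real and y y' :: "complex^'n" assume s: "s \<in> {0..1}"
    let ?P = "closest_point (cball 0 \<epsilon>) :: complex^'n \<Rightarrow> complex^'n"
    have d: "norm (?P y - ?P y') \<le> norm (y - y')"
      using closest_point_lipschitz[of "cball 0 \<epsilon>" y y'] eps by (simp add: dist_norm)
    have "norm (tfield c s y - tfield c s y') \<le> (\<Sum>i\<in>UNIV. norm ((tfield c s y - tfield c s y') $ i))"
      by (simp add: norm_vec_def L2_set_le_sum)
    also have "\<dots> \<le> (\<Sum>i\<in>UNIV. \<bar>L i\<bar> * norm (y - y'))"
    proof (rule sum_mono)
      fix i
      have "norm ((tfield c s y - tfield c s y') $ i) \<le> L i * norm (?P y - ?P y')"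
        using L[OF s closest_in_cball[of y] closest_in_cball[of y'], of i] by (simp add: tfield_def field_with_def)
      also have "\<dots> \<le> \<bar>L i\<bar> * norm (y - y')" using d by (intro mult_mono) auto
      finally show "norm ((tfield c s y - tfield c s y') $ i) \<le> \<bar>L i\<bar> * norm (y - y')" .
    qed
    also have "\<dots> = (\<Sum>i\<in>UNIV. \<bar>L i\<bar>) * norm (y - y')" by (simp add: sum_distrib_right)
    finally show "norm (tfield c s y - tfield c s y') \<le> (\<Sum>i\<in>UNIV. \<bar>L i\<bar>) * norm (y - y')" .
  qed
qed

lemma tfield_bounded:
  assumes "c > 0"
  obtains B where "\<And>s y. s \<in> {0..1} \<Longrightarrow> norm (tfield c s y) \<le> B"
proof -
  have "\<forall>i. \<exists>B. \<forall>s\<in>{0..1}. \<forall>y\<in>cball 0 \<epsilon>. norm (- b s y * (of_real (\<epsilon>\<^sup>2) * cnj (p i s y) - cnj (e s y) * y $ i) * of_real (1 / max (Re (gram s y)) c)) \<le> B"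
    using unif_lip_bounded[OF unif_lip_tfield_component[OF assms]] by meson
  then obtain B where B: "\<And>i s y. s \<in> {0..1} \<Longrightarrow> y \<in> cball 0 \<epsilon> \<Longrightarrow>
    norm (- b s y * (of_real (\<epsilon>\<^sup>2) * cnj (p i s y) - cnj (e s y) * y $ i) * of_real (1 / max (Re (gram s y)) c)) \<le> B i"
    by metis
  show ?thesis
  proof (rule that)
    fix s :: real and y :: "complex^'n" assume s: "s \<in> {0..1}"
    have "norm (tfield c s y) \<le> (\<Sum>i\<in>UNIV. norm (tfield c s y $ i))" by (simp add: norm_vec_def L2_set_le_sum)
    also have "\<dots> \<le> (\<Sum>i\<in>UNIV. B i)"
      using B[OF s closest_in_cball[of y]] by (intro sum_mono) (simp add: tfield_def field_with_def)
    finally show "norm (tfield c s y) \<le> (\<Sum>i\<in>UNIV. B i)" .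
  qed
qed

text \<open>Compactness of the set of (s, y) with \<eta> <= |g| <= \<delta>. The bound may
  degenerate as \<eta> tends to 0, which is why truncation levels depend on the value to be
  transported.\<close>

lemma gram_lower_bound:
  assumes "\<eta> > 0"
  obtains c where "c > 0"
    "\<And>s y. s \<in> {0..1} \<Longrightarrow> norm y \<le> \<epsilon> \<Longrightarrow> \<eta> \<le> norm (g s y) \<Longrightarrow> norm (g s y) \<le> \<delta> \<Longrightarrow> c \<le> Re (gram s y)"
proof -
  define A where "A = {q \<in> {0..1} \<times> cball 0 \<epsilon>. norm ((\<lambda>(s, y). g s y) q) \<in> {\<eta>..\<delta>}}"
  have "unif_lip \<epsilon> gram" unfolding gram_def e_def by (intro unif_lip_intros unif_lip_p)
  then have cg: "continuous_on ({0..1} \<times> cball 0 \<epsilon>) (\<lambda>q. Re ((\<lambda>(s, y). gram s y) q))"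
    unfolding unif_lip_def by (intro continuous_on_Re) auto
  have "continuous_on ({0..1} \<times> cball 0 \<epsilon>) (\<lambda>q. norm ((\<lambda>(s, y). g s y) q))"
    using unif_lip_g unfolding unif_lip_def by (intro continuous_on_norm) auto
  then have "closed A" unfolding A_def
    using continuous_closed_preimage[of "{0..1} \<times> cball 0 \<epsilon>" "\<lambda>q. norm ((\<lambda>(s, y). g s y) q)" "{\<eta>..\<delta>}"]
    by (simp add: closed_Times vimage_def Int_def)
  moreover have sub: "A \<subseteq> {0..1} \<times> cball 0 \<epsilon>" by (auto simp: A_def)
  ultimately have cA: "compact A"
    by (metis compact_Int_closed compact_Times compact_Icc compact_cball inf.absorb2)
  show ?thesis
  proof (cases "A = {}")
    case True
    then show ?thesis by (intro that[of 1]) (force simp: A_def)+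
  next
    case False
    obtain q where q: "q \<in> A" "\<forall>x\<in>A. Re ((\<lambda>(s, y). gram s y) q) \<le> Re ((\<lambda>(s, y). gram s y) x)"
      using continuous_attains_inf[OF cA False continuous_on_subset[OF cg sub]] by blast
    show ?thesis
    proof (rule that)
      show "Re ((\<lambda>(s, y). gram s y) q) > 0"
        using q(1) assms by (cases q) (auto simp: A_def intro!: regular)
      show "Re ((\<lambda>(s, y). gram s y) q) \<le> Re (gram s y)"
        if "s \<in> {0..1}" "norm y \<le> \<epsilon>" "\<eta> \<le> norm (g s y)" "norm (g s y) \<le> \<delta>" for s y
        using q(2)[rule_format, of "(s, y)"] that by (simp add: A_def)
    qed
  qed
qed

section \<open>Solutions of the truncated equation and curves inside the fibres\<close>

definition solves :: "(real \<Rightarrow> complex^'n \<Rightarrow> complex^'n) \<Rightarrow> (real \<Rightarrow> complex^'n) \<Rightarrow> bool" where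
  "solves V Y \<longleftrightarrow> (\<forall>s\<in>{0..1}. (Y has_vector_derivative V s (Y s)) (at s within {0..1}))"

text \<open>The square of the positive part of |Y|^2 - eps^2 is differentiable even where Y meets
  the sphere, and its derivative vanishes because the field is orthogonal to Y outside the ball.
  Being zero at time r, it is zero before and after r.\<close>

lemma solves_tfield_ball:
  assumes Y: "solves (tfield c) Y" and r: "r \<in> {0..1}" "norm (Y r) \<le> \<epsilon>" and s: "s \<in> {0..1}"
  shows "norm (Y s) \<le> \<epsilon>"
proof -
  define m :: "real \<Rightarrow> real" where "m x = (max 0 x)\<^sup>2" for x
  have m: "(m has_real_derivative 2 * max 0 x) (at x)" for x
  proof -
    consider "x > 0" | "x < 0" | "x = 0" by linarith
    then show ?thesis
    proof cases
      case 1
      have "((\<lambda>x. x\<^sup>2) has_real_derivative 2 * max 0 x) (at x)"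
        using 1 by (auto intro!: derivative_eq_intros)
      then show ?thesis by (rule has_field_derivative_transform_within_open[of _ _ _ "{0<..}"])
          (use 1 in \<open>auto simp: m_def\<close>)
    next
      case 2
      have "((\<lambda>x. 0) has_real_derivative 2 * max 0 x) (at x)"
        using 2 by (auto intro!: derivative_eq_intros)
      then show ?thesis by (rule has_field_derivative_transform_within_open[of _ _ _ "{..<0}"])
          (use 2 in \<open>auto simp: m_def\<close>)
    next
      case 3
      have "((\<lambda>h. m h / h) \<longlongrightarrow> 0) (at 0)"
      proof (rule Lim_null_comparison)
        show "\<forall>\<^sub>F h in at 0. norm (m h / h) \<le> \<bar>h\<bar>"
          by (auto simp: m_def max_def power2_eq_square)
        show "((\<lambda>h::real. \<bar>h\<bar>) \<longlongrightarrow> 0) (at 0)" by (auto intro!: tendsto_eq_intros)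
      qed
      moreover have "m 0 = 0" by (simp add: m_def)
      ultimately show ?thesis using 3 by (simp add: has_field_derivative_iff)
    qed
  qed
  define u where "u s = m (Y s \<bullet> Y s - \<epsilon>\<^sup>2)" for s
  have "(u has_derivative (\<lambda>h. 0)) (at s within {0..1})" if "s \<in> {0..1}" for s
  proof -
    have "(Y has_derivative (\<lambda>h. h *\<^sub>R tfield c s (Y s))) (at s within {0..1})"
      using Y that by (simp add: solves_def has_vector_derivative_def)
    then have "((\<lambda>s. Y s \<bullet> Y s - \<epsilon>\<^sup>2) has_derivative (\<lambda>h. 2 * h * (Y s \<bullet> tfield c s (Y s)))) (at s within {0..1})"
      by (auto intro!: derivative_eq_intros simp: inner_commute algebra_simps)
    from has_derivative_compose[OF this m[unfolded has_field_derivative_def]]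
    have "(u has_derivative (\<lambda>h. 2 * max 0 (Y s \<bullet> Y s - \<epsilon>\<^sup>2) * (2 * h * (Y s \<bullet> tfield c s (Y s))))) (at s within {0..1})"
      unfolding u_def[abs_def] .
    moreover have "max 0 (Y s \<bullet> Y s - \<epsilon>\<^sup>2) * (Y s \<bullet> tfield c s (Y s)) = 0"
    proof (cases "norm (Y s) \<ge> \<epsilon>")
      case False
      then have "(norm (Y s))\<^sup>2 \<le> \<epsilon>\<^sup>2" by (intro power_mono) auto
      then show ?thesis by (simp add: power2_norm_eq_inner)
    qed (simp add: tfield_radial)
    then have "(\<lambda>h. 2 * max 0 (Y s \<bullet> Y s - \<epsilon>\<^sup>2) * (2 * h * (Y s \<bullet> tfield c s (Y s)))) = (\<lambda>h. 0)"
      by (auto simp: fun_eq_iff)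
    ultimately show ?thesis by simp
  qed
  from has_derivative_zero_constant[OF _ this] have "u s = u r" using r s by force
  moreover have "(norm (Y r))\<^sup>2 \<le> \<epsilon>\<^sup>2" using r by (intro power_mono) auto
  ultimately have "m ((norm (Y s))\<^sup>2 - \<epsilon>\<^sup>2) = 0" by (simp add: u_def m_def power2_norm_eq_inner)
  then have "(norm (Y s))\<^sup>2 \<le> \<epsilon>\<^sup>2" by (auto simp: m_def max_def split: if_splits)
  then show ?thesis using eps by (simp add: power2_le_iff_abs_le)
qed

text \<open>As long as g stays near its value at time r, the curve runs where c bounds
  \<open>gram\<close> from below, so the truncated field is the true one and g is stationary.
  \<open>constant_if_stationary_near_value\<close> removes the circularity.\<close>

lemma solves_tfield_value:
  assumes Y: "solves (tfield c) Y" and r: "r \<in> {0..1}" "norm (Y r) \<le> \<epsilon>"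
    and c: "\<And>s y. s \<in> {0..1} \<Longrightarrow> norm y \<le> \<epsilon> \<Longrightarrow> norm (g r (Y r)) / 2 \<le> norm (g s y) \<Longrightarrow> norm (g s y) \<le> \<delta> \<Longrightarrow> c \<le> Re (gram s y)" "c > 0"
    and \<eta>: "0 < norm (g r (Y r))" "norm (g r (Y r)) < \<delta>" and s: "s \<in> {0..1}"
  shows "g s (Y s) = g r (Y r)"
proof (rule constant_if_stationary_near_value[where v = "\<lambda>s. g s (Y s)"])
  let ?\<eta> = "g r (Y r)"
  show "((\<lambda>s. g s (Y s)) has_vector_derivative (b s (Y s) + (\<Sum>i\<in>UNIV. p i s (Y s) * tfield c s (Y s) $ i))) (at s within {0..1})"
    if "s \<in> {0..1}" for s using Y that by (intro chain) (auto simp: solves_def)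
  \<comment> \<open>Closer than |\<eta>| / 2 to \<eta>, g has modulus at least |\<eta>| / 2; closer
    than \<delta> - |\<eta>|, it has modulus at most \<delta>. This is the range in which c is
    available.\<close>
  show "b s (Y s) + (\<Sum>i\<in>UNIV. p i s (Y s) * tfield c s (Y s) $ i) = 0"
    if s: "s \<in> {0..1}" and d: "dist (g s (Y s)) ?\<eta> < min (norm ?\<eta> / 2) (\<delta> - norm ?\<eta>)" for s
  proof -
    have ball: "norm (Y s) \<le> \<epsilon>" using solves_tfield_ball[OF Y r s] .
    have "norm ?\<eta> / 2 \<le> norm (g s (Y s))" "norm (g s (Y s)) \<le> \<delta>"
      using d norm_triangle_ineq2[of "g s (Y s)" ?\<eta>] norm_triangle_ineq3[of "g s (Y s)" ?\<eta>] by (auto simp: dist_norm)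
    from c(1)[OF s ball this] have gr: "c \<le> Re (gram s (Y s))" .
    have "(\<Sum>i\<in>UNIV. p i s (Y s) * field s (Y s) $ i) = - b s (Y s) * of_real (Re (gram s (Y s)) * (1 / Re (gram s (Y s))))"
      unfolding field_def by (rule field_with_vertical)
    then show ?thesis using c(2) gr by (simp add: tfield_eq_field[OF ball gr])
  qed
qed (use assms in auto)

text \<open>Formulated with the untruncated field, so that curves constructed with different
  truncation levels can be compared.\<close>

definition fibre_curve :: "(real \<Rightarrow> complex^'n) \<Rightarrow> bool" where
  "fibre_curve Y \<longleftrightarrow> solves field Y \<and> (\<forall>s\<in>{0..1}. norm (Y s) \<le> \<epsilon> \<and> g s (Y s) = g 0 (Y 0)) \<and>
     0 < norm (g 0 (Y 0)) \<and> norm (g 0 (Y 0)) < \<delta>"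

lemma fibre_curveD:
  assumes "fibre_curve Y"
  shows "s \<in> {0..1} \<Longrightarrow> (Y has_vector_derivative field s (Y s)) (at s within {0..1})"
    and "s \<in> {0..1} \<Longrightarrow> norm (Y s) \<le> \<epsilon>" and "s \<in> {0..1} \<Longrightarrow> g s (Y s) = g 0 (Y 0)"
    and "0 < norm (g 0 (Y 0))" "norm (g 0 (Y 0)) < \<delta>"
  using assms unfolding fibre_curve_def solves_def by blast+

lemma fibre_curve_exists:
  assumes r: "r = 0 \<or> r = 1" and y: "norm y \<le> \<epsilon>" "0 < norm (g r y)" "norm (g r y) < \<delta>"
  obtains Y where "fibre_curve Y" "Y r = y"
proof -
  obtain c where c: "c > 0"
    "\<And>s x. s \<in> {0..1} \<Longrightarrow> norm x \<le> \<epsilon> \<Longrightarrow> norm (g r y) / 2 \<le> norm (g s x) \<Longrightarrow> norm (g s x) \<le> \<delta> \<Longrightarrow> c \<le> Re (gram s x)"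
    using gram_lower_bound[of "norm (g r y) / 2"] y by (metis half_gt_zero)
  obtain L where L: "\<And>s y y'. s \<in> {0..1} \<Longrightarrow> norm (tfield c s y - tfield c s y') \<le> L * norm (y - y')"
    using tfield_lipschitz[OF c(1)] by blast
  obtain B where B: "\<And>s y. s \<in> {0..1} \<Longrightarrow> norm (tfield c s y) \<le> B"
    using tfield_bounded[OF c(1)] by blast
  have "\<exists>Y. Y r = y \<and> solves (tfield c) Y"
    using r
  proof
    assume "r = 0"
    then show ?thesis using lipschitz_ode_exists[OF tfield_continuous[OF c(1)] L B, of y]
      unfolding solves_def by metis
  next
    assume "r = 1"
    then show ?thesis using lipschitz_ode_exists_final[OF tfield_continuous[OF c(1)] L B, of y]
      unfolding solves_def by metis
  qed
  then obtain Y where Y: "Y r = y" "solves (tfield c) Y" by blast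
  have r01: "r \<in> {0..1}" using r by auto
  have ball: "norm (Y s) \<le> \<epsilon>" if "s \<in> {0..1}" for s
    using solves_tfield_ball[OF Y(2) r01 _ that] Y y by simp
  have val: "g s (Y s) = g r y" if "s \<in> {0..1}" for s
    using solves_tfield_value[OF Y(2) r01, of s] Y y c that by simp
  have "solves field Y"
    unfolding solves_def
  proof
    fix s :: real assume s: "s \<in> {0..1}"
    have gr: "c \<le> Re (gram s (Y s))" using y by (intro c(2) s ball) (auto simp: val[OF s])
    then show "(Y has_vector_derivative field s (Y s)) (at s within {0..1})"
      using Y(2) s unfolding solves_def tfield_eq_field[OF ball[OF s] gr, symmetric] by blast
  qed
  then have "fibre_curve Y" unfolding fibre_curve_def using ball val y by simp
  then show ?thesis using that Y by blast
qed

text \<open>Curves whose values have modulus at least \<eta> all solve the equation of one common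
  truncated field, whose Lipschitz constant feeds \<open>lipschitz_ode_gronwall\<close>.\<close>

lemma fibre_curve_lipschitz:
  assumes "\<eta> > 0"
  obtains C where "\<And>Y Z r s. fibre_curve Y \<Longrightarrow> fibre_curve Z \<Longrightarrow> \<eta> \<le> norm (g 0 (Y 0)) \<Longrightarrow> \<eta> \<le> norm (g 0 (Z 0)) \<Longrightarrow>
    r \<in> {0..1} \<Longrightarrow> s \<in> {0..1} \<Longrightarrow> norm (Y s - Z s) \<le> C * norm (Y r - Z r)"
proof -
  obtain c where c: "c > 0"
    "\<And>s y. s \<in> {0..1} \<Longrightarrow> norm y \<le> \<epsilon> \<Longrightarrow> \<eta> \<le> norm (g s y) \<Longrightarrow> norm (g s y) \<le> \<delta> \<Longrightarrow> c \<le> Re (gram s y)"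
    using gram_lower_bound[OF assms] by blast
  obtain L where L: "\<And>s y y'. s \<in> {0..1} \<Longrightarrow> norm (tfield c s y - tfield c s y') \<le> L * norm (y - y')"
    using tfield_lipschitz[OF c(1)] by blast
  have tf: "(Y has_vector_derivative tfield c s (Y s)) (at s within {0..1})"
    if Y: "fibre_curve Y" "\<eta> \<le> norm (g 0 (Y 0))" and s: "s \<in> {0..1}" for Y s
  proof -
    note D = fibre_curveD[OF Y(1)]
    have "c \<le> Re (gram s (Y s))" using Y(2) D(5) by (intro c(2) s D(2)) (simp_all add: D(3)[OF s])
    then show ?thesis using D(1)[OF s] tfield_eq_field[OF D(2)[OF s]] by simp
  qed
  show ?thesis
  proof (rule that)
    fix Y Z r s
    assume "fibre_curve Y" "fibre_curve Z" "\<eta> \<le> norm (g 0 (Y 0))" "\<eta> \<le> norm (g 0 (Z 0))"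
      "r \<in> {0..1::real}" "s \<in> {0..1::real}"
    then show "norm (Y s - Z s) \<le> exp \<bar>L\<bar> * norm (Y r - Z r)"
      using lipschitz_ode_gronwall[of "tfield c" Y Z L s r] tf L by blast
  qed
qed

lemma fibre_curve_unique:
  assumes "fibre_curve Y" "fibre_curve Z" "Y r = Z r" "r \<in> {0..1}" "s \<in> {0..1}"
  shows "Y s = Z s"
proof -
  let ?\<eta> = "min (norm (g 0 (Y 0))) (norm (g 0 (Z 0)))"
  have "?\<eta> > 0" using assms fibre_curveD(4) by simp
  then obtain C where "norm (Y s - Z s) \<le> C * norm (Y r - Z r)"
    using fibre_curve_lipschitz[of ?\<eta>] assms by (metis min.cobounded1 min.cobounded2)
  then show ?thesis using assms by simp
qed

section \<open>Transport between the two ends of the family\<close>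

definition total :: "real \<Rightarrow> (complex^'n) set" where
  "total s = {y \<in> cball 0 \<epsilon>. g s y \<in> ball 0 \<delta> - {0}}"

text \<open>For y in \<open>total r\<close> with r = 0 or r = 1 a curve exists, and by
  \<open>fibre_curve_unique\<close> the choice does not matter for s in [0,1].\<close>

definition transport :: "real \<Rightarrow> real \<Rightarrow> complex^'n \<Rightarrow> complex^'n" where
  "transport r s y = (SOME Y. fibre_curve Y \<and> Y r = y) s"

lemma transport_curve:
  assumes "r = 0 \<or> r = 1" "y \<in> total r"
  obtains Y where "fibre_curve Y" "Y r = y" "\<And>s. transport r s y = Y s"
proof -
  have "norm y \<le> \<epsilon>" "0 < norm (g r y)" "norm (g r y) < \<delta>" using assms(2) by (auto simp: total_def)
  from fibre_curve_exists[OF assms(1) this] have "\<exists>Y. fibre_curve Y \<and> Y r = y" by blast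
  from someI_ex[OF this] show ?thesis using that unfolding transport_def by blast
qed

lemma transport_total:
  assumes "r = 0 \<or> r = 1" "y \<in> total r" "s \<in> {0..1}"
  shows "transport r s y \<in> total s" "g s (transport r s y) = g r y"
proof -
  obtain Y where Y: "fibre_curve Y" "Y r = y" "\<And>s. transport r s y = Y s"
    using transport_curve[OF assms(1,2)] by blast
  have "r \<in> {0..1}" using assms by auto
  then have "g r y = g 0 (Y 0)" using fibre_curveD(3)[OF Y(1)] Y(2) by blast
  then show "transport r s y \<in> total s" "g s (transport r s y) = g r y"
    using fibre_curveD(2,3)[OF Y(1) assms(3)] fibre_curveD(4,5)[OF Y(1)] Y(3) by (simp_all add: total_def)
qed

lemma transport_inverse:
  assumes "r = 0 \<or> r = 1" "s = 0 \<or> s = 1" "y \<in> total r"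
  shows "transport s r (transport r s y) = y"
proof -
  obtain Y where Y: "fibre_curve Y" "Y r = y" "\<And>s. transport r s y = Y s"
    using transport_curve[OF assms(1,3)] by blast
  have rs: "r \<in> {0..1}" "s \<in> {0..1}" using assms by auto
  have "transport r s y \<in> total s" using transport_total assms rs by blast
  then obtain Z where Z: "fibre_curve Z" "Z s = transport r s y" "\<And>q. transport s q (transport r s y) = Z q"
    using transport_curve[OF assms(2)] by blast
  have "Z r = Y r" using fibre_curve_unique[OF Z(1) Y(1), of s r] Z Y rs by simp
  then show ?thesis using Z Y by simp
qed

lemma transport_continuous:
  assumes r: "r = 0 \<or> r = 1" and s: "s = 0 \<or> s = 1"
  shows "continuous_on (total r) (transport r s)"
  unfolding continuous_on_def
proof
  fix y assume y: "y \<in> total r"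
  have rs: "r \<in> {0..1}" "s \<in> {0..1}" using r s by auto
  \<comment> \<open>Near y the value keeps at least half of its modulus, which yields one Lipschitz
    constant on a neighbourhood of y.\<close>
  let ?\<eta> = "norm (g r y) / 2"
  have \<eta>: "?\<eta> > 0" using y by (auto simp: total_def)
  obtain C where C: "\<And>Y Z r s. fibre_curve Y \<Longrightarrow> fibre_curve Z \<Longrightarrow> ?\<eta> \<le> norm (g 0 (Y 0)) \<Longrightarrow> ?\<eta> \<le> norm (g 0 (Z 0)) \<Longrightarrow>
    r \<in> {0..1} \<Longrightarrow> s \<in> {0..1} \<Longrightarrow> norm (Y s - Z s) \<le> C * norm (Y r - Z r)"
    using fibre_curve_lipschitz[OF \<eta>] by blast
  have est: "norm (transport r s x - transport r s y) \<le> C * norm (x - y)" if x: "x \<in> total r" "?\<eta> \<le> norm (g r x)" for x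
  proof -
    obtain Y where Y: "fibre_curve Y" "Y r = y" "\<And>s. transport r s y = Y s"
      using transport_curve[OF r y] by blast
    obtain X where X: "fibre_curve X" "X r = x" "\<And>s. transport r s x = X s"
      using transport_curve[OF r x(1)] by blast
    have "g 0 (X 0) = g r x" "g 0 (Y 0) = g r y" 
      using X(2) Y(2) fibre_curveD(3)[OF X(1) rs(1)] fibre_curveD(3)[OF Y(1) rs(1)] by simp_all
    then show ?thesis using C[OF X(1) Y(1), of r s] X Y x rs by simp
  qed
  have "continuous_on (cball 0 \<epsilon>) (\<lambda>y. (\<lambda>(s, y). g s y) (r, y))"
  proof (rule continuous_on_compose2[of "{0..1} \<times> cball 0 \<epsilon>" "\<lambda>(s, y). g s y" _ "\<lambda>y. (r, y)"])
    show "continuous_on ({0..1} \<times> cball 0 \<epsilon>) (\<lambda>(s, y). g s y)" using unif_lip_g by (simp add: unif_lip_def)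
    show "continuous_on (cball 0 \<epsilon>) (\<lambda>y::complex^'n. (r, y))" by (intro continuous_intros)
  qed (use rs in auto)
  then have "continuous_on (cball 0 \<epsilon>) (g r)" by simp
  then have "continuous_on (total r) (g r)"
    by (rule continuous_on_subset) (auto simp: total_def)
  then have "((\<lambda>x. norm (g r x)) \<longlongrightarrow> norm (g r y)) (at y within total r)"
    using y by (intro tendsto_norm) (auto simp: continuous_on_def)
  then have "\<forall>\<^sub>F x in at y within total r. ?\<eta> < norm (g r x)"
    using \<eta> by (intro order_tendstoD(1)) auto
  moreover have "\<forall>\<^sub>F x in at y within total r. x \<in> total r" by (simp add: eventually_at_filter)
  ultimately have "\<forall>\<^sub>F x in at y within total r. norm (transport r s x - transport r s y) \<le> C * norm (x - y)"
    by eventually_elim (simp add: est)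
  then have "((\<lambda>x. transport r s x - transport r s y) \<longlongrightarrow> 0) (at y within total r)"
    by (rule Lim_null_comparison) (auto intro!: tendsto_eq_intros)
  then show "(transport r s \<longlongrightarrow> transport r s y) (at y within total r)" by (rule LIM_zero_cancel)
qed

theorem total_space_homeomorphism:
  "\<exists>\<Phi> \<Psi>. homeomorphism (total 0) (total 1) \<Phi> \<Psi> \<and> (\<forall>y\<in>total 0. g 1 (\<Phi> y) = g 0 y)"
proof (intro exI conjI)
  show "homeomorphism (total 0) (total 1) (transport 0 1) (transport 1 0)"
    using transport_continuous[of 0 1] transport_continuous[of 1 0] transport_inverse[of 0 1]
      transport_inverse[of 1 0] transport_total(1)[of 0 _ 1] transport_total(1)[of 1 _ 0]
    by (intro homeomorphismI image_subsetI) simp_all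
  show "\<forall>y\<in>total 0. g 1 (transport 0 1 y) = g 0 y" using transport_total(2)[of 0 _ 1] by simp
qed

end

section \<open>Newton polyhedra and face functions\<close>

definition wt :: "nat^'n \<Rightarrow> nat^'n \<Rightarrow> nat" where
  "wt w \<alpha> = (\<Sum>i\<in>UNIV. w $ i * \<alpha> $ i)"

lemma wdot_real_of_exp: "wdot w (real_of_exp \<alpha>) = real (wt w \<alpha>)"
  by (simp add: wdot_def real_of_exp_def wt_def)

lemma wdot_inner: "wdot w x = (\<chi> i. real (w $ i)) \<bullet> x"
  by (simp add: wdot_def inner_vec_def)

lemma wdot_le: "(\<And>i. x $ i \<le> y $ i) \<Longrightarrow> wdot w x \<le> wdot w y"
  by (auto simp: wdot_def intro!: sum_mono mult_left_mono)

lemma exp_in_newton_polyhedron: "\<alpha> \<in> zsupp g \<Longrightarrow> real_of_exp \<alpha> \<in> newton_polyhedron g"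
  unfolding newton_polyhedron_def by (rule hull_inc) (auto simp: real_of_exp_def)

lemma newton_polyhedron_wdot_ge:
  assumes "\<And>\<alpha>. \<alpha> \<in> zsupp g \<Longrightarrow> m \<le> real (wt w \<alpha>)" and x: "x \<in> newton_polyhedron g"
  shows "m \<le> wdot w x"
proof -
  have "newton_polyhedron g \<subseteq> {x. (\<chi> i. real (w $ i)) \<bullet> x \<ge> m}"
    unfolding newton_polyhedron_def
  proof (rule hull_minimal)
    show "convex {x. (\<chi> i. real (w $ i)) \<bullet> x \<ge> m}" by (rule convex_halfspace_ge)
    show "(\<Union>\<alpha>\<in>zsupp g. {x. \<forall>i. real (\<alpha> $ i) \<le> x $ i}) \<subseteq> {x. (\<chi> i. real (w $ i)) \<bullet> x \<ge> m}"
    proof clarify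
      fix \<alpha> x assume a: "\<alpha> \<in> zsupp g" "\<forall>i. real (\<alpha> $ i) \<le> x $ i"
      have "wdot w (real_of_exp \<alpha>) \<le> wdot w x" using a by (intro wdot_le) (simp add: real_of_exp_def)
      then show "m \<le> (\<chi> i. real (w $ i)) \<bullet> x" using assms(1)[OF a(1)]
        by (simp add: wdot_real_of_exp flip: wdot_inner)
    qed
  qed
  then show ?thesis using x by (auto simp: wdot_inner)
qed

lemma newton_d_attained:
  assumes ne: "zsupp g \<noteq> {}"
  obtains \<alpha> where "\<alpha> \<in> zsupp g" "newton_d w g = real (wt w \<alpha>)"
    "\<And>\<beta>. \<beta> \<in> zsupp g \<Longrightarrow> wt w \<alpha> \<le> wt w \<beta>"
proof -
  obtain \<alpha> where \<alpha>: "\<alpha> \<in> zsupp g" "\<And>\<beta>. \<beta> \<in> zsupp g \<Longrightarrow> wt w \<alpha> \<le> wt w \<beta>"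
    using ex_has_least_nat[of "\<lambda>\<alpha>. \<alpha> \<in> zsupp g" _ "wt w"] ne by blast
  have ge: "real (wt w \<alpha>) \<le> wdot w x" if "x \<in> newton_polyhedron g" for x
    using newton_polyhedron_wdot_ge[OF _ that, of "real (wt w \<alpha>)" w] \<alpha>(2) by simp
  have "newton_d w g = real (wt w \<alpha>)"
    unfolding newton_d_def
  proof (rule cInf_eq_minimum)
    show "real (wt w \<alpha>) \<in> wdot w ` newton_polyhedron g"
      using exp_in_newton_polyhedron[OF \<alpha>(1)] wdot_real_of_exp[of w \<alpha>] by (metis imageI)
  qed (use ge in auto)
  then show ?thesis using that \<alpha> by simp
qed

lemma newton_d_le:
  assumes "x \<in> newton_polyhedron g"
  shows "newton_d w g \<le> wdot w x"
proof (cases "zsupp g = {}")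
  case True
  then show ?thesis using assms by (simp add: newton_polyhedron_def)
next
  case False
  obtain \<alpha> where "newton_d w g = real (wt w \<alpha>)" "\<And>\<beta>. \<beta> \<in> zsupp g \<Longrightarrow> wt w \<alpha> \<le> wt w \<beta>"
    using newton_d_attained[OF False] by metis
  then show ?thesis using newton_polyhedron_wdot_ge[OF _ assms, of "newton_d w g" w] by simp
qed

text \<open>Exponents of the support lie in the polyhedron, so for them lying on the face is a
  matter of weight; all other coefficients are zero on both sides.\<close>

lemma face_fun_eq:
  "face_fun w g \<alpha> = (if real (wt w \<alpha>) = newton_d w g then g \<alpha> else 0)"
  using exp_in_newton_polyhedron[of \<alpha> g]
  by (auto simp: face_fun_def newton_Delta_def wdot_real_of_exp zsupp_def)

text \<open>The polyhedron is the Minkowski sum of the compact hull of the exponents and the closed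
  orthant.\<close>

lemma newton_polyhedron_closed:
  fixes g :: "nat^'n \<Rightarrow> complex"
  assumes "finite (zsupp g)"
  shows "closed (newton_polyhedron g)"
proof -
  let ?O = "{y :: real^'n. \<forall>i. 0 \<le> y $ i}"
  have "(\<Union>\<alpha>\<in>zsupp g. {x. \<forall>i. real (\<alpha> $ i) \<le> x $ i}) = {x + y | x y. x \<in> real_of_exp ` zsupp g \<and> y \<in> ?O}"
  proof (intro equalityI subsetI)
    fix x assume "x \<in> (\<Union>\<alpha>\<in>zsupp g. {x. \<forall>i. real (\<alpha> $ i) \<le> x $ i})"
    then obtain \<alpha> where "\<alpha> \<in> zsupp g" "\<forall>i. real (\<alpha> $ i) \<le> x $ i" by auto
    then have "x = real_of_exp \<alpha> + (x - real_of_exp \<alpha>)" "x - real_of_exp \<alpha> \<in> ?O" "real_of_exp \<alpha> \<in> real_of_exp ` zsupp g"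
      by (auto simp: real_of_exp_def)
    then show "x \<in> {x + y | x y. x \<in> real_of_exp ` zsupp g \<and> y \<in> ?O}" by blast
  next
    fix x assume "x \<in> {x + y | x y. x \<in> real_of_exp ` zsupp g \<and> y \<in> ?O}"
    then obtain \<alpha> y where "\<alpha> \<in> zsupp g" "x = real_of_exp \<alpha> + y" "\<forall>i. 0 \<le> y $ i" by blast
    then show "x \<in> (\<Union>\<alpha>\<in>zsupp g. {x. \<forall>i. real (\<alpha> $ i) \<le> x $ i})"
      by (intro UN_I[of \<alpha>]) (auto simp: real_of_exp_def)
  qed
  moreover have "convex ?O" by (auto simp: convex_def)
  moreover have "{x + y | x y. x \<in> S \<and> y \<in> T} = S + T" for S T :: "(real^'n) set"
    by (auto simp: set_plus_def)
  ultimately have "newton_polyhedron g = {x + y | x y. x \<in> convex hull (real_of_exp ` zsupp g) \<and> y \<in> ?O}"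
    unfolding newton_polyhedron_def by (simp only: convex_hull_set_plus hull_same)
  also have "\<dots> = (\<Union>x\<in>convex hull (real_of_exp ` zsupp g). \<Union>y\<in>?O. {x + y})" by blast
  also have "closed \<dots>"
  proof (rule compact_closed_sums)
    show "compact (convex hull (real_of_exp ` zsupp g))"
      using assms by (intro compact_convex_hull finite_imp_compact) auto
    have "?O = (\<Inter>i. {y. 0 \<le> y $ i})" by auto
    also have "closed \<dots>" by (intro closed_INT ballI closed_Collect_le continuous_intros)
    finally show "closed ?O" .
  qed
  finally show ?thesis .
qed

text \<open>On the face all coordinates are nonnegative and x_i <= w_i x_i <= w.x = d, since a
  positive integral weight has w_i >= 1.\<close>

lemma newton_Delta_compact_face:
  fixes g :: "nat^'n \<Rightarrow> complex"
  assumes fin: "finite (zsupp g)" and w: "positive_weight w" and ne: "zsupp g \<noteq> {}"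
  shows "newton_Delta w g face_of newton_polyhedron g" "compact (newton_Delta w g)"
proof -
  have D: "newton_Delta w g = newton_polyhedron g \<inter> {x. (\<chi> i. real (w $ i)) \<bullet> x = newton_d w g}"
    by (auto simp: newton_Delta_def wdot_inner)
  have "convex (newton_polyhedron g)" by (simp add: newton_polyhedron_def)
  then show "newton_Delta w g face_of newton_polyhedron g"
    unfolding D by (rule face_of_Int_supporting_hyperplane_ge) (simp add: newton_d_le flip: wdot_inner)
  have nonneg: "0 \<le> x $ i" if "x \<in> newton_polyhedron g" for x i
  proof -
    have "newton_polyhedron g \<subseteq> {x. axis i 1 \<bullet> x \<ge> 0}"
      unfolding newton_polyhedron_def
    proof (rule hull_minimal)
      show "convex {x :: real^'n. axis i 1 \<bullet> x \<ge> 0}" by (rule convex_halfspace_ge)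
    qed (auto simp: inner_axis' intro: order_trans[OF of_nat_0_le_iff])
    then show ?thesis using that by (auto simp: inner_axis')
  qed
  have "newton_Delta w g \<subseteq> cbox 0 (\<chi> i. newton_d w g)"
  proof
    fix x assume x: "x \<in> newton_Delta w g"
    then have xp: "x \<in> newton_polyhedron g" and eq: "wdot w x = newton_d w g" by (auto simp: newton_Delta_def)
    have "x $ i \<le> newton_d w g" for i
    proof -
      have "real 1 * x $ i \<le> real (w $ i) * x $ i"
        using w nonneg[OF xp, of i] by (intro mult_right_mono) (auto simp: positive_weight_def Suc_le_eq simp del: of_nat_1)
      also have "\<dots> \<le> wdot w x" unfolding wdot_def
        by (rule member_le_sum) (use nonneg[OF xp] in auto)
      finally show ?thesis using eq by simp
    qed
    then show "x \<in> cbox 0 (\<chi> i. newton_d w g)" using nonneg[OF xp] by (simp add: mem_box_cart)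
  qed
  then have "bounded (newton_Delta w g)" using bounded_cbox bounded_subset by blast
  moreover have "closed (newton_Delta w g)"
    unfolding D by (intro closed_Int newton_polyhedron_closed fin closed_hyperplane)
  ultimately show "compact (newton_Delta w g)" using compact_eq_bounded_closed by blast
qed

lemma newton_boundary_subset: "newton_boundary g \<subseteq> newton_polyhedron g"
  by (auto simp: newton_boundary_def dest: face_of_imp_subset)

lemma newton_boundary_meets_face:
  assumes "finite (zsupp g)" "positive_weight w" "zsupp g \<noteq> {}"
  obtains x where "x \<in> newton_boundary g" "wdot w x = newton_d w g"
proof -
  obtain \<alpha> where \<alpha>: "\<alpha> \<in> zsupp g" "newton_d w g = real (wt w \<alpha>)"
    using newton_d_attained[OF assms(3)] by metis
  then have "real_of_exp \<alpha> \<in> newton_Delta w g"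
    by (simp add: newton_Delta_def exp_in_newton_polyhedron wdot_real_of_exp)
  then have "real_of_exp \<alpha> \<in> newton_boundary g"
    using newton_Delta_compact_face[OF assms] by (auto simp: newton_boundary_def)
  then show ?thesis using that \<alpha> by (simp add: wdot_real_of_exp)
qed

text \<open>A nonzero polynomial has a nonempty Newton boundary, as the weight (1,...,1) shows,
  whereas the zero polynomial has an empty polyhedron. Along a family with constant boundary, a
  slice thus vanishes for one parameter only if it does for all.\<close>

lemma zsupp_empty_boundary:
  assumes "newton_boundary g \<subseteq> newton_boundary h" "finite (zsupp g)" "zsupp h = {}"
  shows "zsupp g = {}"
proof (rule ccontr)
  assume ne: "zsupp g \<noteq> {}"
  have "positive_weight (\<chi> i. 1)" by (simp add: positive_weight_def)
  from newton_boundary_meets_face[OF assms(2) this ne] obtain x where "x \<in> newton_boundary g" by blast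
  then have "x \<in> newton_polyhedron h" using assms newton_boundary_subset by blast
  then show False using assms(3) by (simp add: newton_polyhedron_def)
qed

text \<open>The weights N w + (1,...,1) are positive; N large makes them select a w-minimal exponent.\<close>
lemma newton_d_mono_boundary:
  fixes g h :: "nat^'n \<Rightarrow> complex"
  assumes sub: "newton_boundary g \<subseteq> newton_boundary h"
    and fin: "finite (zsupp g)" and ne: "zsupp g \<noteq> {}"
  shows "newton_d w h \<le> newton_d w g"
proof -
  have neh: "zsupp h \<noteq> {}" using zsupp_empty_boundary[OF sub fin] ne by blast
  obtain \<alpha> where \<alpha>: "\<alpha> \<in> zsupp g" "newton_d w g = real (wt w \<alpha>)"
    using newton_d_attained[OF ne, of w] by metis
  \<comment> \<open>One more than the degree of \<alpha>: the v-weight of \<alpha> is then below N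
    (wt w \<alpha> + 1), so an exponent of no larger v-weight cannot have larger w-weight.\<close>
  define N where "N = Suc (wt (\<chi> i. 1) \<alpha>)"
  define v :: "nat^'n" where "v = (\<chi> i. N * w $ i + 1)"
  have v: "positive_weight v" by (simp add: positive_weight_def v_def)
  have wtv: "wt v \<beta> = N * wt w \<beta> + wt (\<chi> i. 1) \<beta>" for \<beta>
    by (simp add: wt_def v_def algebra_simps sum.distrib sum_distrib_left)
  obtain x where x: "x \<in> newton_boundary g" "wdot v x = newton_d v g"
    using newton_boundary_meets_face[OF fin v ne] by blast
  obtain \<beta> where \<beta>: "\<beta> \<in> zsupp h" "newton_d v h = real (wt v \<beta>)"
    using newton_d_attained[OF neh, of v] by metis
  obtain \<gamma> where \<gamma>: "newton_d v g = real (wt v \<gamma>)" "\<And>\<beta>. \<beta> \<in> zsupp g \<Longrightarrow> wt v \<gamma> \<le> wt v \<beta>"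
    using newton_d_attained[OF ne, of v] by metis
  obtain \<beta>' where \<beta>': "newton_d w h = real (wt w \<beta>')" "\<And>\<beta>. \<beta> \<in> zsupp h \<Longrightarrow> wt w \<beta>' \<le> wt w \<beta>"
    using newton_d_attained[OF neh, of w] by metis
  have "x \<in> newton_polyhedron h" using x sub newton_boundary_subset by blast
  from newton_d_le[OF this, of v] have "wt v \<beta> \<le> wt v \<gamma>" using x \<beta>(2) \<gamma>(1) by simp
  also have "\<dots> \<le> wt v \<alpha>" using \<gamma> \<alpha> by blast
  finally have "N * wt w \<beta> < N * (wt w \<alpha> + 1)" unfolding wtv N_def by simp
  then have "wt w \<beta> \<le> wt w \<alpha>" by (simp only: mult_less_cancel1) simp
  then show ?thesis using \<beta>'(2)[OF \<beta>(1)] \<beta>'(1) \<alpha>(2) by simp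
qed

text \<open>Faces for weights with zero entries are in general not compact and need not lie in the
  boundary, but the boundary still determines their level d. Local tameness is about such
  weights.\<close>

lemma newton_d_eq_of_boundary_eq:
  assumes "newton_boundary g = newton_boundary h" "finite (zsupp g)" "finite (zsupp h)" "zsupp g \<noteq> {}"
  shows "newton_d w g = newton_d w h"
proof (rule antisym)
  have "zsupp h \<noteq> {}" using zsupp_empty_boundary[of g h] assms by auto
  then show "newton_d w g \<le> newton_d w h" "newton_d w h \<le> newton_d w g"
    using assms by (auto intro: newton_d_mono_boundary)
qed

section \<open>Polynomials with a parameter and their partial derivatives\<close>

lemma zeval_superset:
  assumes "finite A" "zsupp g \<subseteq> A"
  shows "zeval g z = (\<Sum>\<alpha>\<in>A. g \<alpha> * zmonom \<alpha> z)"
  unfolding zeval_def by (rule sum.mono_neutral_left) (use assms in \<open>auto simp: zsupp_def\<close>)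

definition zsupports :: "(nat \<Rightarrow> nat^'n \<Rightarrow> complex) \<Rightarrow> (nat^'n) set" where
  "zsupports c = snd ` tzsupp c"

lemma finite_zsupports: "is_tzpoly c \<Longrightarrow> finite (zsupports c)"
  by (simp add: zsupports_def is_tzpoly_def)

lemma zsupp_tslice_subset: "zsupp (tslice c t) \<subseteq> zsupports c"
proof
  fix \<alpha> assume "\<alpha> \<in> zsupp (tslice c t)"
  then have "(\<Sum>j | c j \<alpha> \<noteq> 0. c j \<alpha> * t ^ j) \<noteq> 0" by (simp add: zsupp_def tslice_def)
  then obtain j where "c j \<alpha> \<noteq> 0" by (metis (mono_tags, lifting) mem_Collect_eq sum.not_neutral_contains_not_neutral)
  then have "(j, \<alpha>) \<in> tzsupp c" by (simp add: tzsupp_def)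
  then show "\<alpha> \<in> zsupports c" unfolding zsupports_def by (metis image_eqI snd_conv)
qed

lemma finite_zsupp_tslice: "is_tzpoly c \<Longrightarrow> finite (zsupp (tslice c t))"
  using finite_subset[OF zsupp_tslice_subset finite_zsupports] .

lemma tzeval_eq: 
  assumes "is_tzpoly c"
  shows "tzeval c t z = (\<Sum>\<alpha>\<in>zsupports c. tslice c t \<alpha> * zmonom \<alpha> z)"
    and "tzeval c t z = zeval (tslice c t) z"
proof -
  have fj: "finite {j. c j \<alpha> \<noteq> 0}" for \<alpha>
  proof (rule finite_subset)
    show "{j. c j \<alpha> \<noteq> 0} \<subseteq> fst ` tzsupp c"
      by (rule subsetI, rule image_eqI[of _ _ "(_, \<alpha>)"]) (auto simp: tzsupp_def)
  qed (use assms in \<open>simp add: is_tzpoly_def\<close>)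
  have eq: "tzsupp c = prod.swap ` (SIGMA \<alpha>:zsupports c. {j. c j \<alpha> \<noteq> 0})"
  proof (intro equalityI subsetI)
    fix x assume x: "x \<in> tzsupp c"
    obtain j \<alpha> where "x = (j, \<alpha>)" by (cases x)
    then have "c j \<alpha> \<noteq> 0" "\<alpha> \<in> zsupports c" "x = prod.swap (\<alpha>, j)"
      using x by (auto simp: tzsupp_def zsupports_def intro: image_eqI[of _ _ "(j, \<alpha>)"])
    then show "x \<in> prod.swap ` (SIGMA \<alpha>:zsupports c. {j. c j \<alpha> \<noteq> 0})" by blast
  qed (auto simp: tzsupp_def)
  have "tzeval c t z = (\<Sum>(\<alpha>, j)\<in>(SIGMA \<alpha>:zsupports c. {j. c j \<alpha> \<noteq> 0}). c j \<alpha> * t ^ j * zmonom \<alpha> z)"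
    unfolding tzeval_def eq by (subst sum.reindex) (auto simp: case_prod_beta)
  also have "\<dots> = (\<Sum>\<alpha>\<in>zsupports c. \<Sum>j\<in>{j. c j \<alpha> \<noteq> 0}. c j \<alpha> * t ^ j * zmonom \<alpha> z)"
    by (rule sum.Sigma[symmetric]) (use fj finite_zsupports[OF assms] in auto)
  finally show *: "tzeval c t z = (\<Sum>\<alpha>\<in>zsupports c. tslice c t \<alpha> * zmonom \<alpha> z)"
    by (simp add: tslice_def sum_distrib_right)
  show "tzeval c t z = zeval (tslice c t) z"
    unfolding * by (rule zeval_superset[symmetric]) (use finite_zsupports[OF assms] zsupp_tslice_subset in auto)
qed

lemma tslice_tendsto: "(t \<longlongrightarrow> t0) F \<Longrightarrow> ((\<lambda>m. tslice c (t m) \<alpha>) \<longlongrightarrow> tslice c t0 \<alpha>) F"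
  unfolding tslice_def by (intro tendsto_intros)

text \<open>The natural subtraction in the exponent is harmless: when it is cut off at 0, the factor
  \<open>of_nat (\<alpha> $ i)\<close> vanishes.\<close>

definition dmonom :: "'n \<Rightarrow> nat^'n \<Rightarrow> complex^'n \<Rightarrow> complex" where
  "dmonom i \<alpha> z = of_nat (\<alpha> $ i) * (z $ i) ^ (\<alpha> $ i - 1) * (\<Prod>l\<in>UNIV - {i}. (z $ l) ^ (\<alpha> $ l))"

lemma mult_dmonom: "z $ i * dmonom i \<alpha> z = of_nat (\<alpha> $ i) * zmonom \<alpha> z"
proof -
  have "zmonom \<alpha> z = (z $ i) ^ (\<alpha> $ i) * (\<Prod>l\<in>UNIV - {i}. (z $ l) ^ (\<alpha> $ l))"
    unfolding zmonom_def by (rule prod.remove) auto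
  then show ?thesis by (cases "\<alpha> $ i") (auto simp: dmonom_def)
qed

lemma zpartial_eq:
  assumes "finite A" "zsupp g \<subseteq> A"
  shows "zpartial g i z = (\<Sum>\<alpha>\<in>A. g \<alpha> * dmonom i \<alpha> z)"
proof -
  have m: "zmonom \<alpha> (\<chi> l. if l = i then s else z $ l) = s ^ (\<alpha> $ i) * (\<Prod>l\<in>UNIV - {i}. (z $ l) ^ (\<alpha> $ l))" for \<alpha> s
  proof -
    have "zmonom \<alpha> (\<chi> l. if l = i then s else z $ l) =
       s ^ (\<alpha> $ i) * (\<Prod>l\<in>UNIV - {i}. (if l = i then s else z $ l) ^ (\<alpha> $ l))"
      unfolding zmonom_def by (subst prod.remove[of _ i]) auto
    also have "(\<Prod>l\<in>UNIV - {i}. (if l = i then s else z $ l) ^ (\<alpha> $ l)) = (\<Prod>l\<in>UNIV - {i}. (z $ l) ^ (\<alpha> $ l))"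
      by (rule prod.cong) auto
    finally show ?thesis .
  qed
  show ?thesis
    unfolding zpartial_def zeval_superset[OF assms] m dmonom_def
    by (rule DERIV_imp_deriv) (auto intro!: derivative_eq_intros sum.cong)
qed

text \<open>z_i d/dz_i acts diagonally on monomials, so limits of quotients of monomials also give
  limits of derivatives.\<close>

lemma mult_zpartial:
  assumes "finite A" "zsupp g \<subseteq> A"
  shows "z $ i * zpartial g i z = (\<Sum>\<alpha>\<in>A. g \<alpha> * of_nat (\<alpha> $ i) * zmonom \<alpha> z)"
  unfolding zpartial_eq[OF assms] sum_distrib_left
  by (rule sum.cong) (auto simp: mult.left_commute mult_dmonom mult.assoc)

section \<open>Limits of monomials along sequences\<close>

text \<open>Sequential compactness of [b, infinity], one index at a time. Applied to logarithms it
  yields the convergence of monomial quotients in [0, infinity].\<close>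

lemma subseq_convergent_or_at_top:
  fixes f :: "'a \<Rightarrow> nat \<Rightarrow> real"
  assumes "finite V" and "\<And>v m. v \<in> V \<Longrightarrow> b v \<le> f v m"
  obtains r :: "nat \<Rightarrow> nat" where "strict_mono r"
    "\<And>v. v \<in> V \<Longrightarrow> convergent (f v \<circ> r) \<or> filterlim (f v \<circ> r) at_top sequentially"
proof -
  have "\<exists>r :: nat \<Rightarrow> nat. strict_mono r \<and>
    (\<forall>v\<in>V. convergent (f v \<circ> r) \<or> filterlim (f v \<circ> r) at_top sequentially)"
    using assms
  proof (induction V rule: finite_induct)
    case empty
    then show ?case by (auto intro: strict_mono_id[unfolded id_def])
  next
    case (insert v V)
    have "\<exists>r :: nat \<Rightarrow> nat. strict_mono r \<and>
        (\<forall>v\<in>V. convergent (f v \<circ> r) \<or> filterlim (f v \<circ> r) at_top sequentially)"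
      by (rule insert.IH) (use insert.prems in blast)
    then obtain r where r: "strict_mono (r :: nat \<Rightarrow> nat)"
      "\<And>v. v \<in> V \<Longrightarrow> convergent (f v \<circ> r) \<or> filterlim (f v \<circ> r) at_top sequentially" by blast
    obtain q :: "nat \<Rightarrow> nat" where q: "strict_mono q"
      "convergent (f v \<circ> r \<circ> q) \<or> filterlim (f v \<circ> r \<circ> q) at_top sequentially"
    proof (cases "\<exists>B. infinite {m. f v (r m) \<le> B}")
      case True
      then obtain B where "infinite {m. f v (r m) \<le> B}" by blast
      then obtain p where p: "strict_mono (p :: nat \<Rightarrow> nat)" "\<And>m. f v (r (p m)) \<le> B"
        using infinite_enumerate by blast
      have "\<forall>m. (f v \<circ> r \<circ> p) m \<in> {b v..B}" using insert.prems p by simp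
      then obtain l s where s: "strict_mono (s :: nat \<Rightarrow> nat)" "(f v \<circ> r \<circ> p \<circ> s) \<longlonglongrightarrow> l"
        using compact_imp_seq_compact[OF compact_Icc[of "b v" B], THEN seq_compactE] by metis
      show ?thesis
        by (rule that[of "p \<circ> s"]) (use p s in \<open>auto intro: strict_mono_o simp: o_assoc convergent_def\<close>)
    next
      case False
      have "filterlim (f v \<circ> r) at_top sequentially"
        unfolding filterlim_at_top
      proof
        fix Z
        have "finite {m. f v (r m) \<le> Z}" using False by blast
        then show "\<forall>\<^sub>F m in sequentially. Z \<le> (f v \<circ> r) m"
          by (auto simp: eventually_cofinite simp flip: cofinite_eq_sequentially
              elim!: finite_subset[rotated])
      qed
      then show ?thesis by (intro that[of "\<lambda>m. m"]) (auto simp: o_def strict_mono_def)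
    qed
    have "convergent (f v' \<circ> (r \<circ> q)) \<or> filterlim (f v' \<circ> (r \<circ> q)) at_top sequentially" if "v' \<in> V" for v'
    proof -
      have "filterlim q at_top sequentially" by (rule filterlim_subseq[OF q(1)])
      then show ?thesis
        using r(2)[OF that] convergent_subseq_convergent[OF _ q(1), of "f v' \<circ> r"]
          filterlim_compose[of "f v' \<circ> r" at_top sequentially q sequentially]
        by (auto simp: o_def)
    qed
    with q(2) have "\<forall>v'\<in>insert v V. convergent (f v' \<circ> (r \<circ> q)) \<or> filterlim (f v' \<circ> (r \<circ> q)) at_top sequentially"
      by (simp only: o_assoc insert_iff ball_simps) blast
    then show ?case using strict_mono_o[OF r(1) q(1)] by blast
  qed
  then show thesis using that by blast
qed

text \<open>
  Subtracting from the sequence the combination of a dual basis with coefficients b.x(m)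
  leaves a sequence orthogonal to E.
\<close>
lemma convergent_part:
  fixes x :: "nat \<Rightarrow> 'a::euclidean_space"
  assumes E: "finite E" "\<And>v. v \<in> E \<Longrightarrow> convergent (\<lambda>m. v \<bullet> x m)"
  obtains y \<xi> where "y \<longlonglongrightarrow> \<xi>" "\<And>v m. v \<in> E \<Longrightarrow> v \<bullet> y m = v \<bullet> x m"
proof -
  obtain B where B: "B \<subseteq> E" "independent B" "E \<subseteq> span B"
    using maximal_independent_subset[of E] by metis
  have finB: "finite B" using B(1) E(1) finite_subset by blast
  have "\<exists>d. \<forall>b'\<in>B. b' \<bullet> d = (if b' = b then 1 else 0)" for b
  proof -
    obtain h :: "'a \<Rightarrow> real" where h: "linear h" "\<forall>b'\<in>B. h b' = (if b' = b then 1 else 0)"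
      using linear_independent_extend[OF B(2), of "\<lambda>b'. if b' = b then 1 else 0"] by blast
    \<comment> \<open>\<open>adjoint h 1\<close> is the vector that represents the functional h
      through the inner product.\<close>
    then show ?thesis using adjoint_works[OF h(1), of _ 1] by (intro exI[of _ "adjoint h 1"]) simp
  qed
  then obtain d where d: "\<And>b b'. b' \<in> B \<Longrightarrow> b' \<bullet> d b = (if b' = b then 1 else 0)" by metis
  define y where "y m = (\<Sum>b\<in>B. (b \<bullet> x m) *\<^sub>R d b)" for m
  have "v \<bullet> y m = v \<bullet> x m" if "v \<in> B" for v m
  proof -
    have "v \<bullet> y m = (\<Sum>b\<in>B. (b \<bullet> x m) * (if v = b then 1 else 0))"
      using d[OF that] by (simp add: y_def inner_sum_right)
    also have "\<dots> = v \<bullet> x m" using that finB by (simp add: if_distrib sum.delta cong: if_cong)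
    finally show ?thesis .
  qed
  then have B0: "v \<bullet> (y m - x m) = 0" if "v \<in> B" for v m using that by (simp add: inner_diff_right)
  have "v \<bullet> (y m - x m) = 0" if "v \<in> span B" for v m
    using that
  proof (induction rule: span_induct)
    case base
    show ?case by (simp add: subspace_def inner_add_left)
  next
    case (step v)
    then show ?case by (rule B0)
  qed
  then have "v \<bullet> y m = v \<bullet> x m" if "v \<in> E" for v m
    using that B(3) by (auto simp: inner_diff_right)
  moreover have "y \<longlonglongrightarrow> (\<Sum>b\<in>B. lim (\<lambda>m. b \<bullet> x m) *\<^sub>R d b)"
    unfolding y_def using E(2) B(1) by (intro tendsto_intros) (auto simp: convergent_LIMSEQ_iff)
  ultimately show thesis using that by blast
qed

text \<open>
  Simultaneous Dirichlet approximation: for integral v with v.p = 0, the pairing of v with a good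
  integral approximation of a multiple of p is an integer of modulus less than 1.
\<close>
lemma integral_weight_exists:
  fixes p :: "real^'n" and E P :: "(real^'n) set"
  assumes fin: "finite E" "finite P" and int: "\<And>v i. v \<in> E \<union> P \<Longrightarrow> v $ i \<in> \<int>"
    and E: "\<And>v. v \<in> E \<Longrightarrow> v \<bullet> p = 0" and P: "\<And>v. v \<in> P \<Longrightarrow> v \<bullet> p \<ge> 1"
  obtains a :: "'n \<Rightarrow> int" where "\<And>v. v \<in> E \<Longrightarrow> v \<bullet> (\<chi> i. of_int (a i)) = 0"
    "\<And>v. v \<in> P \<Longrightarrow> v \<bullet> (\<chi> i. of_int (a i)) > 0"
proof -
  obtain h :: "nat \<Rightarrow> 'n" where h: "bij_betw h {0..<CARD('n)} UNIV"
    using ex_bij_betw_nat_finite[of "UNIV :: 'n set"] by auto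
  define l where "l v = (\<Sum>i\<in>UNIV. \<bar>v $ i\<bar>)" for v :: "real^'n"
  \<comment> \<open>N exceeds the l1-norm of every vector involved, so coordinate errors below 1 / N
    change each pairing by less than 1.\<close>
  define N where "N = nat \<lceil>(\<Sum>v\<in>E \<union> P. l v)\<rceil> + 1"
  have l0: "l v \<ge> 0" for v by (auto simp: l_def intro: sum_nonneg)
  have N: "l v < real N" if "v \<in> E \<union> P" for v
  proof -
    have "l v \<le> (\<Sum>v\<in>E \<union> P. l v)" by (rule member_le_sum) (use that fin l0 in auto)
    also have "\<dots> < real N" unfolding N_def by linarith
    finally show ?thesis .
  qed
  obtain q c where q: "0 < q" "\<And>i. i < CARD('n) \<Longrightarrow> \<bar>of_int q * p $ h i - of_int (c i)\<bar> < 1 / N"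
    using Dirichlet_approx_simult[of N "CARD('n)" "\<lambda>i. p $ h i"] N_def by (metis add_gr_0 zero_less_one)
  define a where "a i = c (inv_into {0..<CARD('n)} h i)" for i
  have a: "\<bar>of_int (a i) - of_int q * p $ i\<bar> < 1 / N" for i
  proof -
    have "i \<in> h ` {0..<CARD('n)}" using h by (simp add: bij_betw_def)
    then have "inv_into {0..<CARD('n)} h i \<in> {0..<CARD('n)}" "h (inv_into {0..<CARD('n)} h i) = i"
      by (rule inv_into_into, rule f_inv_into_f)
    moreover from this have "inv_into {0..<CARD('n)} h i < CARD('n)" by simp
    ultimately show ?thesis using q(2)[of "inv_into {0..<CARD('n)} h i"]
      by (simp add: a_def abs_minus_commute)
  qed
  have close: "\<bar>v \<bullet> (\<chi> i. of_int (a i)) - of_int q * (v \<bullet> p)\<bar> < 1" if v: "v \<in> E \<union> P" for v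
  proof -
    have "v \<bullet> (\<chi> i. of_int (a i)) - of_int q * (v \<bullet> p) = (\<Sum>i\<in>UNIV. v $ i * (of_int (a i) - of_int q * p $ i))"
      by (simp add: inner_vec_def algebra_simps sum_subtractf sum_distrib_left)
    also have "\<bar>\<dots>\<bar> \<le> (\<Sum>i\<in>UNIV. \<bar>v $ i\<bar> * (1 / N))"
      by (rule order_trans[OF sum_abs])
        (simp only: abs_mult, intro sum_mono mult_left_mono less_imp_le[OF a] abs_ge_zero)
    also have "\<dots> = l v / N" by (simp add: l_def sum_divide_distrib)
    also have "\<dots> < 1" using N[OF v] l0[of v] by (simp add: divide_less_eq)
    finally show ?thesis .
  qed
  show thesis
  proof (rule that)
    fix v assume v: "v \<in> E"
    have "v \<bullet> (\<chi> i. of_int (a i)) \<in> \<int>"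
      using int v by (auto simp: inner_vec_def intro!: Ints_sum Ints_mult)
    then show "v \<bullet> (\<chi> i. of_int (a i)) = 0"
      using close[of v] v E[OF v] by (auto elim!: Ints_cases)
  next
    fix v assume v: "v \<in> P"
    have "1 * 1 \<le> of_int q * (v \<bullet> p)" using P[OF v] q(1) by (intro mult_mono) auto
    then show "v \<bullet> (\<chi> i. of_int (a i)) > 0" using close[of v] v by auto
  qed
qed

text \<open>
  Logarithmic sizes of the coordinates. Vanishing coordinates get an artificial size, so small that
  monomials vanishing at z stay dominated by the others.
\<close>
definition absexp :: "complex^'n \<Rightarrow> nat \<Rightarrow> real^'n" where
  "absexp z c = (\<chi> i. if z $ i \<noteq> 0 then - ln (norm (z $ i))
     else real c * (1 + (\<Sum>j\<in>{j. z $ j \<noteq> 0}. \<bar>ln (norm (z $ j))\<bar>)))"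

text \<open>The value 1 at vanishing coordinates keeps all phases in the compact torus, so their
  limits have coordinates of modulus 1.\<close>

definition phase :: "complex^'n \<Rightarrow> complex^'n" where
  "phase z = (\<chi> i. if z $ i \<noteq> 0 then sgn (z $ i) else 1)"

lemma norm_phase [simp]: "norm (phase z $ i) = 1"
  by (simp add: phase_def norm_sgn)

lemma zmonom_eq_0_iff: "zmonom \<alpha> z = 0 \<longleftrightarrow> (\<exists>i. z $ i = 0 \<and> \<alpha> $ i > 0)"
  by (auto simp: zmonom_def prod_zero_iff)

lemma zmonom_norm1: "(\<And>i. norm (z $ i) = 1) \<Longrightarrow> norm (zmonom \<alpha> z) = 1"
  by (simp add: zmonom_def prod_norm[symmetric] norm_power)

lemma zmonom_polar: "zmonom \<alpha> (\<chi> i. \<omega> $ i * of_real (exp (- x $ i))) = zmonom \<alpha> \<omega> * of_real (exp (- (real_of_exp \<alpha> \<bullet> x)))"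
proof -
  have "zmonom \<alpha> (\<chi> i. \<omega> $ i * of_real (exp (- x $ i))) = (\<Prod>i\<in>UNIV. (\<omega> $ i) ^ (\<alpha> $ i) * of_real (exp (real (\<alpha> $ i) * (- x $ i))))"
    unfolding zmonom_def
  proof (rule prod.cong)
    fix i
    have "complex_of_real (exp (- x $ i)) ^ (\<alpha> $ i) = of_real (exp (real (\<alpha> $ i) * (- x $ i)))"
      unfolding exp_of_nat_mult by simp
    then show "(\<chi> i. \<omega> $ i * of_real (exp (- x $ i))) $ i ^ (\<alpha> $ i) = (\<omega> $ i) ^ (\<alpha> $ i) * of_real (exp (real (\<alpha> $ i) * (- x $ i)))"
      by (simp only: vec_lambda_beta power_mult_distrib)
  qed simp
  also have "\<dots> = zmonom \<alpha> \<omega> * of_real (\<Prod>i\<in>UNIV. exp (real (\<alpha> $ i) * (- x $ i)))"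
    by (simp only: prod.distrib zmonom_def of_real_prod)
  also have "(\<Prod>i\<in>UNIV. exp (real (\<alpha> $ i) * (- x $ i))) = exp (- (real_of_exp \<alpha> \<bullet> x))"
    by (simp add: exp_sum[symmetric] inner_vec_def real_of_exp_def sum_negf)
  finally show ?thesis .
qed

text \<open>A monomial that does not vanish at z has exponent 0 at every vanishing coordinate, so
  the artificial entries of \<open>absexp\<close> do not contribute.\<close>

lemma zmonom_absexp:
  assumes "zmonom \<alpha> z \<noteq> 0"
  shows "zmonom \<alpha> z = zmonom \<alpha> (phase z) * of_real (exp (- (real_of_exp \<alpha> \<bullet> absexp z c)))"
proof -
  have "zmonom \<alpha> z = zmonom \<alpha> (\<chi> i. phase z $ i * of_real (exp (- absexp z c $ i)))"
    unfolding zmonom_def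
  proof (rule prod.cong)
    fix i
    show "z $ i ^ (\<alpha> $ i) = (\<chi> i. phase z $ i * of_real (exp (- absexp z c $ i))) $ i ^ (\<alpha> $ i)"
    proof (cases "z $ i = 0")
      case True
      then have "\<alpha> $ i = 0" using assms by (auto simp: zmonom_eq_0_iff)
      then show ?thesis by simp
    next
      case False
      then show ?thesis by (simp add: phase_def absexp_def sgn_div_norm scaleR_conv_of_real field_simps)
    qed
  qed simp
  then show ?thesis by (simp only: zmonom_polar)
qed

text \<open>Some vanishing coordinate occurs in \<alpha> and none in \<beta>. It contributes at
  least c (1 + X), where X is the sum of the |ln |z_j||, while the nonvanishing coordinates lose at
  most s X, s being the total degree of \<alpha> and \<beta>. As c >= m + s, the gap is at least
  m.\<close>

lemma absexp_vanishing_monom: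
  assumes \<alpha>: "zmonom \<alpha> z = 0" and \<beta>: "zmonom \<beta> z \<noteq> 0" and c: "c \<ge> m + (\<Sum>i\<in>UNIV. \<alpha> $ i + \<beta> $ i)"
  shows "(real_of_exp \<alpha> - real_of_exp \<beta>) \<bullet> absexp z c \<ge> real m"
proof -
  let ?J = "{j. z $ j \<noteq> 0}"
  let ?s = "real (\<Sum>i\<in>UNIV. \<alpha> $ i + \<beta> $ i)"
  define X where "X = (\<Sum>j\<in>?J. \<bar>ln (norm (z $ j))\<bar>)"
  have X: "X \<ge> 0" by (simp add: X_def sum_nonneg)
  let ?v = "real_of_exp \<alpha> - real_of_exp \<beta>"
  obtain i where i: "z $ i = 0" "\<alpha> $ i > 0" using \<alpha> by (auto simp: zmonom_eq_0_iff)
  have \<beta>0: "\<beta> $ j = 0" if "z $ j = 0" for j using \<beta> that by (auto simp: zmonom_eq_0_iff)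
  have "?v \<bullet> absexp z c = (\<Sum>j\<in>?J. ?v $ j * absexp z c $ j) + (\<Sum>j\<in>- ?J. ?v $ j * absexp z c $ j)"
    unfolding inner_vec_def inner_real_def Compl_eq_Diff_UNIV
    by (subst sum.subset_diff[of ?J UNIV]) auto
  moreover have "(\<Sum>j\<in>?J. ?v $ j * absexp z c $ j) \<ge> (\<Sum>j\<in>?J. - (?s * \<bar>ln (norm (z $ j))\<bar>))"
  proof (rule sum_mono)
    fix j assume j: "j \<in> ?J"
    have "\<alpha> $ j + \<beta> $ j \<le> (\<Sum>i\<in>UNIV. \<alpha> $ i + \<beta> $ i)"
      by (rule member_le_sum[of j UNIV "\<lambda>i. \<alpha> $ i + \<beta> $ i"]) auto
    then have "real (\<alpha> $ j + \<beta> $ j) \<le> ?s" by (simp only: of_nat_le_iff)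
    moreover have "\<bar>?v $ j\<bar> \<le> real (\<alpha> $ j + \<beta> $ j)" by (simp add: real_of_exp_def)
    ultimately have "\<bar>?v $ j\<bar> \<le> ?s" by linarith
    then have "\<bar>?v $ j * absexp z c $ j\<bar> \<le> ?s * \<bar>absexp z c $ j\<bar>"
      unfolding abs_mult by (rule mult_right_mono) simp
    also have "\<bar>absexp z c $ j\<bar> = \<bar>ln (norm (z $ j))\<bar>" using j by (simp add: absexp_def)
    finally show "- (?s * \<bar>ln (norm (z $ j))\<bar>) \<le> ?v $ j * absexp z c $ j" by linarith
  qed
  then have "(\<Sum>j\<in>?J. ?v $ j * absexp z c $ j) \<ge> - (?s * X)"
    by (simp add: X_def sum_negf sum_distrib_left)
  moreover have "(\<Sum>j\<in>- ?J. ?v $ j * absexp z c $ j) \<ge> c * (1 + X)"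
  proof -
    have "c * (1 + X) \<le> real (\<alpha> $ i) * (c * (1 + X))"
      using i X mult_right_mono[of 1 "real (\<alpha> $ i)" "c * (1 + X)"] by simp
    also have "\<dots> = ?v $ i * absexp z c $ i" using i \<beta>0[of i] by (simp add: real_of_exp_def absexp_def X_def)
    also have "\<dots> \<le> (\<Sum>j\<in>- ?J. ?v $ j * absexp z c $ j)"
    proof (rule member_le_sum[of i "- ?J" "\<lambda>j. ?v $ j * absexp z c $ j"])
      show "0 \<le> ?v $ x * absexp z c $ x" if "x \<in> - ?J - {i}" for x
        using that \<beta>0[of x] X by (simp add: real_of_exp_def absexp_def flip: X_def)
    qed (use i in auto)
    finally show ?thesis .
  qed
  moreover have "real c * (1 + X) \<ge> (real m + ?s) * (1 + X)"
  proof (rule mult_right_mono)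
    have "real (m + (\<Sum>i\<in>UNIV. \<alpha> $ i + \<beta> $ i)) \<le> real c" using c by (simp only: of_nat_le_iff)
    then show "real m + ?s \<le> real c" by (simp only: of_nat_add)
  qed (use X in simp)
  moreover have "(real m + ?s) * (1 + X) \<ge> real m + ?s * X"
  proof -
    have "real m + t * X \<le> (real m + t) * (1 + X)" if "t \<ge> 0" for t
      using X that by (simp add: algebra_simps)
    from this[OF of_nat_0_le_iff] show ?thesis .
  qed
  ultimately show ?thesis by linarith
qed

text \<open>Pigeonhole on the finite set of choice functions on S.\<close>

lemma finite_choice_subseq:
  assumes "finite S" "\<And>k. k \<in> S \<Longrightarrow> finite (A k)" "\<And>k (m::nat). k \<in> S \<Longrightarrow> a k m \<in> A k"
  obtains r :: "nat \<Rightarrow> nat" and c where "strict_mono r" "\<And>k m. k \<in> S \<Longrightarrow> a k (r m) = c k"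
proof -
  let ?f = "\<lambda>m. restrict (\<lambda>k. a k m) S"
  have "range ?f \<subseteq> (\<Pi>\<^sub>E k\<in>S. A k)" using assms(3) by auto
  then have fr: "finite (range ?f)" by (rule finite_subset) (simp add: finite_PiE assms(1,2))
  obtain m0 where "infinite {m \<in> UNIV. ?f m = ?f m0}"
    using pigeonhole_infinite[OF infinite_UNIV_nat fr] by blast
  from infinite_enumerate[OF this]
  obtain r where r: "strict_mono (r :: nat \<Rightarrow> nat)" "\<And>m. ?f (r m) = ?f m0" by blast
  have "a k (r m) = a k m0" if "k \<in> S" for k m using fun_cong[OF r(2), of m k] that by simp
  with r(1) show thesis by (rule that[of r "\<lambda>k. a k m0"])
qed

lemma absexp_ge:
  assumes "norm z \<le> B" "B \<ge> 1"
  shows "absexp z c $ i \<ge> - ln B"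
proof (cases "z $ i = 0")
  case True
  have "- ln B \<le> 0" using assms by simp
  also have "0 \<le> absexp z c $ i" using True by (simp add: absexp_def sum_nonneg)
  finally show ?thesis .
next
  case False
  have "norm (z $ i) \<le> B" using Finite_Cartesian_Product.norm_nth_le[of z i] assms by linarith
  moreover have "0 < norm (z $ i)" using False by simp
  ultimately have "ln (norm (z $ i)) \<le> ln B" using assms(2) by (subst ln_le_cancel_iff) auto
  then show ?thesis using False by (simp add: absexp_def)
qed

text \<open>sig k m is a dominant monomial of A k at z (r m), up to a constant; w records which monomials dominate.\<close>
lemma toric_limit:
  fixes A :: "'k \<Rightarrow> (nat^'n) set" and z :: "nat \<Rightarrow> complex^'n"
  assumes S: "finite S" and A: "\<And>k. k \<in> S \<Longrightarrow> finite (A k)"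
    and nz: "\<And>k m. k \<in> S \<Longrightarrow> \<exists>\<alpha>\<in>A k. zmonom \<alpha> (z m) \<noteq> 0"
    and lim: "z \<longlonglongrightarrow> z0"
  obtains r :: "nat \<Rightarrow> nat" and w :: "nat^'n" and u :: "complex^'n" and sig :: "'k \<Rightarrow> nat \<Rightarrow> complex" and d :: "'k \<Rightarrow> nat"
  where "strict_mono r" "\<And>i. w $ i = 0 \<longleftrightarrow> z0 $ i \<noteq> 0" "u \<in> torus" "\<And>i. z0 $ i \<noteq> 0 \<Longrightarrow> u $ i = z0 $ i"
    "\<And>k m. k \<in> S \<Longrightarrow> sig k m \<noteq> 0" "\<And>k. k \<in> S \<Longrightarrow> \<exists>\<alpha>\<in>A k. wt w \<alpha> = d k"
    "\<And>k \<alpha>. k \<in> S \<Longrightarrow> \<alpha> \<in> A k \<Longrightarrow> d k \<le> wt w \<alpha>"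
    "\<And>k \<alpha>. k \<in> S \<Longrightarrow> \<alpha> \<in> A k \<Longrightarrow>
       (\<lambda>m. zmonom \<alpha> (z (r m)) / sig k m) \<longlonglongrightarrow> (if wt w \<alpha> = d k then zmonom \<alpha> u else 0)"
proof -
  define C where "C = 2 * (\<Sum>k\<in>S. \<Sum>\<alpha>\<in>A k. \<Sum>i\<in>UNIV. \<alpha> $ i)"
  \<comment> \<open>C covers the total degree of any two exponents, and m + 1 pushes monomials that
    vanish at \<open>z m\<close> ever further below the nonvanishing ones, so that they become
    negligible in the limit.\<close>
  define x where "x m = absexp (z m) (m + 1 + C)" for m
  have Cge: "(\<Sum>i\<in>UNIV. \<alpha> $ i + \<beta> $ i) \<le> C" if "k \<in> S" "\<alpha> \<in> A k" "\<beta> \<in> A k" for k \<alpha> \<beta>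
  proof -
    have "(\<Sum>i\<in>UNIV. \<gamma> $ i) \<le> (\<Sum>k\<in>S. \<Sum>\<alpha>\<in>A k. \<Sum>i\<in>UNIV. \<alpha> $ i)" if "\<gamma> \<in> A k" for \<gamma>
      using member_le_sum[OF that, of "\<lambda>\<gamma>. \<Sum>i\<in>UNIV. \<gamma> $ i"] A[OF \<open>k \<in> S\<close>]
        member_le_sum[OF \<open>k \<in> S\<close>, of "\<lambda>k. \<Sum>\<alpha>\<in>A k. \<Sum>i\<in>UNIV. \<alpha> $ i"] S by simp
    from this[OF that(2)] this[OF that(3)] show ?thesis by (simp add: C_def sum.distrib)
  qed
  have van: "(real_of_exp \<alpha> - real_of_exp \<beta>) \<bullet> x m \<ge> real (m + 1)"
    if "k \<in> S" "\<alpha> \<in> A k" "\<beta> \<in> A k" "zmonom \<alpha> (z m) = 0" "zmonom \<beta> (z m) \<noteq> 0" for k \<alpha> \<beta> m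
    unfolding x_def by (rule absexp_vanishing_monom[OF that(4,5)]) (use Cge[OF that(1-3)] in simp)
  have "\<exists>\<alpha>. \<alpha> \<in> A k \<and> (\<forall>\<beta>\<in>A k. real_of_exp \<alpha> \<bullet> x m \<le> real_of_exp \<beta> \<bullet> x m)" if "k \<in> S" for k m
  proof -
    have "A k \<noteq> {}" using nz[OF that, of 0] by blast
    then have "Min ((\<lambda>\<alpha>. real_of_exp \<alpha> \<bullet> x m) ` A k) \<in> (\<lambda>\<alpha>. real_of_exp \<alpha> \<bullet> x m) ` A k"
      using A[OF that] by (intro Min_in) auto
    then obtain \<alpha> where "\<alpha> \<in> A k" "real_of_exp \<alpha> \<bullet> x m = Min ((\<lambda>\<alpha>. real_of_exp \<alpha> \<bullet> x m) ` A k)" by auto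
    then show ?thesis using A[OF that] by (intro exI[of _ \<alpha>]) simp
  qed
  then obtain a where a: "\<And>k m. k \<in> S \<Longrightarrow> a k m \<in> A k"
    "\<And>k m \<beta>. k \<in> S \<Longrightarrow> \<beta> \<in> A k \<Longrightarrow> real_of_exp (a k m) \<bullet> x m \<le> real_of_exp \<beta> \<bullet> x m" by metis
  obtain r1 :: "nat \<Rightarrow> nat" and c where r1: "strict_mono r1" "\<And>k m. k \<in> S \<Longrightarrow> a k (r1 m) = c k"
    using finite_choice_subseq[of S A a] S A a(1) by blast
  have c: "c k \<in> A k" if "k \<in> S" for k using a(1)[OF that, of "r1 0"] r1(2)[OF that] by simp
  have cmin: "(real_of_exp \<beta> - real_of_exp (c k)) \<bullet> x (r1 m) \<ge> 0" if "k \<in> S" "\<beta> \<in> A k" for k \<beta> m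
    using a(2)[OF that, of "r1 m"] r1(2)[OF that(1)] by (simp add: inner_diff_left)
  have cnz: "zmonom (c k) (z (r1 m)) \<noteq> 0" if k: "k \<in> S" for k m
  proof
    assume 0: "zmonom (c k) (z (r1 m)) = 0"
    obtain \<beta> where \<beta>: "\<beta> \<in> A k" "zmonom \<beta> (z (r1 m)) \<noteq> 0" using nz[OF k] by blast
    from van[OF k c[OF k] \<beta>(1) 0 \<beta>(2)] cmin[OF k \<beta>(1), of m] show False by (simp add: inner_diff_left)
  qed
  \<comment> \<open>Differences to the dominant exponents measure monomial quotients. The coordinate
    vectors are added to make the weight nonnegative and to detect which coordinates tend to
    0.\<close>
  define V where "V = (\<Union>k\<in>S. (\<lambda>\<beta>. real_of_exp \<beta> - real_of_exp (c k)) ` A k) \<union> range (\<lambda>i. axis i 1)"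
  have finV: "finite V" unfolding V_def using S A by auto
  obtain B where B: "\<And>m. norm (z m) \<le> B" "B \<ge> 1"
  proof -
    have "Bseq z" using lim by (simp add: convergentI convergent_imp_Bseq)
    then obtain B where "\<And>m. norm (z m) \<le> B" by (auto simp: Bseq_def)
    then show thesis by (intro that[of "max B 1"]) (auto intro: max.coboundedI1)
  qed
  have Vge: "min 0 (- ln B) \<le> v \<bullet> x (r1 m)" if "v \<in> V" for v m
    using that cmin absexp_ge[OF B(1) B(2)] unfolding V_def x_def
    by (auto simp: inner_axis' intro: min.coboundedI1 min.coboundedI2)
  obtain r2 where r2: "strict_mono (r2 :: nat \<Rightarrow> nat)"
    "\<And>v. v \<in> V \<Longrightarrow> convergent ((\<lambda>m. v \<bullet> x (r1 m)) \<circ> r2) \<or> filterlim ((\<lambda>m. v \<bullet> x (r1 m)) \<circ> r2) at_top sequentially"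
    using subseq_convergent_or_at_top[OF finV, of "\<lambda>v. min 0 (- ln B)" "\<lambda>v m. v \<bullet> x (r1 m)"] Vge by metis
  have "bounded (range (\<lambda>m. phase (z (r1 (r2 m)))))"
    unfolding bounded_iff
  proof (intro exI ballI)
    fix y assume "y \<in> range (\<lambda>m. phase (z (r1 (r2 m))))"
    then have "(\<Sum>i\<in>UNIV. norm (y $ i)) \<le> CARD('n)" by auto
    then show "norm y \<le> CARD('n)" using L2_set_le_sum[of UNIV "\<lambda>i. norm (y $ i)"] by (simp add: norm_vec_def)
  qed
  then obtain \<omega> r3 where r3: "strict_mono (r3 :: nat \<Rightarrow> nat)" "((\<lambda>m. phase (z (r1 (r2 m)))) \<circ> r3) \<longlonglongrightarrow> \<omega>"
    using bounded_imp_convergent_subsequence by blast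
  define r where "r = r1 \<circ> r2 \<circ> r3"
  have r: "strict_mono r" unfolding r_def by (intro strict_mono_o r1 r2 r3)
  have phase: "(\<lambda>m. phase (z (r m))) \<longlonglongrightarrow> \<omega>" using r3(2) by (simp add: r_def o_def)
  have zr: "(\<lambda>m. z (r m)) \<longlonglongrightarrow> z0" using LIMSEQ_subseq_LIMSEQ[OF lim r] by (simp add: o_def)
  have cmin': "(real_of_exp \<beta> - real_of_exp (c k)) \<bullet> x (r m) \<ge> 0" if "k \<in> S" "\<beta> \<in> A k" for k \<beta> m
    using cmin[OF that] by (simp add: r_def)
  have cnz': "zmonom (c k) (z (r m)) \<noteq> 0" if "k \<in> S" for k m
    using cnz[OF that] by (simp add: r_def)
  \<comment> \<open>Differences in E belong to monomials comparable with the dominant one,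
    differences in P to negligible monomials.\<close>
  define E where "E = {v \<in> V. convergent (\<lambda>m. v \<bullet> x (r m))}"
  define P where "P = {v \<in> V. filterlim (\<lambda>m. v \<bullet> x (r m)) at_top sequentially}"
  have EP: "V \<subseteq> E \<union> P"
  proof
    fix v assume v: "v \<in> V"
    from r2(2)[OF v] show "v \<in> E \<union> P"
      using convergent_subseq_convergent[OF _ r3(1), of "(\<lambda>m. v \<bullet> x (r1 m)) \<circ> r2"]
        filterlim_compose[of "(\<lambda>m. v \<bullet> x (r1 m)) \<circ> r2" at_top sequentially r3 sequentially]
        filterlim_subseq[OF r3(1)] v
      by (auto simp: E_def P_def r_def o_def)
  qed
  have fin: "finite E" "finite P" unfolding E_def P_def using finV by auto
  obtain y \<xi> where y: "y \<longlonglongrightarrow> \<xi>" "\<And>v m. v \<in> E \<Longrightarrow> v \<bullet> y m = v \<bullet> x (r m)"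
    using convergent_part[OF fin(1), of "\<lambda>m. x (r m)"] by (auto simp: E_def)
  have Elim: "(\<lambda>m. v \<bullet> x (r m)) \<longlonglongrightarrow> v \<bullet> \<xi>" if "v \<in> E" for v
    using tendsto_inner[OF tendsto_const y(1), of v] by (simp add: y(2)[OF that])
  have "\<forall>\<^sub>F m in sequentially. \<forall>v\<in>P. v \<bullet> (x (r m) - y m) \<ge> 1"
    unfolding eventually_ball_finite_distrib[OF fin(2)]
  proof
    fix v assume "v \<in> P"
    then have "filterlim (\<lambda>m. - (v \<bullet> y m) + v \<bullet> x (r m)) at_top sequentially"
      using y(1) by (intro filterlim_tendsto_add_at_top[OF tendsto_minus[OF tendsto_inner[OF tendsto_const]]]) (auto simp: P_def)
    then show "\<forall>\<^sub>F m in sequentially. v \<bullet> (x (r m) - y m) \<ge> 1"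
      by (simp add: filterlim_at_top inner_diff_right)
  qed
  \<comment> \<open>A single late term, freed of its convergent part, serves as a real weight: it is
    orthogonal to E and at least 1 on P.\<close>
  then obtain m0 where m0: "\<And>v. v \<in> P \<Longrightarrow> v \<bullet> (x (r m0) - y m0) \<ge> 1"
    by (auto simp: eventually_sequentially)
  have int: "v $ i \<in> \<int>" if "v \<in> E \<union> P" for v i
    using that by (auto simp: E_def P_def V_def real_of_exp_def axis_def)
  obtain a where a: "\<And>v. v \<in> E \<Longrightarrow> v \<bullet> (\<chi> i. of_int (a i)) = 0" "\<And>v. v \<in> P \<Longrightarrow> v \<bullet> (\<chi> i. of_int (a i)) > 0"
  proof (rule integral_weight_exists[OF fin int, of "x (r m0) - y m0"])
    show "v \<bullet> (x (r m0) - y m0) = 0" if "v \<in> E" for v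
      using y(2)[OF that, of m0] by (simp add: inner_diff_right)
  qed (use m0 in auto)
  have axV: "axis i 1 \<in> V" for i by (simp add: V_def)
  have a0: "a i \<ge> 0" "a i = 0 \<Longrightarrow> axis i 1 \<in> E" "axis i 1 \<in> E \<Longrightarrow> a i = 0" for i
    using axV[of i] EP a(1)[of "axis i 1"] a(2)[of "axis i 1"] by (auto simp: inner_axis')
  \<comment> \<open>The logarithmic size of a coordinate converges exactly when its limit in z0 is
    not 0. With \<open>a0\<close> this makes the zero weights the nonvanishing coordinates of
    z0.\<close>
  have axE: "axis i 1 \<in> E \<longleftrightarrow> z0 $ i \<noteq> 0" and \<xi>: "z0 $ i \<noteq> 0 \<Longrightarrow> \<xi> $ i = - ln (norm (z0 $ i))" for i
  proof -
    have zi: "(\<lambda>m. z (r m) $ i) \<longlonglongrightarrow> z0 $ i" by (rule tendsto_vec_nth[OF zr])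
    have 1: "axis i 1 \<notin> E" if "z0 $ i = 0"
    proof
      assume e: "axis i 1 \<in> E"
      have "(\<lambda>m. x (r m) $ i) \<longlonglongrightarrow> axis i 1 \<bullet> \<xi>" using Elim[OF e] by (simp add: inner_axis')
      then have "\<forall>\<^sub>F m in sequentially. x (r m) $ i < axis i 1 \<bullet> \<xi> + 1" by (rule order_tendstoD) simp
      moreover have "\<forall>\<^sub>F m in sequentially. norm (z (r m) $ i) < exp (- (axis i 1 \<bullet> \<xi> + 1))"
        using tendsto_norm[OF zi] that by (intro order_tendstoD(2)) auto
      moreover have "\<forall>\<^sub>F m in sequentially. real m \<ge> axis i 1 \<bullet> \<xi> + 1"
        using filterlim_real_sequentially by (simp add: filterlim_at_top)
      ultimately have "\<forall>\<^sub>F m :: nat in sequentially. False"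
      proof eventually_elim
        case (elim m)
        show ?case
        proof (cases "z (r m) $ i = 0")
          case True
          define X where "X = (\<Sum>j\<in>{j. z (r m) $ j \<noteq> 0}. \<bar>ln (norm (z (r m) $ j))\<bar>)"
          have "X \<ge> 0" by (simp add: X_def sum_nonneg)
          have "real m * 1 \<le> real (r m + 1 + C) * (1 + X)"
            using seq_suble[OF r, of m] \<open>X \<ge> 0\<close> by (intro mult_mono) auto
          also have "\<dots> = x (r m) $ i" using True by (simp add: x_def absexp_def X_def)
          finally show ?thesis using elim by linarith
        next
          case False
          then have "ln (norm (z (r m) $ i)) < - (axis i 1 \<bullet> \<xi> + 1)"
            using elim(2) by (metis ln_exp ln_less_cancel_iff exp_gt_zero zero_less_norm_iff)
          then show ?thesis using elim(1) False by (simp add: x_def absexp_def)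
        qed
      qed
      then show False by simp
    qed
    have 2: "axis i 1 \<in> E \<and> \<xi> $ i = - ln (norm (z0 $ i))" if "z0 $ i \<noteq> 0"
    proof -
      have "\<forall>\<^sub>F m in sequentially. z (r m) $ i \<noteq> 0" using tendsto_imp_eventually_ne[OF zi that] .
      then have "\<forall>\<^sub>F m in sequentially. - ln (norm (z (r m) $ i)) = x (r m) $ i"
        by eventually_elim (simp add: x_def absexp_def)
      moreover have "(\<lambda>m. - ln (norm (z (r m) $ i))) \<longlonglongrightarrow> - ln (norm (z0 $ i))"
        using that by (intro tendsto_intros zi) auto
      ultimately have l: "(\<lambda>m. x (r m) $ i) \<longlonglongrightarrow> - ln (norm (z0 $ i))" by (rule Lim_transform_eventually[rotated])
      then have e: "axis i 1 \<in> E" using axV by (auto simp: E_def inner_axis' convergent_def)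
      have "(\<lambda>m. x (r m) $ i) \<longlonglongrightarrow> \<xi> $ i" using Elim[OF e] by (simp add: inner_axis')
      with l have "\<xi> $ i = - ln (norm (z0 $ i))" using LIMSEQ_unique by blast
      with e show ?thesis by blast
    qed
    show "axis i 1 \<in> E \<longleftrightarrow> z0 $ i \<noteq> 0" "z0 $ i \<noteq> 0 \<Longrightarrow> \<xi> $ i = - ln (norm (z0 $ i))"
      using 1 2 by blast+
  qed
  define w :: "nat^'n" where "w = (\<chi> i. nat (a i))"
  have wv: "(real_of_exp \<beta> - real_of_exp \<alpha>) \<bullet> (\<chi> i. of_int (a i)) = real (wt w \<beta>) - real (wt w \<alpha>)" for \<alpha> \<beta>
    using a0(1) by (simp add: wt_def w_def inner_vec_def real_of_exp_def algebra_simps sum_subtractf)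
  \<comment> \<open>Limiting phases, with sizes from the limit of the convergent part. At the
    nonvanishing coordinates of z0 this is z0; elsewhere it is a nonzero replacement for a
    coordinate tending to 0.\<close>
  define u where "u = (\<chi> i. \<omega> $ i * of_real (exp (- \<xi> $ i)))"
  have \<omega>1: "norm (\<omega> $ i) = 1" for i
  proof -
    have "(\<lambda>m. norm (phase (z (r m)) $ i)) \<longlonglongrightarrow> norm (\<omega> $ i)" by (intro tendsto_norm tendsto_vec_nth phase)
    then show ?thesis by (simp add: LIMSEQ_const_iff)
  qed
  have u0: "u $ i \<noteq> 0" for i using \<omega>1[of i] by (auto simp: u_def)
  have mu0: "zmonom \<alpha> u \<noteq> 0" for \<alpha> using u0 by (simp add: zmonom_eq_0_iff)
  have umon: "zmonom \<alpha> u = zmonom \<alpha> \<omega> * of_real (exp (- (real_of_exp \<alpha> \<bullet> \<xi>)))" for \<alpha>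
    unfolding u_def by (rule zmonom_polar)
  \<comment> \<open>The division by the dominant monomial at u makes every comparable monomial
    converge to its value at u, and not to a multiple of it.\<close>
  define sig where "sig k m = zmonom (c k) (z (r m)) / zmonom (c k) u" for k m
  have ratio: "zmonom \<beta> (z (r m)) / sig k m = zmonom \<beta> (phase (z (r m))) / zmonom (c k) (phase (z (r m)))
      * of_real (exp (- ((real_of_exp \<beta> - real_of_exp (c k)) \<bullet> x (r m)))) * zmonom (c k) u"
    if "k \<in> S" "zmonom \<beta> (z (r m)) \<noteq> 0" for k \<beta> m
  proof -
    let ?e = "\<lambda>\<gamma>. complex_of_real (exp (- (real_of_exp \<gamma> \<bullet> x (r m))))"
    have "complex_of_real (exp (- ((real_of_exp \<beta> - real_of_exp (c k)) \<bullet> x (r m)))) = ?e \<beta> / ?e (c k)"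
      by (simp add: inner_diff_left flip: exp_diff of_real_divide)
    moreover have "zmonom \<beta> (z (r m)) = zmonom \<beta> (phase (z (r m))) * ?e \<beta>"
      "zmonom (c k) (z (r m)) = zmonom (c k) (phase (z (r m))) * ?e (c k)"
      unfolding x_def by (rule zmonom_absexp, fact, rule zmonom_absexp, rule cnz', fact)
    ultimately show ?thesis unfolding sig_def by simp
  qed
  show thesis
  proof (rule that[of r w u sig "\<lambda>k. wt w (c k)"])
    show "strict_mono r" by (rule r)
    show "w $ i = 0 \<longleftrightarrow> z0 $ i \<noteq> 0" for i using a0[of i] axE[of i] by (auto simp: w_def)
    show "u \<in> torus" using u0 by (simp add: torus_def)
    show "u $ i = z0 $ i" if "z0 $ i \<noteq> 0" for i
    proof -
      have zi: "(\<lambda>m. z (r m) $ i) \<longlonglongrightarrow> z0 $ i" by (rule tendsto_vec_nth[OF zr])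
      have "\<forall>\<^sub>F m in sequentially. z (r m) $ i \<noteq> 0" using tendsto_imp_eventually_ne[OF zi that] .
      then have "\<forall>\<^sub>F m in sequentially. sgn (z (r m) $ i) = phase (z (r m)) $ i"
        by eventually_elim (simp add: phase_def)
      moreover have "(\<lambda>m. sgn (z (r m) $ i)) \<longlonglongrightarrow> sgn (z0 $ i)" using that by (intro tendsto_sgn zi) auto
      ultimately have "(\<lambda>m. phase (z (r m)) $ i) \<longlonglongrightarrow> sgn (z0 $ i)" by (rule Lim_transform_eventually[rotated])
      moreover have "(\<lambda>m. phase (z (r m)) $ i) \<longlonglongrightarrow> \<omega> $ i" by (rule tendsto_vec_nth[OF phase])
      ultimately have "\<omega> $ i = sgn (z0 $ i)" using LIMSEQ_unique by blast
      then show ?thesis using \<xi>[OF that] that by (simp add: u_def sgn_div_norm scaleR_conv_of_real field_simps)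
    qed
    show "sig k m \<noteq> 0" if "k \<in> S" for k m using cnz'[OF that] mu0 by (simp add: sig_def)
    show "\<exists>\<alpha>\<in>A k. wt w \<alpha> = wt w (c k)" if "k \<in> S" for k using c[OF that] by blast
    fix k \<alpha> assume k: "k \<in> S" and \<alpha>: "\<alpha> \<in> A k"
    let ?v = "real_of_exp \<alpha> - real_of_exp (c k)"
    have vV: "?v \<in> V" using k \<alpha> by (auto simp: V_def)
    then have vEP: "?v \<in> E \<or> ?v \<in> P" using EP by blast
    show "wt w (c k) \<le> wt w \<alpha>" using vEP a(1)[of ?v] a(2)[of ?v] unfolding wv by auto
    show "(\<lambda>m. zmonom \<alpha> (z (r m)) / sig k m) \<longlonglongrightarrow> (if wt w \<alpha> = wt w (c k) then zmonom \<alpha> u else 0)"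
      using vEP
    proof
      assume v: "?v \<in> E"
      have "\<forall>\<^sub>F m in sequentially. ?v \<bullet> x (r m) < ?v \<bullet> \<xi> + 1" using Elim[OF v] by (rule order_tendstoD) simp
      moreover have "\<forall>\<^sub>F m in sequentially. real m \<ge> ?v \<bullet> \<xi> + 1"
        using filterlim_real_sequentially by (simp add: filterlim_at_top)
      ultimately have "\<forall>\<^sub>F m in sequentially. zmonom \<alpha> (phase (z (r m))) / zmonom (c k) (phase (z (r m)))
        * of_real (exp (- (?v \<bullet> x (r m)))) * zmonom (c k) u = zmonom \<alpha> (z (r m)) / sig k m"
      proof eventually_elim
        case (elim m)
        \<comment> \<open>If this monomial vanished, its pairing would be at least r m + 1, against
          convergence.\<close>
        have "zmonom \<alpha> (z (r m)) \<noteq> 0"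
        proof
          assume "zmonom \<alpha> (z (r m)) = 0"
          from van[OF k \<alpha> c[OF k] this cnz'[OF k]] seq_suble[OF r, of m] elim show False by auto
        qed
        from ratio[OF k this] show ?case by simp
      qed
      moreover have "(\<lambda>m. zmonom \<alpha> (phase (z (r m))) / zmonom (c k) (phase (z (r m)))
        * of_real (exp (- (?v \<bullet> x (r m)))) * zmonom (c k) u) \<longlonglongrightarrow>
         zmonom \<alpha> \<omega> / zmonom (c k) \<omega> * of_real (exp (- (?v \<bullet> \<xi>))) * zmonom (c k) u"
      proof (intro tendsto_mult tendsto_divide tendsto_of_real tendsto_exp tendsto_minus tendsto_const Elim[OF v])
        have pl: "(\<lambda>m. zmonom \<beta> (phase (z (r m)))) \<longlonglongrightarrow> zmonom \<beta> \<omega>" for \<beta>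
          unfolding zmonom_def by (intro tendsto_intros tendsto_vec_nth phase)
        show "(\<lambda>m. zmonom \<alpha> (phase (z (r m)))) \<longlonglongrightarrow> zmonom \<alpha> \<omega>"
          "(\<lambda>m. zmonom (c k) (phase (z (r m)))) \<longlonglongrightarrow> zmonom (c k) \<omega>" by (rule pl)+
        show "zmonom (c k) \<omega> \<noteq> 0" using zmonom_norm1[OF \<omega>1, of "c k"] by auto
      qed
      moreover have "zmonom \<alpha> \<omega> / zmonom (c k) \<omega> * of_real (exp (- (?v \<bullet> \<xi>))) * zmonom (c k) u = zmonom \<alpha> u"
        using zmonom_norm1[OF \<omega>1, of "c k"] unfolding umon
        by (auto simp: inner_diff_left exp_diff exp_minus divide_simps)
      moreover have "wt w \<alpha> = wt w (c k)" using a(1)[OF v] unfolding wv by simp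
      ultimately show ?thesis by (simp add: Lim_transform_eventually)
    next
      assume v: "?v \<in> P"
      have "wt w \<alpha> \<noteq> wt w (c k)" using a(2)[OF v] unfolding wv by simp
      moreover have "(\<lambda>m. zmonom \<alpha> (z (r m)) / sig k m) \<longlonglongrightarrow> 0"
      proof (rule Lim_null_comparison)
        show "\<forall>\<^sub>F m in sequentially. norm (zmonom \<alpha> (z (r m)) / sig k m) \<le> exp (- (?v \<bullet> x (r m))) * norm (zmonom (c k) u)"
        proof (rule always_eventually, rule allI)
          fix m
          show "norm (zmonom \<alpha> (z (r m)) / sig k m) \<le> exp (- (?v \<bullet> x (r m))) * norm (zmonom (c k) u)"
          proof (cases "zmonom \<alpha> (z (r m)) = 0")
            case False
            show ?thesis unfolding ratio[OF k False] by (simp add: norm_mult norm_divide zmonom_norm1)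
          qed simp
        qed
        have "((\<lambda>y. exp (- y)) \<longlongrightarrow> (0::real)) at_top"
          using filterlim_compose[OF exp_at_bot filterlim_uminus_at_bot_at_top] .
        from filterlim_compose[OF this] v
        have "(\<lambda>m. exp (- (?v \<bullet> x (r m)))) \<longlonglongrightarrow> 0" by (auto simp: P_def)
        from tendsto_mult_left_zero[OF this]
        show "(\<lambda>m. exp (- (?v \<bullet> x (r m))) * norm (zmonom (c k) u)) \<longlonglongrightarrow> 0" .
      qed
      ultimately show ?thesis by simp
    qed
  qed
qed

section \<open>Transversality of the fibres to small spheres\<close>

lemma finite_bounded_subseq:
  fixes a :: "'k \<Rightarrow> nat \<Rightarrow> complex"
  assumes "finite K" "\<And>k m. k \<in> K \<Longrightarrow> norm (a k m) \<le> 1"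
  obtains r :: "nat \<Rightarrow> nat" and l where "strict_mono r" "\<And>k. k \<in> K \<Longrightarrow> (\<lambda>m. a k (r m)) \<longlonglongrightarrow> l k"
proof -
  have "\<exists>r :: nat \<Rightarrow> nat. strict_mono r \<and> (\<forall>k\<in>K. convergent (\<lambda>m. a k (r m)))"
    using assms
  proof (induction K rule: finite_induct)
    case empty
    show ?case by (auto intro!: exI[of _ "\<lambda>m. m"] simp: strict_mono_def)
  next
    case (insert k K)
    have "\<exists>r :: nat \<Rightarrow> nat. strict_mono r \<and> (\<forall>k\<in>K. convergent (\<lambda>m. a k (r m)))"
      by (rule insert.IH) (use insert.prems in blast)
    then obtain r where r: "strict_mono (r :: nat \<Rightarrow> nat)" "\<And>k. k \<in> K \<Longrightarrow> convergent (\<lambda>m. a k (r m))" by blast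
    have "bounded (range (\<lambda>m. a k (r m)))" using insert.prems by (auto simp: bounded_iff)
    then obtain l q where q: "strict_mono (q :: nat \<Rightarrow> nat)" "((\<lambda>m. a k (r m)) \<circ> q) \<longlonglongrightarrow> l"
      using bounded_imp_convergent_subsequence by blast
    have "convergent (\<lambda>m. a k' (r (q m)))" if "k' \<in> insert k K" for k'
    proof (cases "k' = k")
      case True
      then show ?thesis using q(2) by (auto simp: convergent_def o_def)
    next
      case False
      then show ?thesis using convergent_subseq_convergent[OF r(2) q(1), of k'] that by (simp add: o_def)
    qed
    then show ?case using strict_mono_o[OF r(1) q(1)] by (intro exI[of _ "\<lambda>m. r (q m)"]) (simp add: o_def)
  qed
  then obtain r where "strict_mono (r :: nat \<Rightarrow> nat)" "\<And>k. k \<in> K \<Longrightarrow> (\<lambda>m. a k (r m)) \<longlonglongrightarrow> lim (\<lambda>m. a k (r m))"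
    by (auto simp: convergent_LIMSEQ_iff)
  then show thesis by (rule that)
qed

text \<open>\<open>supps k\<close> gathers the exponents present for some small parameter.
  Coefficients may vanish at particular parameters, the limit parameter included; a common finite
  set makes sums for different t comparable.\<close>

locale newton_family =
  fixes k0 :: nat and F :: "nat \<Rightarrow> nat \<Rightarrow> nat^'n \<Rightarrow> complex" and R \<rho> :: real
    and G :: "nat \<Rightarrow> complex \<Rightarrow> nat^'n \<Rightarrow> complex" and supps :: "nat \<Rightarrow> (nat^'n) set"
  defines "G \<equiv> \<lambda>k t. tslice (F k) t"
    and "supps \<equiv> \<lambda>k. {\<alpha>. \<exists>t. norm t < \<rho> \<and> G k t \<alpha> \<noteq> 0}"
  assumes poly: "\<And>k. k \<in> {1..k0} \<Longrightarrow> is_tzpoly (F k)"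
    and R: "R > 0" and \<rho>: "\<rho> > 0"
    and boundary: "\<And>t k. norm t < \<rho> \<Longrightarrow> k \<in> {1..k0} \<Longrightarrow> newton_boundary (G k t) = newton_boundary (G k 0)"
    and nondegenerate: "\<And>t S. norm t < \<rho> \<Longrightarrow> S \<noteq> {} \<Longrightarrow> S \<subseteq> {1..k0} \<Longrightarrow> nondegenerate_ci S (\<lambda>k. G k t)"
    and tame: "\<And>t S. norm t < \<rho> \<Longrightarrow> S \<noteq> {} \<Longrightarrow> S \<subseteq> {1..k0} \<Longrightarrow> \<exists>R'>R. tameness_radius R' S (\<lambda>k. G k t)"
begin

text \<open>The numerator of the logarithmic derivative. Unlike the plain derivative it has no
  exponents beyond those of f^k.\<close>

definition logd :: "nat \<Rightarrow> complex \<Rightarrow> complex^'n \<Rightarrow> 'n \<Rightarrow> complex" where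
  "logd k t z i = z $ i * zpartial (G k t) i z"

lemma finite_supps: "k \<in> {1..k0} \<Longrightarrow> finite (supps k)"
  by (rule finite_subset[OF _ finite_zsupports[OF poly]])
    (use zsupp_tslice_subset in \<open>auto simp: supps_def G_def zsupp_def\<close>)

lemma zsupp_subset: "norm t < \<rho> \<Longrightarrow> zsupp (G k t) \<subseteq> supps k"
  by (auto simp: supps_def zsupp_def)

text \<open>A minimal exponent of the union occurs for some parameter t1 and is minimal there, so it
  gives d at t1. The constant Newton boundary carries d over to t, even if that coefficient vanishes
  at t.\<close>

lemma newton_d_supps:
  assumes k: "k \<in> {1..k0}" and t: "norm t < \<rho>" and \<alpha>: "\<alpha> \<in> supps k" "\<And>\<beta>. \<beta> \<in> supps k \<Longrightarrow> wt w \<alpha> \<le> wt w \<beta>"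
  shows "newton_d w (G k t) = real (wt w \<alpha>)"
proof -
  obtain t1 where t1: "norm t1 < \<rho>" "\<alpha> \<in> zsupp (G k t1)" using \<alpha>(1) by (auto simp: supps_def zsupp_def)
  have fin: "finite (zsupp (G k t))" for t unfolding G_def by (rule finite_zsupp_tslice[OF poly[OF k]])
  have ne: "zsupp (G k t1) \<noteq> {}" using t1 by blast
  obtain \<beta> where \<beta>: "\<beta> \<in> zsupp (G k t1)" "newton_d w (G k t1) = real (wt w \<beta>)"
    "\<And>\<gamma>. \<gamma> \<in> zsupp (G k t1) \<Longrightarrow> wt w \<beta> \<le> wt w \<gamma>"
    using newton_d_attained[OF ne] by metis
  have "wt w \<beta> = wt w \<alpha>"
    using \<beta>(3)[OF t1(2)] \<alpha>(2)[of \<beta>] \<beta>(1) zsupp_subset[OF t1(1)] by (meson antisym subsetD)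
  moreover have "newton_d w (G k t1) = newton_d w (G k t)"
    by (rule newton_d_eq_of_boundary_eq[OF _ fin fin ne]) (simp add: boundary[OF t1(1) k] boundary[OF t k])
  ultimately show ?thesis using \<beta>(2) by simp
qed

text \<open>After division by sig the sums over \<open>supps k\<close> converge term by term, as
  coefficients are continuous in t. By \<open>newton_d_supps\<close> the surviving terms form the
  face function at the limit t0. Factors \<alpha>_i turn values into logarithmic derivatives, and
  weighting these with w gives Euler's identity.\<close>

lemma family_limit:
  fixes t :: "nat \<Rightarrow> complex" and z :: "nat \<Rightarrow> complex^'n"
  assumes S: "S \<subseteq> {1..k0}" and t: "t \<longlonglongrightarrow> t0" "norm t0 < \<rho>" "\<And>m. norm (t m) < \<rho>" and z: "z \<longlonglongrightarrow> z0"
    and nz: "\<And>k m. k \<in> S \<Longrightarrow> \<exists>\<alpha>\<in>supps k. zmonom \<alpha> (z m) \<noteq> 0"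
  obtains r :: "nat \<Rightarrow> nat" and w :: "nat^'n" and u :: "complex^'n" and sig :: "nat \<Rightarrow> nat \<Rightarrow> complex" and d :: "nat \<Rightarrow> nat"
  where "strict_mono r" "\<And>i. w $ i = 0 \<longleftrightarrow> z0 $ i \<noteq> 0" "u \<in> torus" "\<And>i. z0 $ i \<noteq> 0 \<Longrightarrow> u $ i = z0 $ i"
    "\<And>k m. k \<in> S \<Longrightarrow> sig k m \<noteq> 0" "\<And>k. k \<in> S \<Longrightarrow> \<exists>\<alpha>\<in>supps k. wt w \<alpha> = d k"
    "\<And>k \<alpha>. k \<in> S \<Longrightarrow> \<alpha> \<in> supps k \<Longrightarrow> d k \<le> wt w \<alpha>"
    "\<And>k \<alpha>. k \<in> S \<Longrightarrow> face_fun w (G k t0) \<alpha> = (if wt w \<alpha> = d k then G k t0 \<alpha> else 0)"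
    "\<And>k. k \<in> S \<Longrightarrow> (\<lambda>m. zeval (G k (t (r m))) (z (r m)) / sig k m) \<longlonglongrightarrow> zeval (face_fun w (G k t0)) u"
    "\<And>k i. k \<in> S \<Longrightarrow> (\<lambda>m. logd k (t (r m)) (z (r m)) i / sig k m) \<longlonglongrightarrow> u $ i * zpartial (face_fun w (G k t0)) i u"
    "\<And>k. k \<in> S \<Longrightarrow> (\<Sum>i\<in>UNIV. of_nat (w $ i) * (u $ i * zpartial (face_fun w (G k t0)) i u)) = of_nat (d k) * zeval (face_fun w (G k t0)) u"
proof -
  have finS: "finite S" using S finite_subset by blast
  have finA: "finite (supps k)" if "k \<in> S" for k using finite_supps that S by blast
  obtain r :: "nat \<Rightarrow> nat" and w :: "nat^'n" and u :: "complex^'n" and sig :: "nat \<Rightarrow> nat \<Rightarrow> complex" and d :: "nat \<Rightarrow> nat"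
    where r: "strict_mono r" "\<And>i. w $ i = 0 \<longleftrightarrow> z0 $ i \<noteq> 0" "u \<in> torus" "\<And>i. z0 $ i \<noteq> 0 \<Longrightarrow> u $ i = z0 $ i"
      "\<And>k m. k \<in> S \<Longrightarrow> sig k m \<noteq> 0" "\<And>k. k \<in> S \<Longrightarrow> \<exists>\<alpha>\<in>supps k. wt w \<alpha> = d k"
      "\<And>k \<alpha>. k \<in> S \<Longrightarrow> \<alpha> \<in> supps k \<Longrightarrow> d k \<le> wt w \<alpha>"
      "\<And>k \<alpha>. k \<in> S \<Longrightarrow> \<alpha> \<in> supps k \<Longrightarrow>
         (\<lambda>m. zmonom \<alpha> (z (r m)) / sig k m) \<longlonglongrightarrow> (if wt w \<alpha> = d k then zmonom \<alpha> u else 0)"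
    by (rule toric_limit[OF finS finA nz z]) blast+
  have face: "face_fun w (G k t0) \<alpha> = (if wt w \<alpha> = d k then G k t0 \<alpha> else 0)" if k: "k \<in> S" for k \<alpha>
  proof -
    obtain \<beta> where \<beta>: "\<beta> \<in> supps k" "wt w \<beta> = d k" using r(6)[OF k] by blast
    have k': "k \<in> {1..k0}" using k S by blast
    have "newton_d w (G k t0) = real (wt w \<beta>)"
      by (rule newton_d_supps[OF k' t(2) \<beta>(1)]) (use r(7)[OF k] \<beta>(2) in simp)
    then show ?thesis using \<beta>(2) by (simp add: face_fun_eq)
  qed
  have fsub: "zsupp (face_fun w (G k t0)) \<subseteq> supps k" if "k \<in> S" for k
    using zsupp_subset[OF t(2), of k] by (auto simp: zsupp_def face[OF that] split: if_splits)
  have lim: "(\<lambda>m. (\<Sum>\<alpha>\<in>supps k. G k (t (r m)) \<alpha> * q \<alpha> * zmonom \<alpha> (z (r m))) / sig k m) \<longlonglongrightarrow>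
      (\<Sum>\<alpha>\<in>supps k. face_fun w (G k t0) \<alpha> * q \<alpha> * zmonom \<alpha> u)" if k: "k \<in> S" for k q
  proof -
    have tr: "(\<lambda>m. t (r m)) \<longlonglongrightarrow> t0" using LIMSEQ_subseq_LIMSEQ[OF t(1) r(1)] by (simp add: o_def)
    have "(\<lambda>m. \<Sum>\<alpha>\<in>supps k. G k (t (r m)) \<alpha> * q \<alpha> * (zmonom \<alpha> (z (r m)) / sig k m)) \<longlonglongrightarrow>
      (\<Sum>\<alpha>\<in>supps k. G k t0 \<alpha> * q \<alpha> * (if wt w \<alpha> = d k then zmonom \<alpha> u else 0))"
      unfolding G_def by (intro tendsto_sum tendsto_mult tendsto_const tslice_tendsto tr r(8)[OF k])
    moreover have "(\<Sum>\<alpha>\<in>supps k. G k t0 \<alpha> * q \<alpha> * (if wt w \<alpha> = d k then zmonom \<alpha> u else 0)) =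
       (\<Sum>\<alpha>\<in>supps k. face_fun w (G k t0) \<alpha> * q \<alpha> * zmonom \<alpha> u)"
      by (rule sum.cong) (auto simp: face[OF k])
    ultimately show ?thesis by (simp add: sum_divide_distrib)
  qed
  show thesis
  proof (rule that[of r w u sig d])
    fix k assume k: "k \<in> S"
    show "(\<lambda>m. zeval (G k (t (r m))) (z (r m)) / sig k m) \<longlonglongrightarrow> zeval (face_fun w (G k t0)) u"
      using lim[OF k, of "\<lambda>_. 1"]
      by (simp add: zeval_superset[OF finA[OF k] zsupp_subset[OF t(3)]] zeval_superset[OF finA[OF k] fsub[OF k]])
    show "(\<lambda>m. logd k (t (r m)) (z (r m)) i / sig k m) \<longlonglongrightarrow> u $ i * zpartial (face_fun w (G k t0)) i u" for i
      using lim[OF k, of "\<lambda>\<alpha>. of_nat (\<alpha> $ i)"]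
      by (simp add: logd_def mult_zpartial[OF finA[OF k] zsupp_subset[OF t(3)]] mult_zpartial[OF finA[OF k] fsub[OF k]])
    have "(\<Sum>i\<in>UNIV. of_nat (w $ i) * (u $ i * zpartial (face_fun w (G k t0)) i u)) =
        (\<Sum>i\<in>UNIV. \<Sum>\<alpha>\<in>supps k. face_fun w (G k t0) \<alpha> * of_nat (w $ i * \<alpha> $ i) * zmonom \<alpha> u)"
      unfolding mult_zpartial[OF finA[OF k] fsub[OF k]] sum_distrib_left
      by (intro sum.cong) (auto simp: algebra_simps)
    also have "\<dots> = (\<Sum>\<alpha>\<in>supps k. face_fun w (G k t0) \<alpha> * of_nat (wt w \<alpha>) * zmonom \<alpha> u)"
      by (subst sum.swap) (simp add: wt_def sum_distrib_left sum_distrib_right)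
    also have "\<dots> = of_nat (d k) * zeval (face_fun w (G k t0)) u"
      unfolding zeval_superset[OF finA[OF k] fsub[OF k]] sum_distrib_left
      by (rule sum.cong) (auto simp: face[OF k])
    finally show "(\<Sum>i\<in>UNIV. of_nat (w $ i) * (u $ i * zpartial (face_fun w (G k t0)) i u)) = of_nat (d k) * zeval (face_fun w (G k t0)) u" .
  qed (use r face in auto)
qed

text \<open>The terms theta m |z_i|^2 all have the same argument, so they cannot cancel in the weighted sum.\<close>
lemma common_phase_limit:
  fixes \<theta> :: "nat \<Rightarrow> complex" and z :: "nat \<Rightarrow> complex^'n" and w :: "nat^'n"
  assumes V: "\<And>i. (\<lambda>m. \<theta> m * of_real ((norm (z m $ i))\<^sup>2)) \<longlonglongrightarrow> V i"
    and 0: "(\<Sum>i\<in>UNIV. of_nat (w $ i) * V i) = 0" and i: "w $ i > 0"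
  shows "V i = 0"
proof -
  have "(\<lambda>m. \<Sum>i\<in>UNIV. of_nat (w $ i) * (\<theta> m * of_real ((norm (z m $ i))\<^sup>2))) \<longlonglongrightarrow> (\<Sum>i\<in>UNIV. of_nat (w $ i) * V i)"
    by (intro tendsto_intros V)
  then have s0: "(\<lambda>m. norm (\<Sum>i\<in>UNIV. of_nat (w $ i) * (\<theta> m * of_real ((norm (z m $ i))\<^sup>2)))) \<longlonglongrightarrow> 0"
    unfolding 0 by (rule tendsto_norm_zero)
  have "norm (\<theta> m * of_real ((norm (z m $ i))\<^sup>2)) \<le> norm (\<Sum>i\<in>UNIV. of_nat (w $ i) * (\<theta> m * of_real ((norm (z m $ i))\<^sup>2)))" for m
  proof -
    let ?s = "\<Sum>i\<in>UNIV. real (w $ i) * (norm (z m $ i))\<^sup>2"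
    have "1 * (norm (z m $ i))\<^sup>2 \<le> real (w $ i) * (norm (z m $ i))\<^sup>2" using i by (intro mult_right_mono) auto
    also have "\<dots> \<le> ?s" by (rule member_le_sum[of i UNIV "\<lambda>i. real (w $ i) * (norm (z m $ i))\<^sup>2"]) auto
    finally have le: "(norm (z m $ i))\<^sup>2 \<le> ?s" by simp
    have "(\<Sum>i\<in>UNIV. of_nat (w $ i) * (\<theta> m * of_real ((norm (z m $ i))\<^sup>2))) = \<theta> m * of_real ?s"
      by (simp add: sum_distrib_left algebra_simps)
    then have "norm (\<Sum>i\<in>UNIV. of_nat (w $ i) * (\<theta> m * of_real ((norm (z m $ i))\<^sup>2))) = norm (\<theta> m) * ?s"
      by (simp only: norm_mult norm_of_real) (simp add: sum_nonneg)
    then show ?thesis using le by (simp add: norm_mult norm_power mult_left_mono)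
  qed
  then have "(\<lambda>m. \<theta> m * of_real ((norm (z m $ i))\<^sup>2)) \<longlonglongrightarrow> 0"
    by (intro Lim_null_comparison[OF _ s0]) auto
  then show ?thesis using V[of i] LIMSEQ_unique by blast
qed

text \<open>Division by the sum of the moduli puts the coefficient vectors on a compact l1-sphere,
  so the limit is not the zero vector.\<close>

lemma normalized_limit:
  fixes c :: "nat \<Rightarrow> nat \<Rightarrow> complex"
  assumes K: "finite K" and c: "\<And>m. \<exists>k\<in>K. c k m \<noteq> 0"
  obtains r :: "nat \<Rightarrow> nat" and l where "strict_mono r"
    "\<And>k. k \<in> K \<Longrightarrow> (\<lambda>m. c k (r m) / of_real (\<Sum>k\<in>K. norm (c k (r m)))) \<longlonglongrightarrow> l k"
    "\<exists>k\<in>K. l k \<noteq> 0"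
proof -
  define N where "N m = (\<Sum>k\<in>K. norm (c k m))" for m
  have N: "N m > 0" for m
  proof -
    obtain k where "k \<in> K" "c k m \<noteq> 0" using c by blast
    then show ?thesis unfolding N_def using K by (intro sum_pos2[of K k]) auto
  qed
  have "norm (c k m / of_real (N m)) \<le> 1" if "k \<in> K" for k m
  proof -
    have "norm (c k m) \<le> N m" unfolding N_def using K by (intro member_le_sum that) auto
    then show ?thesis using N[of m] by (simp add: norm_divide)
  qed
  then obtain r :: "nat \<Rightarrow> nat" and l where r: "strict_mono r" "\<And>k. k \<in> K \<Longrightarrow> (\<lambda>m. c k (r m) / of_real (N (r m))) \<longlonglongrightarrow> l k"
    using finite_bounded_subseq[OF K, of "\<lambda>k m. c k m / of_real (N m)"] by blast
  have "(\<lambda>m. \<Sum>k\<in>K. norm (c k (r m) / of_real (N (r m)))) \<longlonglongrightarrow> (\<Sum>k\<in>K. norm (l k))"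
    by (intro tendsto_sum tendsto_norm r)
  moreover have "(\<Sum>k\<in>K. norm (c k m / of_real (N m))) = 1" for m
  proof -
    have "(\<Sum>k\<in>K. norm (c k m / of_real (N m))) = (\<Sum>k\<in>K. norm (c k m)) / N m"
      using N[of m] by (simp add: norm_divide sum_divide_distrib)
    then show ?thesis using N[of m] by (simp add: N_def)
  qed
  ultimately have "(\<Sum>k\<in>K. norm (l k)) = 1" by (simp add: LIMSEQ_const_iff)
  then have "\<exists>k\<in>K. l k \<noteq> 0" by (metis norm_zero sum.neutral zero_neq_one)
  then show thesis using that r unfolding N_def by blast
qed

text \<open>Up to radius \<epsilon>, the strata cut out by the f^k in the coordinate tori are transversal to the spheres.\<close>
definition transversal_radius :: "real \<Rightarrow> bool" where
  "transversal_radius \<epsilon> \<longleftrightarrow> (\<forall>t z K. \<forall>\<kappa> :: nat \<Rightarrow> complex. \<forall>\<tau> :: complex.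
     norm t \<le> \<rho> / 2 \<and> norm z \<le> \<epsilon> \<and> K \<subseteq> {1..k0} \<and>
     (\<forall>k\<in>K. zeval (G k t) z = 0 \<and> (\<exists>\<alpha>\<in>supps k. zmonom \<alpha> z \<noteq> 0)) \<and>
     (\<forall>i. (\<Sum>k\<in>K. \<kappa> k * logd k t z i) = \<tau> * of_real ((norm (z $ i))\<^sup>2)) \<longrightarrow> (\<forall>k\<in>K. \<kappa> k = 0))"

text \<open>Violations with z tending to 0 have a positive limiting weight. The face functions
  involved vanish at u, so Euler's identity makes the weighted sum of the limits of the radial terms
  zero. By \<open>common_phase_limit\<close> each of them is zero, even if the normalized \<tau> is
  unbounded, and non-degeneracy applies.\<close>

lemma transversal_radius_exists:
  obtains \<epsilon> where "\<epsilon> > 0" "\<epsilon>\<^sup>2 < R" "transversal_radius \<epsilon>"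
proof -
  define bad where "bad t z K \<kappa> \<tau> \<longleftrightarrow> norm t \<le> \<rho> / 2 \<and> K \<subseteq> {1..k0} \<and>
      (\<forall>k\<in>K. zeval (G k t) z = 0 \<and> (\<exists>\<alpha>\<in>supps k. zmonom \<alpha> z \<noteq> 0)) \<and>
      (\<forall>i. (\<Sum>k\<in>K. \<kappa> k * logd k t z i) = \<tau> * of_real ((norm (z $ i))\<^sup>2)) \<and> (\<exists>k\<in>K. \<kappa> k \<noteq> 0)"
    for t z K and \<kappa> :: "nat \<Rightarrow> complex" and \<tau> :: complex
  have "\<exists>\<epsilon>>0. \<forall>t z K \<kappa> \<tau>. norm z \<le> \<epsilon> \<longrightarrow> \<not> bad t z K \<kappa> \<tau>"
  proof (rule ccontr)
    assume "\<not> ?thesis"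
    then have "\<exists>t z K \<kappa> \<tau>. norm z \<le> 1 / real (Suc m) \<and> bad t z K \<kappa> \<tau>" for m
      using zero_less_divide_1_iff of_nat_0_less_iff zero_less_Suc by metis
    then obtain t z K \<kappa> \<tau> where z: "\<And>m. norm (z m) \<le> 1 / real (Suc m)" and b: "\<And>m. bad (t m) (z m) (K m) (\<kappa> m) (\<tau> m)"
      by metis
    have "K m \<in> Pow {1..k0}" for m using b[of m] by (auto simp: bad_def)
    \<comment> \<open>K m ranges over a finite power set, so it may be taken constant; the index set
      of the selection lemma is a singleton here.\<close>
    then obtain r1 :: "nat \<Rightarrow> nat" and K0 where r1: "strict_mono r1" "\<And>m. K (r1 m) = K0"
      using finite_choice_subseq[of "{()}" "\<lambda>_. Pow {1..k0}" "\<lambda>_. K"] by (metis finite.emptyI finite_Pow_iff finite_atLeastAtMost finite_insert singletonI)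
    have "bounded (range (\<lambda>m. t (r1 m)))" using b unfolding bounded_iff bad_def by blast
    then obtain t0 r2 where r2: "strict_mono (r2 :: nat \<Rightarrow> nat)" "((\<lambda>m. t (r1 m)) \<circ> r2) \<longlonglongrightarrow> t0"
      using bounded_imp_convergent_subsequence by blast
    define r where "r = r1 \<circ> r2"
    have r: "strict_mono r" unfolding r_def by (intro strict_mono_o r1 r2)
    have tlim: "(\<lambda>m. t (r m)) \<longlonglongrightarrow> t0" using r2 by (simp add: r_def o_def)
    have b': "bad (t (r m)) (z (r m)) K0 (\<kappa> (r m)) (\<tau> (r m))" for m using b[of "r m"] r1(2) by (simp add: r_def)
    have "z \<longlonglongrightarrow> 0" by (rule Lim_null_comparison[OF _ LIMSEQ_inverse_real_of_nat]) (use z in \<open>simp add: inverse_eq_divide\<close>)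
    then have zlim: "(\<lambda>m. z (r m)) \<longlonglongrightarrow> 0" using LIMSEQ_subseq_LIMSEQ[OF _ r] by (simp add: o_def)
    have tn: "norm (t (r m)) \<le> \<rho> / 2" for m using b'[of m] by (simp add: bad_def)
    then have "norm t0 \<le> \<rho> / 2" by (intro Lim_bounded[OF tendsto_norm[OF tlim], of 0]) auto
    then have t0: "norm t0 < \<rho>" using \<rho> by linarith
    have tn': "norm (t (r m)) < \<rho>" for m using tn[of m] \<rho> by linarith
    have K0: "K0 \<subseteq> {1..k0}" using b'[of 0] by (simp add: bad_def)
    have nz: "\<exists>\<alpha>\<in>supps k. zmonom \<alpha> (z (r m)) \<noteq> 0" if "k \<in> K0" for k m using b'[of m] that unfolding bad_def by blast
    obtain q :: "nat \<Rightarrow> nat" and w :: "nat^'n" and u :: "complex^'n" and sig :: "nat \<Rightarrow> nat \<Rightarrow> complex" and d :: "nat \<Rightarrow> nat"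
    where q: "strict_mono q" "\<And>i. w $ i = 0 \<longleftrightarrow> (0::complex^'n) $ i \<noteq> 0" "u \<in> torus"
      "\<And>k m. k \<in> K0 \<Longrightarrow> sig k m \<noteq> 0" 
      "\<And>k. k \<in> K0 \<Longrightarrow> (\<lambda>m. zeval (G k (t (r (q m)))) (z (r (q m))) / sig k m) \<longlonglongrightarrow> zeval (face_fun w (G k t0)) u"
      "\<And>k i. k \<in> K0 \<Longrightarrow> (\<lambda>m. logd k (t (r (q m))) (z (r (q m))) i / sig k m) \<longlonglongrightarrow> u $ i * zpartial (face_fun w (G k t0)) i u"
      "\<And>k. k \<in> K0 \<Longrightarrow> (\<Sum>i\<in>UNIV. of_nat (w $ i) * (u $ i * zpartial (face_fun w (G k t0)) i u)) = of_nat (d k) * zeval (face_fun w (G k t0)) u"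
      by (rule family_limit[OF K0 tlim t0 tn' zlim nz]) blast+
    define T Z where "T m = t (r (q m))" and "Z m = z (r (q m))" for m
    \<comment> \<open>The relation is rewritten for the rescaled derivatives logd / sig; its
      coefficients absorb sig before they are normalized.\<close>
    define c where "c k m = \<kappa> (r (q m)) k * sig k m" for k m
    have bq: "bad (T m) (Z m) K0 (\<kappa> (r (q m))) (\<tau> (r (q m)))" for m unfolding T_def Z_def by (rule b')
    have finK: "finite K0" using K0 finite_subset by blast
    have "\<exists>k\<in>K0. c k m \<noteq> 0" for m using bq[of m] q(4) unfolding bad_def c_def by force
    then obtain p :: "nat \<Rightarrow> nat" and l where p: "strict_mono p"
      "\<And>k. k \<in> K0 \<Longrightarrow> (\<lambda>m. c k (p m) / of_real (\<Sum>k\<in>K0. norm (c k (p m)))) \<longlonglongrightarrow> l k" "\<exists>k\<in>K0. l k \<noteq> 0"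
      using normalized_limit[OF finK, of c] by blast
    define N where "N m = (\<Sum>k\<in>K0. norm (c k m))" for m
    define \<theta> where "\<theta> m = \<tau> (r (q (p m))) / of_real (N (p m))" for m
    define V where "V i = (\<Sum>k\<in>K0. l k * (u $ i * zpartial (face_fun w (G k t0)) i u))" for i
    have \<phi>0: "zeval (face_fun w (G k t0)) u = 0" if k: "k \<in> K0" for k
    proof -
      have "zeval (G k (t (r (q m)))) (z (r (q m))) = 0" for m using bq[of m] k by (simp add: bad_def T_def Z_def)
      then show ?thesis using q(5)[OF k] by (simp add: LIMSEQ_const_iff)
    qed
    have V: "(\<lambda>m. \<theta> m * of_real ((norm (Z (p m) $ i))\<^sup>2)) \<longlonglongrightarrow> V i" for i
    proof -
      have "(\<lambda>m. logd k (T (p m)) (Z (p m)) i / sig k (p m)) \<longlonglongrightarrow> u $ i * zpartial (face_fun w (G k t0)) i u" if "k \<in> K0" for k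
        using LIMSEQ_subseq_LIMSEQ[OF q(6)[OF that, of i] p(1)] by (simp add: o_def T_def Z_def)
      then have "(\<lambda>m. \<Sum>k\<in>K0. c k (p m) / of_real (N (p m)) * (logd k (T (p m)) (Z (p m)) i / sig k (p m))) \<longlonglongrightarrow> V i"
        unfolding V_def N_def by (intro tendsto_sum tendsto_mult p)
      moreover have "(\<Sum>k\<in>K0. c k (p m) / of_real (N (p m)) * (logd k (T (p m)) (Z (p m)) i / sig k (p m))) =
          \<theta> m * of_real ((norm (Z (p m) $ i))\<^sup>2)" for m
      proof -
        have "(\<Sum>k\<in>K0. c k (p m) / of_real (N (p m)) * (logd k (T (p m)) (Z (p m)) i / sig k (p m))) =
          (\<Sum>k\<in>K0. \<kappa> (r (q (p m))) k * logd k (T (p m)) (Z (p m)) i) / of_real (N (p m))"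
          unfolding sum_divide_distrib by (rule sum.cong) (simp_all add: c_def q(4))
        also have "(\<Sum>k\<in>K0. \<kappa> (r (q (p m))) k * logd k (T (p m)) (Z (p m)) i) = \<tau> (r (q (p m))) * of_real ((norm (Z (p m) $ i))\<^sup>2)"
          using bq[of "p m"] unfolding bad_def by blast
        finally show ?thesis by (simp add: \<theta>_def)
      qed
      ultimately show ?thesis by simp
    qed
    have "(\<Sum>i\<in>UNIV. of_nat (w $ i) * V i) =
        (\<Sum>k\<in>K0. l k * (\<Sum>i\<in>UNIV. of_nat (w $ i) * (u $ i * zpartial (face_fun w (G k t0)) i u)))"
      unfolding V_def sum_distrib_left by (subst sum.swap) (simp add: algebra_simps)
    also have "\<dots> = 0" by (rule sum.neutral) (simp add: q(7) \<phi>0)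
    finally have V0: "V i = 0" for i using common_phase_limit[OF V, of w i] q(2)[of i] by simp
    have "nondegenerate_ci K0 (\<lambda>k. G k t0)" using p(3) by (intro nondegenerate t0 K0) auto
    moreover have "positive_weight w" using q(2) by (auto simp: positive_weight_def)
    moreover have "u \<in> Vstar K0 (\<lambda>k. face_fun w (G k t0))" using q(3) \<phi>0 by (simp add: Vstar_def)
    ultimately have "diffs_independent {} K0 (\<lambda>k. face_fun w (G k t0)) u" unfolding nondegenerate_ci_def by blast
    moreover have "(\<Sum>k\<in>K0. l k * zpartial (face_fun w (G k t0)) i u) = 0" for i
    proof -
      have "u $ i * (\<Sum>k\<in>K0. l k * zpartial (face_fun w (G k t0)) i u) = V i"
        by (simp add: V_def sum_distrib_left algebra_simps)
      then show ?thesis using V0[of i] q(3) by (simp add: torus_def)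
    qed
    ultimately have "\<forall>k\<in>K0. l k = 0" unfolding diffs_independent_def by blast
    then show False using p(3) by blast
  qed
  then obtain \<epsilon> where \<epsilon>: "\<epsilon> > 0" "\<And>t z K \<kappa> \<tau>. norm z \<le> \<epsilon> \<Longrightarrow> \<not> bad t z K \<kappa> \<tau>" by blast
  show thesis
  proof (rule that[of "min \<epsilon> (sqrt (R / 2))"])
    show "min \<epsilon> (sqrt (R / 2)) > 0" using \<epsilon> R by simp
    have "(min \<epsilon> (sqrt (R / 2)))\<^sup>2 \<le> (sqrt (R / 2))\<^sup>2" using \<epsilon> R by (intro power_mono) auto
    then show "(min \<epsilon> (sqrt (R / 2)))\<^sup>2 < R" using R by simp
    show "transversal_radius (min \<epsilon> (sqrt (R / 2)))"
      unfolding transversal_radius_def using \<epsilon>(2) unfolding bad_def by (meson min.boundedE)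
  qed
qed

text \<open>
  Divide the logarithmic derivatives of the f^k by dominant monomials: in the limit the coefficients
  of the relation are carried by those k whose face function vanishes at u. Tameness (or
  non-degeneracy, at the origin) kills the f^k that vanish on the coordinate space of z0, and the
  choice of the radius kills the others.
\<close>
lemma no_critical_sequence:
  fixes z :: "nat \<Rightarrow> complex^'n"
  assumes \<epsilon>: "\<epsilon>\<^sup>2 < R" "transversal_radius \<epsilon>"
    and t0: "norm t0 \<le> \<rho> / 2" and z0: "norm z0 \<le> \<epsilon>"
    and t: "t \<longlonglongrightarrow> t0" "\<And>m. norm (t m) < \<rho>" and z: "z \<longlonglongrightarrow> z0"
    and nz: "\<And>k m. k \<in> {1..k0} \<Longrightarrow> zeval (G k (t m)) (z m) \<noteq> 0"
    and crit: "\<And>m i. (\<Sum>k\<in>{1..k0}. logd k (t m) (z m) i / zeval (G k (t m)) (z m)) = \<mu> m * of_real ((norm (z m $ i))\<^sup>2)"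
    and \<mu>0: "\<And>m. z0 = 0 \<Longrightarrow> \<mu> m = 0"
    and kz: "kz \<in> {1..k0}" "zeval (G kz t0) z0 = 0"
  shows False
proof -
  let ?S = "{1..k0}"
  have t0': "norm t0 < \<rho>" using t0 \<rho> by linarith
  have nz': "\<exists>\<alpha>\<in>supps k. zmonom \<alpha> (z m) \<noteq> 0" if k: "k \<in> ?S" for k m
  proof (rule ccontr)
    assume "\<not> ?thesis"
    then have "zeval (G k (t m)) (z m) = 0"
      unfolding zeval_superset[OF finite_supps[OF k] zsupp_subset[OF t(2)]] by (intro sum.neutral) auto
    then show False using nz[OF k] by blast
  qed
  obtain q :: "nat \<Rightarrow> nat" and w :: "nat^'n" and u :: "complex^'n" and sig :: "nat \<Rightarrow> nat \<Rightarrow> complex" and d :: "nat \<Rightarrow> nat"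
    where q: "strict_mono q" "\<And>i. w $ i = 0 \<longleftrightarrow> z0 $ i \<noteq> 0" "u \<in> torus" "\<And>i. z0 $ i \<noteq> 0 \<Longrightarrow> u $ i = z0 $ i"
      "\<And>k m. k \<in> ?S \<Longrightarrow> sig k m \<noteq> 0" "\<And>k. k \<in> ?S \<Longrightarrow> \<exists>\<alpha>\<in>supps k. wt w \<alpha> = d k"
      "\<And>k \<alpha>. k \<in> ?S \<Longrightarrow> \<alpha> \<in> supps k \<Longrightarrow> d k \<le> wt w \<alpha>"
      "\<And>k \<alpha>. k \<in> ?S \<Longrightarrow> face_fun w (G k t0) \<alpha> = (if wt w \<alpha> = d k then G k t0 \<alpha> else 0)"
      "\<And>k. k \<in> ?S \<Longrightarrow> (\<lambda>m. zeval (G k (t (q m))) (z (q m)) / sig k m) \<longlonglongrightarrow> zeval (face_fun w (G k t0)) u"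
      "\<And>k i. k \<in> ?S \<Longrightarrow> (\<lambda>m. logd k (t (q m)) (z (q m)) i / sig k m) \<longlonglongrightarrow> u $ i * zpartial (face_fun w (G k t0)) i u"
      "\<And>k. k \<in> ?S \<Longrightarrow> (\<Sum>i\<in>UNIV. of_nat (w $ i) * (u $ i * zpartial (face_fun w (G k t0)) i u)) = of_nat (d k) * zeval (face_fun w (G k t0)) u"
    by (rule family_limit[OF order_refl t(1) t0' t(2) z nz']) blast+
  define \<phi> where "\<phi> k = zeval (face_fun w (G k t0)) u" for k
  define ell where "ell k i = u $ i * zpartial (face_fun w (G k t0)) i u" for k i
  have fsub: "zsupp (face_fun w (G k t0)) \<subseteq> supps k" if "k \<in> ?S" for k
    using zsupp_subset[OF t0', of k] by (auto simp: zsupp_def q(8)[OF that] split: if_splits)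
  \<comment> \<open>If d k = 0, the face function contains only monomials in the nonvanishing
    coordinates of z0, where u and z0 agree, while all other monomials vanish at z0. So passing to
    the limit amounts to evaluating f^k at z0.\<close>
  have flat: "(\<Sum>\<alpha>\<in>supps k. face_fun w (G k t0) \<alpha> * h \<alpha> * zmonom \<alpha> u) = (\<Sum>\<alpha>\<in>supps k. G k t0 \<alpha> * h \<alpha> * zmonom \<alpha> z0)"
    if k: "k \<in> ?S" "d k = 0" for k h
  proof (rule sum.cong)
    fix \<alpha>
    show "face_fun w (G k t0) \<alpha> * h \<alpha> * zmonom \<alpha> u = G k t0 \<alpha> * h \<alpha> * zmonom \<alpha> z0"
    proof (cases "wt w \<alpha> = 0")
      case True
      then have "w $ i = 0 \<or> \<alpha> $ i = 0" for i by (simp add: wt_def)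
      then have "u $ i ^ (\<alpha> $ i) = z0 $ i ^ (\<alpha> $ i)" for i
        using q(2)[of i] q(4)[of i] by (metis power_0)
      then have "zmonom \<alpha> u = zmonom \<alpha> z0" by (simp add: zmonom_def)
      then show ?thesis using True k by (simp add: q(8))
    next
      case False
      then obtain i where "w $ i * \<alpha> $ i > 0" by (auto simp: wt_def)
      then have "zmonom \<alpha> z0 = 0" using q(2)[of i] by (auto simp: zmonom_eq_0_iff)
      then show ?thesis using False k by (simp add: q(8))
    qed
  qed simp
  have flat_\<phi>: "\<phi> k = zeval (G k t0) z0" if "k \<in> ?S" "d k = 0" for k
    using flat[OF that, of "\<lambda>_. 1"]
    by (simp add: \<phi>_def zeval_superset[OF finite_supps[OF that(1)] fsub[OF that(1)]]
        zeval_superset[OF finite_supps[OF that(1)] zsupp_subset[OF t0']])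
  have flat_ell: "ell k i = logd k t0 z0 i" if "k \<in> ?S" "d k = 0" for k i
    using flat[OF that, of "\<lambda>\<alpha>. of_nat (\<alpha> $ i)"]
    by (simp add: ell_def logd_def mult_zpartial[OF finite_supps[OF that(1)] fsub[OF that(1)]]
        mult_zpartial[OF finite_supps[OF that(1)] zsupp_subset[OF t0']])
  \<comment> \<open>These coefficients express the sum of the logd / f^k through the logd / sig,
    whose limits are known. They blow up when the face function vanishes at u, hence the
    normalization.\<close>
  define c where "c k m = sig k m / zeval (G k (t (q m))) (z (q m))" for k m
  have c0: "c k m \<noteq> 0" if "k \<in> ?S" for k m using q(5) nz that by (simp add: c_def)
  then have "\<exists>k\<in>?S. c k m \<noteq> 0" for m using kz(1) by blast
  then obtain p :: "nat \<Rightarrow> nat" and l where p: "strict_mono p"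
    "\<And>k. k \<in> ?S \<Longrightarrow> (\<lambda>m. c k (p m) / of_real (\<Sum>k\<in>?S. norm (c k (p m)))) \<longlonglongrightarrow> l k" "\<exists>k\<in>?S. l k \<noteq> 0"
    using normalized_limit[OF finite_atLeastAtMost, of 1 k0 c] by blast
  define T Z where "T m = t (q (p m))" and "Z m = z (q (p m))" for m
  define N where "N m = complex_of_real (\<Sum>k\<in>?S. norm (c k (p m)))" for m
  define \<theta> where "\<theta> m = \<mu> (q (p m)) / N m" for m
  define V where "V i = (\<Sum>k\<in>?S. l k * ell k i)" for i
  have V: "(\<lambda>m. \<theta> m * of_real ((norm (Z m $ i))\<^sup>2)) \<longlonglongrightarrow> V i" for i
  proof -
    have "(\<lambda>m. logd k (T m) (Z m) i / sig k (p m)) \<longlonglongrightarrow> ell k i" if "k \<in> ?S" for k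
      using LIMSEQ_subseq_LIMSEQ[OF q(10)[OF that, of i] p(1)] by (simp add: o_def T_def Z_def ell_def)
    then have "(\<lambda>m. \<Sum>k\<in>?S. c k (p m) / N m * (logd k (T m) (Z m) i / sig k (p m))) \<longlonglongrightarrow> V i"
      unfolding V_def N_def by (intro tendsto_sum tendsto_mult p)
    moreover have "(\<Sum>k\<in>?S. c k (p m) / N m * (logd k (T m) (Z m) i / sig k (p m))) = \<theta> m * of_real ((norm (Z m $ i))\<^sup>2)" for m
    proof -
      have "(\<Sum>k\<in>?S. c k (p m) / N m * (logd k (T m) (Z m) i / sig k (p m))) =
        (\<Sum>k\<in>?S. logd k (T m) (Z m) i / zeval (G k (T m)) (Z m)) / N m"
        unfolding sum_divide_distrib by (rule sum.cong) (simp_all add: c_def T_def Z_def q(5))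
      also have "(\<Sum>k\<in>?S. logd k (T m) (Z m) i / zeval (G k (T m)) (Z m)) = \<mu> (q (p m)) * of_real ((norm (Z m $ i))\<^sup>2)"
        unfolding T_def Z_def by (rule crit)
      finally show ?thesis by (simp add: \<theta>_def)
    qed
    ultimately show ?thesis by simp
  qed
  have Zlim: "Z \<longlonglongrightarrow> z0"
    using LIMSEQ_subseq_LIMSEQ[OF LIMSEQ_subseq_LIMSEQ[OF z q(1)] p(1)] by (simp add: o_def Z_def[abs_def])
  \<comment> \<open>At the origin the radial term is absent by assumption. Otherwise a nonvanishing
    coordinate of z0 can be divided out to see that the coefficient converges.\<close>
  obtain \<tau> where \<tau>: "\<theta> \<longlonglongrightarrow> \<tau>"
  proof (cases "z0 = 0")
    case True
    then have "\<theta> = (\<lambda>m. 0)" using \<mu>0 by (simp add: \<theta>_def fun_eq_iff)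
    then show thesis using that[of 0] by simp
  next
    case False
    then obtain j where j: "z0 $ j \<noteq> 0" by (auto simp: vec_eq_iff)
    have zj: "(\<lambda>m. complex_of_real ((norm (Z m $ j))\<^sup>2)) \<longlonglongrightarrow> of_real ((norm (z0 $ j))\<^sup>2)"
      by (intro tendsto_intros tendsto_vec_nth Zlim)
    have "(\<lambda>m. \<theta> m * of_real ((norm (Z m $ j))\<^sup>2) / of_real ((norm (Z m $ j))\<^sup>2)) \<longlonglongrightarrow> V j / of_real ((norm (z0 $ j))\<^sup>2)"
      by (rule tendsto_divide[OF V zj]) (use j in simp)
    moreover have "\<forall>\<^sub>F m in sequentially. Z m $ j \<noteq> 0"
      by (rule tendsto_imp_eventually_ne[OF tendsto_vec_nth[OF Zlim] j])
    then have "\<forall>\<^sub>F m in sequentially. \<theta> m * of_real ((norm (Z m $ j))\<^sup>2) / of_real ((norm (Z m $ j))\<^sup>2) = \<theta> m"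
      by eventually_elim simp
    ultimately show thesis by (intro that) (rule Lim_transform_eventually)
  qed
  have V\<tau>: "V i = \<tau> * of_real ((norm (z0 $ i))\<^sup>2)" for i
  proof -
    have "(\<lambda>m. \<theta> m * of_real ((norm (Z m $ i))\<^sup>2)) \<longlonglongrightarrow> \<tau> * of_real ((norm (z0 $ i))\<^sup>2)"
      by (intro tendsto_intros tendsto_vec_nth Zlim \<tau>)
    then show ?thesis using V LIMSEQ_unique by blast
  qed
  define \<nu> where "\<nu> = l kz * \<phi> kz"
  \<comment> \<open>c k times f^k / sig is 1 for every k, so after normalization all products l k *
    \<phi> k are the same limit, that of 1 / N.\<close>
  have l\<phi>: "l k * \<phi> k = \<nu>" if k: "k \<in> ?S" for k
  proof -
    have inv: "(\<lambda>m. 1 / N m) \<longlonglongrightarrow> l k * \<phi> k" if k: "k \<in> ?S" for k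
    proof -
      have "(\<lambda>m. zeval (G k (T m)) (Z m) / sig k (p m)) \<longlonglongrightarrow> \<phi> k"
        using LIMSEQ_subseq_LIMSEQ[OF q(9)[OF k] p(1)] by (simp add: o_def T_def Z_def \<phi>_def)
      from tendsto_mult[OF p(2)[OF k] this]
      have "(\<lambda>m. c k (p m) / N m * (zeval (G k (T m)) (Z m) / sig k (p m))) \<longlonglongrightarrow> l k * \<phi> k" by (simp add: N_def)
      moreover have "c k (p m) / N m * (zeval (G k (T m)) (Z m) / sig k (p m)) = 1 / N m" for m
        using q(5)[OF k, of "p m"] nz[OF k, of "q (p m)"] by (simp add: c_def T_def Z_def)
      ultimately show ?thesis by simp
    qed
    show ?thesis unfolding \<nu>_def by (rule LIMSEQ_unique[OF inv[OF k] inv[OF kz(1)]])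
  qed
  \<comment> \<open>Euler's identity for each f^k. The weighted sum of the V_i vanishes, since V_i
    can be nonzero only where z0_i is, and there w_i = 0.\<close>
  have "\<nu> * of_nat (\<Sum>k\<in>?S. d k) = (\<Sum>k\<in>?S. l k * (of_nat (d k) * \<phi> k))"
    unfolding of_nat_sum sum_distrib_left by (rule sum.cong) (simp_all add: mult.left_commute flip: l\<phi>)
  also have "\<dots> = (\<Sum>k\<in>?S. l k * (\<Sum>i\<in>UNIV. of_nat (w $ i) * ell k i))"
    unfolding ell_def by (rule sum.cong) (simp_all only: q(11) \<phi>_def)
  also have "\<dots> = (\<Sum>i\<in>UNIV. of_nat (w $ i) * V i)"
    unfolding V_def sum_distrib_left by (subst sum.swap) (simp add: algebra_simps)
  also have "\<dots> = 0" by (rule sum.neutral) (use q(2) in \<open>auto simp: V\<tau>\<close>)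
  finally have \<nu>d: "\<nu> * of_nat (\<Sum>k\<in>?S. d k) = 0" .
  \<comment> \<open>The zero of f at z0 enters here: if d kz = 0, then \<phi> kz is the value of
    f^kz at z0; otherwise the sum of the levels is positive.\<close>
  have \<nu>: "\<nu> = 0"
  proof (cases "d kz = 0")
    case True
    then show ?thesis using flat_\<phi>[OF kz(1)] kz(2) by (simp add: \<nu>_def)
  next
    case False
    then have "(\<Sum>k\<in>?S. d k) > 0" using member_le_sum[OF kz(1), of d] by simp
    then have "complex_of_nat (\<Sum>k\<in>?S. d k) \<noteq> 0" by (metis less_numeral_extra(3) of_nat_eq_0_iff)
    then show ?thesis using \<nu>d by (metis mult_eq_0_iff)
  qed
  \<comment> \<open>Only k with \<phi> k = 0 can carry the relation. A positive level d makes f^k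
    vanish on the coordinate space of z0 (K1); level 0 means that some exponent in
    \<open>supps k\<close> uses only nonvanishing coordinates of z0 (K2).\<close>
  define K1 where "K1 = {k \<in> ?S. \<phi> k = 0 \<and> d k > 0}"
  define K2 where "K2 = {k \<in> ?S. \<phi> k = 0 \<and> d k = 0}"
  have l0: "l k = 0" if "k \<in> ?S" "k \<notin> K1" "k \<notin> K2" for k
    using l\<phi>[OF that(1)] \<nu> that by (auto simp: K1_def K2_def)
  have Ksum: "(\<Sum>k\<in>?S. l k * h k) = (\<Sum>k\<in>K1. l k * h k) + (\<Sum>k\<in>K2. l k * h k)" for h
  proof -
    have "(\<Sum>k\<in>?S. l k * h k) = (\<Sum>k\<in>K1 \<union> K2. l k * h k)"
    proof (rule sum.mono_neutral_right)
      show "K1 \<union> K2 \<subseteq> ?S" by (auto simp: K1_def K2_def)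
      show "\<forall>k\<in>?S - (K1 \<union> K2). l k * h k = 0" using l0 by simp
    qed simp
    also have "\<dots> = (\<Sum>k\<in>K1. l k * h k) + (\<Sum>k\<in>K2. l k * h k)"
      by (rule sum.union_disjoint) (auto simp: K1_def K2_def)
    finally show ?thesis .
  qed
  have K2ell: "ell k i = logd k t0 z0 i" if "k \<in> K2" for k i using that by (intro flat_ell) (auto simp: K2_def)
  have lK1: "l k = 0" if k: "k \<in> K1" for k
  proof -
    let ?I = "{i. z0 $ i \<noteq> 0}"
    have K1: "K1 \<subseteq> ?S" "K1 \<noteq> {}" using k by (auto simp: K1_def)
    have uV: "u \<in> Vstar K1 (\<lambda>k. face_fun w (G k t0))" using q(3) by (auto simp: Vstar_def K1_def \<phi>_def)
    have zw: "zero_index w = ?I" using q(2) by (auto simp: zero_index_def)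
    have "diffs_independent ?I K1 (\<lambda>k. face_fun w (G k t0)) u"
    proof (cases "?I = {}")
      case True
      then have "positive_weight w" using q(2) by (auto simp: positive_weight_def)
      then show ?thesis using nondegenerate[OF t0' K1(2,1)] uV unfolding nondegenerate_ci_def True by blast
    next
      case False
      obtain R' where R': "R' > R" "tameness_radius R' K1 (\<lambda>k. G k t0)" using tame[OF t0' K1(2,1)] by blast
      have "?I \<in> vanishing_coord (G k t0)" if k: "k \<in> K1" for k
        unfolding vanishing_coord_def
      proof (intro CollectI allI impI)
        fix y :: "complex^'n" assume y: "\<forall>i. i \<notin> ?I \<longrightarrow> y $ i = 0"
        have kS: "k \<in> ?S" "d k > 0" using k by (auto simp: K1_def)
        have "zmonom \<alpha> y = 0" if "\<alpha> \<in> supps k" for \<alpha>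
        proof -
          have "wt w \<alpha> \<noteq> 0" using q(7)[OF kS(1) that] kS(2) by linarith
          then obtain i where "w $ i * \<alpha> $ i > 0" by (auto simp: wt_def)
          then show ?thesis using q(2)[of i] y by (auto simp: zmonom_eq_0_iff)
        qed
        then show "zeval (G k t0) y = 0"
          unfolding zeval_superset[OF finite_supps[OF kS(1)] zsupp_subset[OF t0']] by simp
      qed
      moreover have "w \<noteq> 0"
      proof
        assume "w = 0"
        then have "wt w \<alpha> = 0" for \<alpha> by (simp add: wt_def)
        then show False using k q(6)[of k] by (auto simp: K1_def)
      qed
      moreover have "(\<Sum>i\<in>?I. (norm (u $ i))\<^sup>2) < R'"
      proof -
        have "(\<Sum>i\<in>?I. (norm (u $ i))\<^sup>2) = (\<Sum>i\<in>?I. (norm (z0 $ i))\<^sup>2)" by (rule sum.cong) (auto simp: q(4))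
        also have "\<dots> \<le> (\<Sum>i\<in>UNIV. (norm (z0 $ i))\<^sup>2)" by (rule sum_mono2) auto
        also have "\<dots> = (norm z0)\<^sup>2" by (simp add: norm_vec_def L2_set_def sum_nonneg)
        also have "\<dots> \<le> \<epsilon>\<^sup>2" using z0 by (intro power_mono) auto
        finally show ?thesis using \<epsilon> R' by linarith
      qed
      moreover have "\<forall>i\<in>?I. u $ i \<noteq> 0" using q(3) by (simp add: torus_def)
      ultimately show ?thesis using R'(2) False zw uV unfolding tameness_radius_def by blast
    qed
    \<comment> \<open>In directions outside I both the radial term and the terms of K2 carry a
      factor z0_i = 0, so the relation involves K1 alone.\<close>
    moreover have "(\<Sum>k\<in>K1. l k * zpartial (face_fun w (G k t0)) i u) = 0" if "i \<notin> ?I" for i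
    proof -
      have "(\<Sum>k\<in>K2. l k * ell k i) = 0" using that by (intro sum.neutral) (simp add: K2ell logd_def)
      then have "(\<Sum>k\<in>K1. l k * ell k i) = 0" using Ksum[of "\<lambda>k. ell k i"] V\<tau>[of i] that by (simp add: V_def)
      moreover have "(\<Sum>k\<in>K1. l k * ell k i) = u $ i * (\<Sum>k\<in>K1. l k * zpartial (face_fun w (G k t0)) i u)"
        by (simp add: ell_def sum_distrib_left algebra_simps)
      ultimately show ?thesis using q(3) by (simp add: torus_def)
    qed
    ultimately show ?thesis using k unfolding diffs_independent_def by blast
  qed
  \<comment> \<open>With K1 gone, a relation at z0 itself with radial right-hand side remains, which
    \<open>transversal_radius\<close> excludes.\<close>
  have lK2: "l k = 0" if k: "k \<in> K2" for k
  proof -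
    have "(\<Sum>k\<in>K2. l k * logd k t0 z0 i) = \<tau> * of_real ((norm (z0 $ i))\<^sup>2)" for i
      using Ksum[of "\<lambda>k. ell k i"] V\<tau>[of i] lK1 by (simp add: V_def K2ell)
    moreover have "\<exists>\<alpha>\<in>supps k. zmonom \<alpha> z0 \<noteq> 0" if k2: "k \<in> K2" for k
    proof -
      obtain \<alpha> where \<alpha>: "\<alpha> \<in> supps k" "wt w \<alpha> = 0" using q(6)[of k] k2 by (auto simp: K2_def)
      then have "zmonom \<alpha> z0 \<noteq> 0" using q(2) by (auto simp: wt_def zmonom_eq_0_iff)
      then show ?thesis using \<alpha> by blast
    qed
    moreover have "zeval (G k t0) z0 = 0" if "k \<in> K2" for k using that flat_\<phi>[of k] by (auto simp: K2_def)
    moreover have "K2 \<subseteq> ?S" by (auto simp: K2_def)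
    ultimately show ?thesis using \<epsilon>(2) t0 z0 k unfolding transversal_radius_def by blast
  qed
  from p(3) l0 lK1 lK2 show False by blast
qed

end

section \<open>Isomorphism of the Milnor fibrations\<close>

lemma has_vector_derivative_prod:
  fixes f :: "'i \<Rightarrow> real \<Rightarrow> 'a::real_normed_field"
  assumes "\<And>i. i \<in> I \<Longrightarrow> (f i has_vector_derivative f' i) (at s within A)"
  shows "((\<lambda>s. \<Prod>i\<in>I. f i s) has_vector_derivative (\<Sum>i\<in>I. f' i * (\<Prod>j\<in>I - {i}. f j s))) (at s within A)"
proof -
  have "((\<lambda>s. \<Prod>i\<in>I. f i s) has_derivative (\<lambda>h. \<Sum>i\<in>I. (h *\<^sub>R f' i) * (\<Prod>j\<in>I - {i}. f j s))) (at s within A)"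
    using assms by (intro has_derivative_prod) (simp add: has_vector_derivative_def)
  then show ?thesis by (simp add: has_vector_derivative_def scaleR_sum_right)
qed

lemma has_vector_derivative_nth:
  fixes Y :: "real \<Rightarrow> complex^'n"
  shows "(Y has_vector_derivative Y') (at s within A) \<Longrightarrow> ((\<lambda>s. Y s $ i) has_vector_derivative Y' $ i) (at s within A)"
  by (rule bounded_linear.has_vector_derivative[OF bounded_linear_vec_nth])

lemma has_vector_derivative_power_complex:
  fixes f :: "real \<Rightarrow> complex"
  assumes "(f has_vector_derivative f') (at s within A)"
  shows "((\<lambda>s. f s ^ k) has_vector_derivative (of_nat k * f s ^ (k - 1) * f')) (at s within A)"
proof -
  have "((\<lambda>s. f s ^ k) has_derivative (\<lambda>h. of_nat k * (h *\<^sub>R f') * f s ^ (k - 1))) (at s within A)"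
    using assms by (intro has_derivative_power) (simp add: has_vector_derivative_def)
  moreover have "(\<lambda>h. of_nat k * (h *\<^sub>R f') * f s ^ (k - 1)) = (\<lambda>h. h *\<^sub>R (of_nat k * f s ^ (k - 1) * f'))"
    by (simp add: fun_eq_iff scaleR_conv_of_real algebra_simps)
  ultimately show ?thesis by (simp add: has_vector_derivative_def)
qed

lemma has_vector_derivative_zmonom:
  fixes Y :: "real \<Rightarrow> complex^'n"
  assumes "(Y has_vector_derivative Y') (at s within A)"
  shows "((\<lambda>s. zmonom \<alpha> (Y s)) has_vector_derivative (\<Sum>i\<in>UNIV. dmonom i \<alpha> (Y s) * Y' $ i)) (at s within A)"
proof -
  have "((\<lambda>s. zmonom \<alpha> (Y s)) has_vector_derivative
     (\<Sum>i\<in>UNIV. (of_nat (\<alpha> $ i) * (Y s $ i) ^ (\<alpha> $ i - 1) * Y' $ i) * (\<Prod>j\<in>UNIV - {i}. Y s $ j ^ (\<alpha> $ j)))) (at s within A)"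
    unfolding zmonom_def by (intro has_vector_derivative_prod has_vector_derivative_power_complex has_vector_derivative_nth assms)
  moreover have "(\<Sum>i\<in>UNIV. (of_nat (\<alpha> $ i) * (Y s $ i) ^ (\<alpha> $ i - 1) * Y' $ i) * (\<Prod>j\<in>UNIV - {i}. Y s $ j ^ (\<alpha> $ j)))
      = (\<Sum>i\<in>UNIV. dmonom i \<alpha> (Y s) * Y' $ i)"
    by (rule sum.cong) (simp_all add: dmonom_def algebra_simps)
  ultimately show ?thesis by simp
qed

definition dtslice :: "(nat \<Rightarrow> nat^'n \<Rightarrow> complex) \<Rightarrow> complex \<Rightarrow> nat^'n \<Rightarrow> complex" where
  "dtslice c t \<alpha> = (\<Sum>j\<in>{j. c j \<alpha> \<noteq> 0}. c j \<alpha> * (of_nat j * t ^ (j - 1)))"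

lemma has_vector_derivative_tzeval:
  fixes Y :: "real \<Rightarrow> complex^'n"
  assumes c: "is_tzpoly c" and Y: "(Y has_vector_derivative Y') (at s within A)"
    and t: "(t has_vector_derivative t') (at s within A)"
  shows "((\<lambda>s. tzeval c (t s) (Y s)) has_vector_derivative
     ((\<Sum>\<alpha>\<in>zsupports c. dtslice c (t s) \<alpha> * zmonom \<alpha> (Y s)) * t' +
      (\<Sum>i\<in>UNIV. zpartial (tslice c (t s)) i (Y s) * Y' $ i))) (at s within A)"
proof -
  have "((\<lambda>s. tslice c (t s) \<alpha>) has_vector_derivative dtslice c (t s) \<alpha> * t') (at s within A)" for \<alpha>
  proof -
    have "((\<lambda>s. tslice c (t s) \<alpha>) has_vector_derivative
        (\<Sum>j\<in>{j. c j \<alpha> \<noteq> 0}. c j \<alpha> * (of_nat j * t s ^ (j - 1) * t'))) (at s within A)"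
      unfolding tslice_def
      by (intro has_vector_derivative_sum bounded_linear.has_vector_derivative[OF bounded_linear_mult_right]
          has_vector_derivative_power_complex t)
    then show ?thesis by (simp add: dtslice_def sum_distrib_right mult.assoc)
  qed
  then have "((\<lambda>s. \<Sum>\<alpha>\<in>zsupports c. tslice c (t s) \<alpha> * zmonom \<alpha> (Y s)) has_vector_derivative
     (\<Sum>\<alpha>\<in>zsupports c. tslice c (t s) \<alpha> * (\<Sum>i\<in>UNIV. dmonom i \<alpha> (Y s) * Y' $ i) + dtslice c (t s) \<alpha> * t' * zmonom \<alpha> (Y s))) (at s within A)"
    by (intro has_vector_derivative_sum has_vector_derivative_mult has_vector_derivative_zmonom Y)
  moreover have "(\<Sum>\<alpha>\<in>zsupports c. tslice c (t s) \<alpha> * (\<Sum>i\<in>UNIV. dmonom i \<alpha> (Y s) * Y' $ i) + dtslice c (t s) \<alpha> * t' * zmonom \<alpha> (Y s))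
    = (\<Sum>\<alpha>\<in>zsupports c. dtslice c (t s) \<alpha> * zmonom \<alpha> (Y s)) * t' + (\<Sum>i\<in>UNIV. zpartial (tslice c (t s)) i (Y s) * Y' $ i)"
  proof -
    have "(\<Sum>i\<in>UNIV. zpartial (tslice c (t s)) i (Y s) * Y' $ i) =
       (\<Sum>i\<in>UNIV. \<Sum>\<alpha>\<in>zsupports c. tslice c (t s) \<alpha> * (dmonom i \<alpha> (Y s) * Y' $ i))"
      unfolding zpartial_eq[OF finite_zsupports[OF c] zsupp_tslice_subset] sum_distrib_right
      by (simp add: mult.assoc)
    also have "\<dots> = (\<Sum>\<alpha>\<in>zsupports c. tslice c (t s) \<alpha> * (\<Sum>i\<in>UNIV. dmonom i \<alpha> (Y s) * Y' $ i))"
      by (subst sum.swap) (simp add: sum_distrib_left)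
    finally have P: "(\<Sum>i\<in>UNIV. zpartial (tslice c (t s)) i (Y s) * Y' $ i) =
       (\<Sum>\<alpha>\<in>zsupports c. tslice c (t s) \<alpha> * (\<Sum>i\<in>UNIV. dmonom i \<alpha> (Y s) * Y' $ i))" .
    have "(\<Sum>\<alpha>\<in>zsupports c. dtslice c (t s) \<alpha> * zmonom \<alpha> (Y s)) * t' = (\<Sum>\<alpha>\<in>zsupports c. dtslice c (t s) \<alpha> * t' * zmonom \<alpha> (Y s))"
      unfolding sum_distrib_right by (rule sum.cong) (simp_all add: mult_ac)
    then show ?thesis unfolding P sum.distrib by (simp only: add.commute)
  qed
  ultimately show ?thesis by (simp add: tzeval_eq(1)[OF c])
qed

lemma unif_lip_zmonom: "unif_lip \<epsilon> (\<lambda>s y. zmonom \<alpha> y)"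
  unfolding zmonom_def by (intro unif_lip_prod unif_lip_power unif_lip_nth)

lemma unif_lip_dmonom: "unif_lip \<epsilon> (\<lambda>s y. dmonom i \<alpha> y)"
  unfolding dmonom_def by (intro unif_lip_mult unif_lip_prod unif_lip_power unif_lip_nth unif_lip_const)

text \<open>Equality case of Cauchy-Schwarz: |p - (e / eps^2) cnj y|^2 <= |p|^2 - |e|^2 / eps^2, where e = p.y.\<close>
lemma gram_degenerate:
  fixes p :: "'n::finite \<Rightarrow> complex" and y :: "complex^'n"
  assumes y: "norm y \<le> \<epsilon>" and eps: "\<epsilon> > 0"
    and deg: "Re (of_real (\<epsilon>\<^sup>2) * (\<Sum>i\<in>UNIV. p i * cnj (p i)) - (\<Sum>i\<in>UNIV. p i * y $ i) * cnj (\<Sum>i\<in>UNIV. p i * y $ i)) \<le> 0"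
  obtains \<mu> where "\<And>i. p i = \<mu> * cnj (y $ i)" "norm y < \<epsilon> \<Longrightarrow> \<mu> = 0"
proof -
  define e where "e = (\<Sum>i\<in>UNIV. p i * y $ i)"
  define P where "P = (\<Sum>i\<in>UNIV. (norm (p i))\<^sup>2)"
  define \<mu> where "\<mu> = e / of_real (\<epsilon>\<^sup>2)"
  have sq: "z * cnj z = of_real ((norm z)\<^sup>2)" for z by (simp only: complex_norm_square)
  have "of_real (\<epsilon>\<^sup>2) * (\<Sum>i\<in>UNIV. p i * cnj (p i)) - e * cnj e = complex_of_real (\<epsilon>\<^sup>2 * P - (norm e)\<^sup>2)"
    unfolding sq P_def by simp
  then have deg': "\<epsilon>\<^sup>2 * P \<le> (norm e)\<^sup>2" using deg unfolding e_def[symmetric] by simp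
  have ny: "(norm y)\<^sup>2 = (\<Sum>i\<in>UNIV. (norm (y $ i))\<^sup>2)" by (simp add: norm_vec_def L2_set_def sum_nonneg)
  have ns: "(norm (a - b))\<^sup>2 = (norm a)\<^sup>2 - 2 * Re (a * cnj b) + (norm b)\<^sup>2" for a b :: complex
    unfolding cmod_power2 by (simp add: power2_eq_square algebra_simps)
  have "(\<Sum>i\<in>UNIV. (norm (p i - \<mu> * cnj (y $ i)))\<^sup>2) =
     (\<Sum>i\<in>UNIV. (norm (p i))\<^sup>2 - 2 * Re (cnj \<mu> * (p i * y $ i)) + (norm \<mu>)\<^sup>2 * (norm (y $ i))\<^sup>2)"
    unfolding ns by (intro sum.cong) (simp_all add: norm_mult power_mult_distrib mult.commute mult.left_commute)
  also have "\<dots> = P - 2 * Re (cnj \<mu> * e) + (norm \<mu>)\<^sup>2 * (norm y)\<^sup>2"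
    by (simp only: sum.distrib sum_subtractf sum_distrib_left[symmetric] Re_sum[symmetric] e_def P_def ny)
  also have "Re (cnj \<mu> * e) = (norm e)\<^sup>2 / \<epsilon>\<^sup>2"
  proof -
    have "cnj \<mu> * e = e * cnj e / of_real (\<epsilon>\<^sup>2)" by (simp add: \<mu>_def)
    also have "\<dots> = of_real ((norm e)\<^sup>2 / \<epsilon>\<^sup>2)" unfolding sq by (simp only: of_real_divide)
    finally show ?thesis by (simp only: Re_complex_of_real)
  qed
  also have "(norm \<mu>)\<^sup>2 = (norm e)\<^sup>2 / \<epsilon>\<^sup>2 / \<epsilon>\<^sup>2"
  proof -
    have "norm \<mu> = norm e / \<epsilon>\<^sup>2" by (simp add: \<mu>_def norm_divide norm_power)
    then show ?thesis by (simp add: power_divide power2_eq_square)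
  qed
  finally have S: "(\<Sum>i\<in>UNIV. (norm (p i - \<mu> * cnj (y $ i)))\<^sup>2) = P - 2 * ((norm e)\<^sup>2 / \<epsilon>\<^sup>2) + (norm e)\<^sup>2 / \<epsilon>\<^sup>2 * ((norm y)\<^sup>2 / \<epsilon>\<^sup>2)"
    by simp
  have Pe: "P \<le> (norm e)\<^sup>2 / \<epsilon>\<^sup>2" using deg' eps by (simp add: field_simps)
  have y1: "(norm y)\<^sup>2 / \<epsilon>\<^sup>2 \<le> 1" using y eps by (simp add: divide_le_eq power_mono)
  then have "(norm e)\<^sup>2 / \<epsilon>\<^sup>2 * ((norm y)\<^sup>2 / \<epsilon>\<^sup>2) \<le> (norm e)\<^sup>2 / \<epsilon>\<^sup>2" by (intro mult_left_le) auto
  then have "(\<Sum>i\<in>UNIV. (norm (p i - \<mu> * cnj (y $ i)))\<^sup>2) \<le> 0" using S Pe by linarith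
  then have z: "(\<Sum>i\<in>UNIV. (norm (p i - \<mu> * cnj (y $ i)))\<^sup>2) = 0" by (intro antisym sum_nonneg) auto
  then have "p i = \<mu> * cnj (y $ i)" for i by (simp add: sum_nonneg_eq_0_iff)
  moreover have "\<mu> = 0" if "norm y < \<epsilon>"
  proof (rule ccontr)
    assume "\<mu> \<noteq> 0"
    then have e: "(norm e)\<^sup>2 / \<epsilon>\<^sup>2 > 0" using eps by (auto simp: \<mu>_def)
    have "(norm y)\<^sup>2 / \<epsilon>\<^sup>2 < 1" using that eps by (simp add: divide_less_eq power_strict_mono)
    then have "(norm e)\<^sup>2 / \<epsilon>\<^sup>2 * ((norm y)\<^sup>2 / \<epsilon>\<^sup>2) < (norm e)\<^sup>2 / \<epsilon>\<^sup>2 * 1" using e by (intro mult_strict_left_mono)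
    then show False using S z Pe by simp
  qed
  ultimately show thesis using that by blast
qed

section \<open>The family along the segment from t to 0\<close>

context newton_family
begin

context
  fixes t :: complex
begin

text \<open>The orientation makes \<open>fam 0\<close> the function f_t and \<open>fam 1\<close> the
  function f_0, so transport from 0 to 1 has the direction required by
  \<open>milnor_fibrations_isomorphic\<close>.\<close>

definition path :: "real \<Rightarrow> complex" where "path s = of_real (1 - s) * t"

definition fam :: "real \<Rightarrow> complex^'n \<Rightarrow> complex" where
  "fam s y = (\<Prod>k\<in>{1..k0}. tzeval (F k) (path s) y)"

definition dfam :: "'n \<Rightarrow> real \<Rightarrow> complex^'n \<Rightarrow> complex" where
  "dfam i s y = (\<Sum>k\<in>{1..k0}. zpartial (G k (path s)) i y * (\<Prod>l\<in>{1..k0} - {k}. tzeval (F l) (path s) y))"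

definition sfam :: "real \<Rightarrow> complex^'n \<Rightarrow> complex" where
  "sfam s y = (\<Sum>k\<in>{1..k0}. (\<Sum>\<alpha>\<in>zsupports (F k). dtslice (F k) (path s) \<alpha> * zmonom \<alpha> y) * (- t) *
     (\<Prod>l\<in>{1..k0} - {k}. tzeval (F l) (path s) y))"

context
  fixes \<epsilon> :: real
  assumes t: "norm t \<le> \<rho> / 2" and eps: "\<epsilon> > 0" "\<epsilon>\<^sup>2 < R" and trans: "transversal_radius \<epsilon>"
begin

lemma path_continuous: "continuous_on A path"
  unfolding path_def[abs_def] by (intro continuous_intros)

lemma norm_path: "s \<in> {0..1} \<Longrightarrow> norm (path s) \<le> \<rho> / 2"
proof -
  assume "s \<in> {0..1}"
  then have "\<bar>1 - s\<bar> * norm t \<le> 1 * (\<rho> / 2)" using t by (intro mult_mono) auto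
  then show ?thesis unfolding path_def norm_mult norm_of_real by simp
qed

lemma unif_lip_tzeval:
  assumes "k \<in> {1..k0}"
  shows "unif_lip \<epsilon> (\<lambda>s y. tzeval (F k) (path s) y)"
  unfolding tzeval_eq(1)[OF poly[OF assms]] tslice_def
  by (intro unif_lip_sum unif_lip_mult unif_lip_zmonom unif_lip_param continuous_intros path_continuous)

lemma unif_lip_fam: "unif_lip \<epsilon> fam"
  unfolding fam_def[abs_def] by (intro unif_lip_prod unif_lip_tzeval)

lemma unif_lip_dfam: "unif_lip \<epsilon> (dfam i)"
  unfolding dfam_def[abs_def]
proof (intro unif_lip_sum unif_lip_mult unif_lip_prod)
  fix k assume k: "k \<in> {1..k0}"
  show "unif_lip \<epsilon> (\<lambda>s y. zpartial (G k (path s)) i y)"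
    unfolding G_def zpartial_eq[OF finite_zsupports[OF poly[OF k]] zsupp_tslice_subset] tslice_def
    by (intro unif_lip_sum unif_lip_mult unif_lip_dmonom unif_lip_param continuous_intros path_continuous)
qed (auto intro: unif_lip_tzeval)

lemma unif_lip_sfam: "unif_lip \<epsilon> sfam"
  unfolding sfam_def[abs_def] dtslice_def
  by (intro unif_lip_sum unif_lip_mult unif_lip_prod unif_lip_tzeval unif_lip_zmonom unif_lip_param continuous_intros path_continuous) auto

lemma fam_chain:
  assumes "(Y has_vector_derivative Y') (at s within {0..1})"
  shows "((\<lambda>s. fam s (Y s)) has_vector_derivative (sfam s (Y s) + (\<Sum>i\<in>UNIV. dfam i s (Y s) * Y' $ i))) (at s within {0..1})"
proof -
  have p: "(path has_vector_derivative - t) (at s within {0..1})"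
    unfolding path_def[abs_def] has_vector_derivative_def
    by (auto intro!: derivative_eq_intros simp: scaleR_conv_of_real)
  have "((\<lambda>s. fam s (Y s)) has_vector_derivative
    (\<Sum>k\<in>{1..k0}. ((\<Sum>\<alpha>\<in>zsupports (F k). dtslice (F k) (path s) \<alpha> * zmonom \<alpha> (Y s)) * (- t) +
      (\<Sum>i\<in>UNIV. zpartial (G k (path s)) i (Y s) * Y' $ i)) * (\<Prod>l\<in>{1..k0} - {k}. tzeval (F l) (path s) (Y s)))) (at s within {0..1})"
    unfolding fam_def G_def by (intro has_vector_derivative_prod has_vector_derivative_tzeval poly assms p)
  moreover have "(\<Sum>i\<in>UNIV. dfam i s (Y s) * Y' $ i) =
    (\<Sum>k\<in>{1..k0}. (\<Sum>i\<in>UNIV. zpartial (G k (path s)) i (Y s) * Y' $ i) * (\<Prod>l\<in>{1..k0} - {k}. tzeval (F l) (path s) (Y s)))"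
    unfolding dfam_def sum_distrib_right by (subst sum.swap) (simp add: algebra_simps)
  ultimately show ?thesis by (simp only: sfam_def distrib_right sum.distrib)
qed

text \<open>\<open>dfam\<close> is written without quotients so that it is Lipschitz across the
  zeros of the f^k; off these zeros it is given by the logarithmic derivative of a product.\<close>

lemma fam_logd:
  assumes "fam s y \<noteq> 0"
  shows "y $ i * dfam i s y = fam s y * (\<Sum>k\<in>{1..k0}. logd k (path s) y i / zeval (G k (path s)) y)"
  unfolding dfam_def sum_distrib_left
proof (rule sum.cong)
  fix k assume k: "k \<in> {1..k0}"
  have ev: "tzeval (F k) (path s) y = zeval (G k (path s)) y" unfolding G_def by (rule tzeval_eq(2)[OF poly[OF k]])
  have "fam s y = tzeval (F k) (path s) y * (\<Prod>l\<in>{1..k0} - {k}. tzeval (F l) (path s) y)"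
    unfolding fam_def by (rule prod.remove) (use k in auto)
  moreover from this assms have "tzeval (F k) (path s) y \<noteq> 0" by auto
  ultimately show "y $ i * (zpartial (G k (path s)) i y * (\<Prod>l\<in>{1..k0} - {k}. tzeval (F l) (path s) y)) =
      fam s y * (logd k (path s) y i / zeval (G k (path s)) y)"
    unfolding ev by (simp add: logd_def)
qed simp

text \<open>If no \<delta> worked, bad points with values tending to 0 would accumulate at a zero of
  f. At each of them \<open>gram_degenerate\<close> makes the gradient a multiple of the conjugate
  of y; multiplied by y_i and divided by f, this is the radial relation refuted by
  \<open>no_critical_sequence\<close>.\<close>

lemma fam_regular:
  obtains \<delta> where "\<delta> > 0"
    "\<And>s y. s \<in> {0..1} \<Longrightarrow> norm y \<le> \<epsilon> \<Longrightarrow> 0 < norm (fam s y) \<Longrightarrow> norm (fam s y) \<le> \<delta> \<Longrightarrow>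
      Re (of_real (\<epsilon>\<^sup>2) * (\<Sum>i\<in>UNIV. dfam i s y * cnj (dfam i s y)) -
        (\<Sum>i\<in>UNIV. dfam i s y * y $ i) * cnj (\<Sum>i\<in>UNIV. dfam i s y * y $ i)) > 0"
proof -
  define gr where "gr s y = Re (of_real (\<epsilon>\<^sup>2) * (\<Sum>i\<in>UNIV. dfam i s y * cnj (dfam i s y)) -
        (\<Sum>i\<in>UNIV. dfam i s y * y $ i) * cnj (\<Sum>i\<in>UNIV. dfam i s y * y $ i))" for s y
  have "\<exists>\<delta>>0. \<forall>s y. s \<in> {0..1} \<and> norm y \<le> \<epsilon> \<and> 0 < norm (fam s y) \<and> norm (fam s y) \<le> \<delta> \<longrightarrow> gr s y > 0"
  proof (rule ccontr)
    assume neg: "\<not> ?thesis"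
    have "\<exists>s y. s \<in> {0..1} \<and> norm y \<le> \<epsilon> \<and> 0 < norm (fam s y) \<and> norm (fam s y) \<le> 1 / real (Suc m) \<and> \<not> gr s y > 0" for m
    proof -
      have "1 / real (Suc m) > 0" by simp
      then show ?thesis using neg by blast
    qed
    then obtain s y where sy: "\<And>m. s m \<in> {0..1}" "\<And>m. norm (y m) \<le> \<epsilon>" "\<And>m. 0 < norm (fam (s m) (y m))"
      "\<And>m. norm (fam (s m) (y m)) \<le> 1 / real (Suc m)" "\<And>m. \<not> gr (s m) (y m) > 0" by metis
    let ?K = "{0..1::real} \<times> cball (0::complex^'n) \<epsilon>"
    have "compact ?K" by (intro compact_Times compact_Icc compact_cball)
    then have sc: "seq_compact ?K" by (rule compact_imp_seq_compact)
    have "\<forall>m. (s m, y m) \<in> ?K" using sy by simp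
    from seq_compactE[OF sc this] obtain a r where a: "a \<in> ?K" "strict_mono (r :: nat \<Rightarrow> nat)"
      "((\<lambda>m. (s m, y m)) \<circ> r) \<longlonglongrightarrow> a" by blast
    define s0 z0 where "s0 = fst a" and "z0 = snd a"
    have s0: "s0 \<in> {0..1}" and z0: "norm z0 \<le> \<epsilon>" using a(1) by (auto simp: s0_def z0_def mem_Times_iff)
    have slim: "(\<lambda>m. s (r m)) \<longlonglongrightarrow> s0" and ylim: "(\<lambda>m. y (r m)) \<longlonglongrightarrow> z0"
      using tendsto_fst[OF a(3)] tendsto_snd[OF a(3)] by (simp_all add: o_def s0_def z0_def)
    have "continuous_on ?K (\<lambda>(s, y). fam s y)" using unif_lip_fam by (simp add: unif_lip_def)
    from continuous_on_tendsto_compose[OF this a(3) a(1)]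
    have "(\<lambda>m. (\<lambda>(s, y). fam s y) (((\<lambda>m. (s m, y m)) \<circ> r) m)) \<longlonglongrightarrow> (\<lambda>(s, y). fam s y) a"
      using sy(1,2) by simp
    then have famlim: "(\<lambda>m. fam (s (r m)) (y (r m))) \<longlonglongrightarrow> fam s0 z0"
      by (simp add: o_def s0_def z0_def case_prod_beta)
    have "(\<lambda>m. fam (s m) (y m)) \<longlonglongrightarrow> 0"
      by (rule Lim_null_comparison[OF _ LIMSEQ_inverse_real_of_nat]) (use sy(4) in \<open>simp add: inverse_eq_divide\<close>)
    from LIMSEQ_subseq_LIMSEQ[OF this a(2)] famlim have "fam s0 z0 = 0"
      using LIMSEQ_unique by (force simp: o_def)
    then obtain kz where kz: "kz \<in> {1..k0}" "zeval (G kz (path s0)) z0 = 0"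
      unfolding fam_def G_def by (auto simp: tzeval_eq(2)[OF poly])
    have "\<exists>\<mu>. (\<forall>i. dfam i (s m) (y m) = \<mu> * cnj (y m $ i)) \<and> (norm (y m) < \<epsilon> \<longrightarrow> \<mu> = 0)" for m
    proof -
      have "gr (s m) (y m) \<le> 0" using sy(5)[of m] by simp
      from gram_degenerate[OF sy(2) eps(1) this[unfolded gr_def]] show ?thesis by metis
    qed
    then obtain \<mu> where \<mu>: "\<And>m i. dfam i (s m) (y m) = \<mu> m * cnj (y m $ i)" "\<And>m. norm (y m) < \<epsilon> \<Longrightarrow> \<mu> m = 0" by metis
    \<comment> \<open>If the limit is the origin, late points lie inside the open ball, where the
      radial coefficient is 0. Dropping M terms makes this true of the whole sequence.\<close>
    obtain M where M: "\<And>m. z0 = 0 \<Longrightarrow> m \<ge> M \<Longrightarrow> norm (y (r m)) < \<epsilon>"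
    proof (cases "z0 = 0")
      case True
      then have "\<forall>\<^sub>F m in sequentially. norm (y (r m)) < \<epsilon>"
        using tendsto_norm[OF ylim] eps by (intro order_tendstoD(2)) auto
      then show thesis using that by (auto simp: eventually_sequentially)
    qed (use that in blast)
    define q where "q m = r (m + M)" for m
    have plim: "(\<lambda>m. path (s (q m))) \<longlonglongrightarrow> path s0"
      unfolding path_def q_def by (intro tendsto_intros LIMSEQ_ignore_initial_segment[OF slim])
    have yl: "(\<lambda>m. y (q m)) \<longlonglongrightarrow> z0" unfolding q_def by (rule LIMSEQ_ignore_initial_segment[OF ylim])
    have fz: "fam (s m) (y m) \<noteq> 0" for m using sy(3)[of m] by simp
    show False
    proof (rule no_critical_sequence[OF eps(2) trans norm_path[OF s0] z0 plim _ yl])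
      show "norm (path (s (q m))) < \<rho>" for m using norm_path[OF sy(1)[of "q m"]] \<rho> by linarith
      show "zeval (G k (path (s (q m)))) (y (q m)) \<noteq> 0" if k: "k \<in> {1..k0}" for k m
        using fz[of "q m"] k unfolding fam_def G_def by (auto simp: tzeval_eq(2)[OF poly])
      show "(\<Sum>k\<in>{1..k0}. logd k (path (s (q m))) (y (q m)) i / zeval (G k (path (s (q m)))) (y (q m))) =
          \<mu> (q m) / fam (s (q m)) (y (q m)) * of_real ((norm (y (q m) $ i))\<^sup>2)" for m i
        using fam_logd[OF fz[of "q m"], of i] \<mu>(1)[of i "q m"] fz[of "q m"]
        by (simp add: complex_norm_square field_simps del: of_real_power)
      show "\<mu> (q m) / fam (s (q m)) (y (q m)) = 0" if "z0 = 0" for m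
        using \<mu>(2)[OF M[OF that]] by (simp add: q_def)
    qed (use kz in auto)
  qed
  then show thesis using that unfolding gr_def by blast
qed

lemma milnor_spaces_homeomorphic:
  "\<exists>\<delta>0>0. \<forall>\<delta>. 0 < \<delta> \<and> \<delta> \<le> \<delta>0 \<longrightarrow>
     (\<exists>\<Phi> \<Psi>. homeomorphism (milnor_space (fam 0) \<epsilon> \<delta>) (milnor_space (fam 1) \<epsilon> \<delta>) \<Phi> \<Psi> \<and>
       (\<forall>z\<in>milnor_space (fam 0) \<epsilon> \<delta>. fam 1 (\<Phi> z) = fam 0 z))"
proof -
  obtain \<delta>0 where \<delta>0: "\<delta>0 > 0" "\<And>s y. s \<in> {0..1} \<Longrightarrow> norm y \<le> \<epsilon> \<Longrightarrow> 0 < norm (fam s y) \<Longrightarrow> norm (fam s y) \<le> \<delta>0 \<Longrightarrow>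
      Re (of_real (\<epsilon>\<^sup>2) * (\<Sum>i\<in>UNIV. dfam i s y * cnj (dfam i s y)) -
        (\<Sum>i\<in>UNIV. dfam i s y * y $ i) * cnj (\<Sum>i\<in>UNIV. dfam i s y * y $ i)) > 0"
    using fam_regular by blast
  show ?thesis
  proof (intro exI[of _ \<delta>0] conjI allI impI \<delta>0(1))
    fix \<delta> :: real assume \<delta>: "0 < \<delta> \<and> \<delta> \<le> \<delta>0"
    interpret fibred_family \<epsilon> \<delta> fam sfam dfam "\<lambda>s y. \<Sum>i\<in>UNIV. dfam i s y * y $ i"
      "\<lambda>s y. of_real (\<epsilon>\<^sup>2) * (\<Sum>i\<in>UNIV. dfam i s y * cnj (dfam i s y)) -
        (\<Sum>i\<in>UNIV. dfam i s y * y $ i) * cnj (\<Sum>i\<in>UNIV. dfam i s y * y $ i)"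
    proof unfold_locales
      show "0 < Re (of_real (\<epsilon>\<^sup>2) * (\<Sum>i\<in>UNIV. dfam i s y * cnj (dfam i s y)) -
        (\<Sum>i\<in>UNIV. dfam i s y * y $ i) * cnj (\<Sum>i\<in>UNIV. dfam i s y * y $ i))"
        if "s \<in> {0..1}" "norm y \<le> \<epsilon>" "0 < norm (fam s y)" "norm (fam s y) \<le> \<delta>" for s y
        using \<delta>0(2)[OF that(1-3)] that(4) \<delta> by linarith
    qed (use \<delta> eps in \<open>auto intro: unif_lip_fam unif_lip_dfam unif_lip_sfam fam_chain\<close>)
    have "total s = milnor_space (fam s) \<epsilon> \<delta>" for s by (simp add: total_def milnor_space_def)
    then show "\<exists>\<Phi> \<Psi>. homeomorphism (milnor_space (fam 0) \<epsilon> \<delta>) (milnor_space (fam 1) \<epsilon> \<delta>) \<Phi> \<Psi> \<and>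
       (\<forall>z\<in>milnor_space (fam 0) \<epsilon> \<delta>. fam 1 (\<Phi> z) = fam 0 z)"
      using total_space_homeomorphism by simp
  qed
qed

end

end

end

theorem theorem5p3:
  fixes k0 :: nat
    and F :: "nat \<Rightarrow> nat \<Rightarrow> nat^'n \<Rightarrow> complex"
  assumes poly: "\<forall>k\<in>{1..k0}. is_tzpoly (F k)"
    and nonconst: "\<forall>k\<in>{1..k0}. nonconstant_tzpoly (F k)"
    and vanish: "\<forall>k\<in>{1..k0}. \<forall>t. tzeval (F k) t 0 = 0"
    and adm: "newton_admissible k0 F"
  shows "\<exists>\<rho>>0. \<forall>t. norm t < \<rho> \<longrightarrow>
           milnor_fibrations_isomorphic
             (\<lambda>z. \<Prod>k\<in>{1..k0}. tzeval (F k) t z)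
             (\<lambda>z. \<Prod>k\<in>{1..k0}. tzeval (F k) 0 z)"
proof -
  obtain R \<rho> where R: "R > 0" and \<rho>: "\<rho> > 0" and A: "\<forall>t. norm t < \<rho> \<longrightarrow>
        (\<forall>k\<in>{1..k0}. newton_boundary (tslice (F k) t) = newton_boundary (tslice (F k) 0)) \<and>
        (\<forall>S. S \<noteq> {} \<and> S \<subseteq> {1..k0} \<longrightarrow>
           nondegenerate_ci S (\<lambda>k. tslice (F k) t) \<and>
           (\<exists>R'>R. tameness_radius R' S (\<lambda>k. tslice (F k) t)))"
    using adm unfolding newton_admissible_def by (elim exE conjE) (rule that)
  interpret newton_family k0 F R \<rho> "\<lambda>k t. tslice (F k) t" "\<lambda>k. {\<alpha>. \<exists>t. norm t < \<rho> \<and> tslice (F k) t \<alpha> \<noteq> 0}"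
  proof unfold_locales
    show "is_tzpoly (F k)" if "k \<in> {1..k0}" for k using poly that by blast
    show "0 < R" "0 < \<rho>" by fact+
    fix t :: complex assume t: "norm t < \<rho>"
    note A = A[rule_format, OF t]
    show "newton_boundary (tslice (F k) t) = newton_boundary (tslice (F k) 0)" if "k \<in> {1..k0}" for k
      using A that by blast
    show "nondegenerate_ci S (\<lambda>k. tslice (F k) t)" "\<exists>R'>R. tameness_radius R' S (\<lambda>k. tslice (F k) t)"
      if "S \<noteq> {}" "S \<subseteq> {1..k0}" for S using A that by blast+
  qed
  obtain \<epsilon>0 where \<epsilon>0: "\<epsilon>0 > 0" "\<epsilon>0\<^sup>2 < R" "transversal_radius \<epsilon>0" by (rule transversal_radius_exists)
  show ?thesis
  \<comment> \<open>Half of \<rho> leaves room for limits: parameters of modulus at most \<rho> / 2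
    accumulate only where admissibility is known.\<close>
  proof (intro exI[of _ "\<rho> / 2"] conjI allI impI)
    show "\<rho> / 2 > 0" using \<rho> by simp
    fix t :: complex assume t: "norm t < \<rho> / 2"
    show "milnor_fibrations_isomorphic (\<lambda>z. \<Prod>k\<in>{1..k0}. tzeval (F k) t z) (\<lambda>z. \<Prod>k\<in>{1..k0}. tzeval (F k) 0 z)"
      unfolding milnor_fibrations_isomorphic_def
    proof (rule exI[of _ \<epsilon>0], intro conjI allI impI \<epsilon>0(1))
      fix \<epsilon> :: real assume \<epsilon>: "0 < \<epsilon> \<and> \<epsilon> \<le> \<epsilon>0"
      have "\<epsilon>\<^sup>2 \<le> \<epsilon>0\<^sup>2" using \<epsilon> by (intro power_mono) auto
      then have "\<epsilon>\<^sup>2 < R" using \<epsilon>0 by linarith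
      moreover have "transversal_radius \<epsilon>"
        using \<epsilon>0(3) \<epsilon> unfolding transversal_radius_def by (meson order_trans)
      ultimately show "\<exists>\<delta>0>0. \<forall>\<delta>. 0 < \<delta> \<and> \<delta> \<le> \<delta>0 \<longrightarrow>
          (\<exists>\<Phi> \<Psi>. homeomorphism (milnor_space (\<lambda>z. \<Prod>k\<in>{1..k0}. tzeval (F k) t z) \<epsilon> \<delta>)
             (milnor_space (\<lambda>z. \<Prod>k\<in>{1..k0}. tzeval (F k) 0 z) \<epsilon> \<delta>) \<Phi> \<Psi> \<and>
             (\<forall>z\<in>milnor_space (\<lambda>z. \<Prod>k\<in>{1..k0}. tzeval (F k) t z) \<epsilon> \<delta>.
                (\<Prod>k\<in>{1..k0}. tzeval (F k) 0 (\<Phi> z)) = (\<Prod>k\<in>{1..k0}. tzeval (F k) t z)))"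
        using milnor_spaces_homeomorphic[of t \<epsilon>] t \<epsilon> by (simp add: fam_def[abs_def] path_def)
    qed
  qed
qed

end
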